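(* Let $K$ be a field and let $\mathcal{C}$ be a Hom-finite, Krull–Schmidt, 2-Calabi–Yau triangulated $K$-category. Let $Q$ be the coloured quiver associated with a basic rigid object $R=R_1\oplus\cdots\oplus R_m\in\mathcal{C}$ (with $R_i$ indecomposable), and let $\widetilde{Q}$ be the coloured quiver associated with $\mu_kR$, for some vertex $k$ of $Q$. Denote the periodicity associated with vertex $i$ of $Q$ (resp. $\widetilde{Q}$) by $d_i$ (resp. $\tilde{d}_i$), and the numbers of $c$-coloured arrows by $q_{(c)}$ (resp. $\widetilde{q}_{(c)}$). (i) We have $d_k=\tilde{d}_k$, and for any $j\in Q_0$ and any $c\in\mathbb{Z}/d_k$, $\widetilde{q}_{(c)}(k,j)=q_{(c+1)}(k,j)$. (ii) Let $i,j\in Q_0$, both different from $k$, be such that $q_{(0)}(k,j)=0=q_{(0)}(k,i)$. Then: - $\tilde{d}_i=d_i$ and $\tilde{d}_j=d_j$; - for any $c\in\mathbb{Z}/d_j$, $\widetilde{q}_{(c)}(j,k)=q_{(c-1)}(j,k)$; - for any $c\in\mathbb{Z}/d_i$, $\widetilde{q}_{(c)}(i,j)=q_{(c)}(i,j)$.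
   Context: $\Sigma$ denotes the shift of $\mathcal{C}$; 2-Calabi–Yau means there are bifunctorial isomorphisms $\mathcal{C}(X,\Sigma Y)\simeq\operatorname{Hom}_K(\mathcal{C}(Y,\Sigma X),K)$. An object $R$ is rigid if $\mathcal{C}(R,\Sigma R)=0$; all rigid objects are basic (summands pairwise non-isomorphic). **Exchange triangles, twist, mutation.** Let $R$ be basic rigid and let $X$ be indecomposable rigid, not in $\operatorname{add}R$, with $\mathcal{C}(X,\Sigma R)=0=\mathcal{C}(R,\Sigma X)$. The exchange triangles of $X$ with respect to $R$ are the triangles $$X^{(c)}\xrightarrow{f^c}B^{(c)}\xrightarrow{g^c}X^{(c+1)}\to\Sigma X^{(c)},\qquad c\in\mathbb{Z},\ X^{(0)}=X,$$ where $f^c$ is a minimal left $\operatorname{add}R$-approximation and $g^c$ is a minimal right $\operatorname{add}R$-approximation. Each $X^{(c)}$ is indecomposable rigid and Ext-orthogonal to $R$. The twist of $X$ with respect to $R$ is $\kappa_RX=X^{(1)}$. For $R=R_1\oplus\cdots\oplus R_m$ the mutation of $R$ at $R_k$ is $\mu_kR=R/R_k\oplus\kappa_{R/R_k}R_k$; its summands are indexed by $\{1,\dots,m\}$ with $\kappa_{R/R_k}R_k$ at index $k$ and $R_i$ at index $i\ne k$. **Coloured quiver.** For an integer $d>0$, $\mathbb{Z}/d$ is identified with $\{0,\dots,d-1\}$, and $\mathbb{Z}/0=\mathbb{Z}$. The coloured quiver $Q_R$ has vertex set $Q_0=\{1,\dots,m\}$. Vertex $i$ is labelled with the periodicity $d_i$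 of the sequence of exchange triangles $R_i^{(c)}\to B_i^{(c)}\to R_i^{(c+1)}\to\Sigma R_i^{(c)}$ of $R_i$ with respect to $R/R_i$ (the smallest $d>0$ with $R_i^{(d)}\simeq R_i$; if there is none, the period is infinite, and colours range over $\mathbb{Z}$). For vertices $i,j$ and $c\in\mathbb{Z}/d_i$, the number $q_{(c)}(i,j)$ of $c$-coloured arrows from $i$ to $j$ is the multiplicity of $R_j$ in $B_i^{(c)}$ (so there are no loops). *)

theory Defs
  imports Complex_Main "HOL-Library.FuncSet"
begin

section \<open>Linear categories\<close>

text \<open>
  The hom spaces of a category are subspaces of one vector space of type \<open>'a\<close>, and are allowed to
  overlap (they all contain \<open>0\<close>), so a morphism does not determine its source and target; notions
  that depend on these take them as arguments. Any small linear category has this form: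
  take for the vector space the direct sum of all hom spaces, and extend composition bilinearly (by
  zero on non-composable summands) and functors linearly. Nothing is required of \<open>Comp\<close> outside
  the hom spaces.
\<close>

record ('o, 'a, 'k) linear_cat =
  Ob :: "'o set"
  Hom :: "'o \<Rightarrow> 'o \<Rightarrow> 'a set"
  Comp :: "'a \<Rightarrow> 'a \<Rightarrow> 'a"  (infixl \<open>\<cdot>\<index>\<close> 75)
  Ident :: "'o \<Rightarrow> 'a"
  Scale :: "'k \<Rightarrow> 'a \<Rightarrow> 'a"

locale linear_category =
  fixes C :: "('o, 'a::ab_group_add, 'k::field, 'z) linear_cat_scheme" (structure)
  assumes vector_space_Scale: "vector_space (Scale C)"
    and subspace_Hom:
      "\<lbrakk>X \<in> Ob C; Y \<in> Ob C\<rbrakk> \<Longrightarrow> module.subspace (Scale C) (Hom C X Y)"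
    and Comp_in_Hom:
      "\<lbrakk>X \<in> Ob C; Y \<in> Ob C; Z \<in> Ob C; f \<in> Hom C X Y; g \<in> Hom C Y Z\<rbrakk>
        \<Longrightarrow> g \<cdot> f \<in> Hom C X Z"
    and Comp_assoc:
      "\<lbrakk>W \<in> Ob C; X \<in> Ob C; Y \<in> Ob C; Z \<in> Ob C;
        f \<in> Hom C W X; g \<in> Hom C X Y; h \<in> Hom C Y Z\<rbrakk>
        \<Longrightarrow> (h \<cdot> g) \<cdot> f = h \<cdot> (g \<cdot> f)"
    and Ident_in_Hom: "X \<in> Ob C \<Longrightarrow> Ident C X \<in> Hom C X X"
    and Comp_Ident:
      "\<lbrakk>X \<in> Ob C; Y \<in> Ob C; f \<in> Hom C X Y\<rbrakk> \<Longrightarrow> f \<cdot> Ident C X = f"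
    and Ident_Comp:
      "\<lbrakk>X \<in> Ob C; Y \<in> Ob C; f \<in> Hom C X Y\<rbrakk> \<Longrightarrow> Ident C Y \<cdot> f = f"
    and Comp_add_right:
      "\<lbrakk>X \<in> Ob C; Y \<in> Ob C; Z \<in> Ob C; f \<in> Hom C X Y; f' \<in> Hom C X Y; g \<in> Hom C Y Z\<rbrakk>
        \<Longrightarrow> g \<cdot> (f + f') = g \<cdot> f + g \<cdot> f'"
    and Comp_add_left:
      "\<lbrakk>X \<in> Ob C; Y \<in> Ob C; Z \<in> Ob C; f \<in> Hom C X Y; g \<in> Hom C Y Z; g' \<in> Hom C Y Z\<rbrakk>
        \<Longrightarrow> (g + g') \<cdot> f = g \<cdot> f + g' \<cdot> f"
    and Comp_Scale_right:
      "\<lbrakk>X \<in> Ob C; Y \<in> Ob C; Z \<in> Ob C; f \<in> Hom C X Y; g \<in> Hom C Y Z\<rbrakk>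
        \<Longrightarrow> g \<cdot> Scale C r f = Scale C r (g \<cdot> f)"
    and Comp_Scale_left:
      "\<lbrakk>X \<in> Ob C; Y \<in> Ob C; Z \<in> Ob C; f \<in> Hom C X Y; g \<in> Hom C Y Z\<rbrakk>
        \<Longrightarrow> Scale C r g \<cdot> f = Scale C r (g \<cdot> f)"

definition iso_mor :: "('o, 'a, 'k, 'z) linear_cat_scheme \<Rightarrow> 'o \<Rightarrow> 'o \<Rightarrow> 'a \<Rightarrow> bool" where
  "iso_mor C X Y f \<longleftrightarrow>
     f \<in> Hom C X Y \<and>
     (\<exists>g \<in> Hom C Y X. g \<cdot>\<^bsub>C\<^esub> f = Ident C X \<and> f \<cdot>\<^bsub>C\<^esub> g = Ident C Y)"

definition isomorphic :: "('o, 'a, 'k, 'z) linear_cat_scheme \<Rightarrow> 'o \<Rightarrow> 'o \<Rightarrow> bool" where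
  "isomorphic C X Y \<longleftrightarrow> (\<exists>f. iso_mor C X Y f)"

definition zero_object :: "('o, 'a::zero, 'k, 'z) linear_cat_scheme \<Rightarrow> 'o \<Rightarrow> bool" where
  "zero_object C X \<longleftrightarrow> X \<in> Ob C \<and> Ident C X = 0"

definition direct_sum_of ::
  "('o, 'a::comm_monoid_add, 'k, 'z) linear_cat_scheme \<Rightarrow> 'i set \<Rightarrow> ('i \<Rightarrow> 'o) \<Rightarrow> 'o \<Rightarrow> bool"
where
  "direct_sum_of C I X S \<longleftrightarrow>
     finite I \<and> S \<in> Ob C \<and> (\<forall>i\<in>I. X i \<in> Ob C) \<and>
     (\<exists>\<iota> \<pi>.
        (\<forall>i\<in>I. \<iota> i \<in> Hom C (X i) S \<and> \<pi> i \<in> Hom C S (X i)) \<and>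
        (\<forall>i\<in>I. \<forall>j\<in>I. \<pi> j \<cdot>\<^bsub>C\<^esub> \<iota> i = (if i = j then Ident C (X i) else 0)) \<and>
        (\<Sum>i\<in>I. \<iota> i \<cdot>\<^bsub>C\<^esub> \<pi> i) = Ident C S)"

abbreviation direct_sum2 ::
  "('o, 'a::comm_monoid_add, 'k, 'z) linear_cat_scheme \<Rightarrow> 'o \<Rightarrow> 'o \<Rightarrow> 'o \<Rightarrow> bool"
where
  "direct_sum2 C X Y S \<equiv> direct_sum_of C (UNIV :: bool set) (\<lambda>b. if b then X else Y) S"

text \<open>The case \<open>I = {}\<close> below provides a zero object.\<close>

locale additive_category = linear_category C
  for C :: "('o, 'a::ab_group_add, 'k::field, 'z) linear_cat_scheme" (structure) +
  assumes ex_direct_sum: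
    "\<And>(I :: nat set) X. finite I \<Longrightarrow> \<forall>i\<in>I. X i \<in> Ob C \<Longrightarrow> \<exists>S. direct_sum_of C I X S"

definition hom_finite ::
  "('o, 'a::ab_group_add, 'k::field, 'z) linear_cat_scheme \<Rightarrow> bool"
where
  "hom_finite C \<longleftrightarrow>
     (\<forall>X \<in> Ob C. \<forall>Y \<in> Ob C. \<exists>B. finite B \<and> Hom C X Y = module.span (Scale C) B)"

definition indecomposable ::
  "('o, 'a::comm_monoid_add, 'k, 'z) linear_cat_scheme \<Rightarrow> 'o \<Rightarrow> bool"
where
  "indecomposable C X \<longleftrightarrow>
     X \<in> Ob C \<and> \<not> zero_object C X \<and>
     (\<forall>Y Z. direct_sum2 C Y Z X \<longrightarrow> zero_object C Y \<or> zero_object C Z)"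

text \<open>The endomorphism ring is local: it is nonzero and its non-units are closed under addition.\<close>

definition local_End ::
  "('o, 'a::comm_monoid_add, 'k, 'z) linear_cat_scheme \<Rightarrow> 'o \<Rightarrow> bool"
where
  "local_End C X \<longleftrightarrow>
     Ident C X \<noteq> 0 \<and>
     (\<forall>f \<in> Hom C X X. \<forall>g \<in> Hom C X X.
        \<not> iso_mor C X X f \<longrightarrow> \<not> iso_mor C X X g \<longrightarrow> \<not> iso_mor C X X (f + g))"

definition krull_schmidt ::
  "('o, 'a::comm_monoid_add, 'k, 'z) linear_cat_scheme \<Rightarrow> bool"
where
  "krull_schmidt C \<longleftrightarrow>
     (\<forall>X \<in> Ob C. \<exists>(n::nat) Y.
        direct_sum_of C {..<n} Y X \<and> (\<forall>i<n. local_End C (Y i)))"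

text \<open>
  The description is unique because, in a Krull-Schmidt category, the decomposition into
  indecomposables is unique up to isomorphism and permutation.
\<close>

definition multiplicity ::
  "('o, 'a::comm_monoid_add, 'k, 'z) linear_cat_scheme \<Rightarrow> 'o \<Rightarrow> 'o \<Rightarrow> nat"
where
  "multiplicity C X B =
     (THE r. \<exists>(n::nat) Y.
        direct_sum_of C {..<n} Y B \<and> (\<forall>i<n. indecomposable C (Y i)) \<and>
        r = card {i. i < n \<and> isomorphic C (Y i) X})"

definition add_closure ::
  "('o, 'a::comm_monoid_add, 'k, 'z) linear_cat_scheme \<Rightarrow> 'o \<Rightarrow> 'o set"
where
  "add_closure C R =
     {X \<in> Ob C. \<exists>(n::nat) Y S. direct_sum_of C {..<n} (\<lambda>_. R) S \<and> direct_sum2 C X Y S}"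

section \<open>Minimal approximations\<close>

definition left_approximation ::
  "('o, 'a, 'k, 'z) linear_cat_scheme \<Rightarrow> 'o set \<Rightarrow> 'o \<Rightarrow> 'o \<Rightarrow> 'a \<Rightarrow> bool"
where
  "left_approximation C \<A> X B f \<longleftrightarrow>
     B \<in> \<A> \<and> f \<in> Hom C X B \<and>
     (\<forall>A \<in> \<A>. \<forall>u \<in> Hom C X A. \<exists>v \<in> Hom C B A. v \<cdot>\<^bsub>C\<^esub> f = u)"

definition right_approximation ::
  "('o, 'a, 'k, 'z) linear_cat_scheme \<Rightarrow> 'o set \<Rightarrow> 'o \<Rightarrow> 'o \<Rightarrow> 'a \<Rightarrow> bool"
where
  "right_approximation C \<A> B Y g \<longleftrightarrow>
     B \<in> \<A> \<and> g \<in> Hom C B Y \<and>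
     (\<forall>A \<in> \<A>. \<forall>u \<in> Hom C A Y. \<exists>v \<in> Hom C A B. g \<cdot>\<^bsub>C\<^esub> v = u)"

definition left_minimal ::
  "('o, 'a, 'k, 'z) linear_cat_scheme \<Rightarrow> 'o \<Rightarrow> 'a \<Rightarrow> bool"
where
  "left_minimal C B f \<longleftrightarrow> (\<forall>v \<in> Hom C B B. v \<cdot>\<^bsub>C\<^esub> f = f \<longrightarrow> iso_mor C B B v)"

definition right_minimal ::
  "('o, 'a, 'k, 'z) linear_cat_scheme \<Rightarrow> 'o \<Rightarrow> 'a \<Rightarrow> bool"
where
  "right_minimal C B g \<longleftrightarrow> (\<forall>v \<in> Hom C B B. g \<cdot>\<^bsub>C\<^esub> v = g \<longrightarrow> iso_mor C B B v)"

section \<open>Triangulated categories\<close>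

record ('o, 'a, 'k) triangulated_cat = "('o, 'a, 'k) linear_cat" +
  ShO :: "'o \<Rightarrow> 'o"
  ShM :: "'a \<Rightarrow> 'a"
  Tri :: "'o \<Rightarrow> 'o \<Rightarrow> 'o \<Rightarrow> 'a \<Rightarrow> 'a \<Rightarrow> 'a \<Rightarrow> bool"

text \<open>
  \<open>Tri C X Y Z f g h\<close> says that \<open>X \<rightarrow> Y \<rightarrow> Z \<rightarrow> \<Sigma>X\<close>, with maps \<open>f\<close>, \<open>g\<close>, \<open>h\<close>, is a distinguished triangle.
  The shift is only required to be a linear autoequivalence, not an automorphism.
\<close>

locale triangulated_category = additive_category C
  for C :: "('o, 'a::ab_group_add, 'k::field, 'z) triangulated_cat_scheme" (structure) +
  assumes ShO_Ob: "X \<in> Ob C \<Longrightarrow> ShO C X \<in> Ob C"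
    and ShM_bij:
      "\<lbrakk>X \<in> Ob C; Y \<in> Ob C\<rbrakk>
        \<Longrightarrow> bij_betw (ShM C) (Hom C X Y) (Hom C (ShO C X) (ShO C Y))"
    and ShM_add:
      "\<lbrakk>X \<in> Ob C; Y \<in> Ob C; f \<in> Hom C X Y; f' \<in> Hom C X Y\<rbrakk>
        \<Longrightarrow> ShM C (f + f') = ShM C f + ShM C f'"
    and ShM_Scale:
      "\<lbrakk>X \<in> Ob C; Y \<in> Ob C; f \<in> Hom C X Y\<rbrakk>
        \<Longrightarrow> ShM C (Scale C r f) = Scale C r (ShM C f)"
    and ShM_Ident: "X \<in> Ob C \<Longrightarrow> ShM C (Ident C X) = Ident C (ShO C X)"
    and ShM_Comp:
      "\<lbrakk>X \<in> Ob C; Y \<in> Ob C; Z \<in> Ob C; f \<in> Hom C X Y; g \<in> Hom C Y Z\<rbrakk>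
        \<Longrightarrow> ShM C (g \<cdot> f) = ShM C g \<cdot> ShM C f"
    and ShO_ess_surj: "Y \<in> Ob C \<Longrightarrow> \<exists>X \<in> Ob C. isomorphic C (ShO C X) Y"
    and Tri_typed:
      "Tri C X Y Z f g h \<Longrightarrow>
         X \<in> Ob C \<and> Y \<in> Ob C \<and> Z \<in> Ob C \<and>
         f \<in> Hom C X Y \<and> g \<in> Hom C Y Z \<and> h \<in> Hom C Z (ShO C X)"
    and Tri_iso:
      "\<lbrakk>Tri C X Y Z f g h;
        X' \<in> Ob C; Y' \<in> Ob C; Z' \<in> Ob C;
        f' \<in> Hom C X' Y'; g' \<in> Hom C Y' Z'; h' \<in> Hom C Z' (ShO C X');
        iso_mor C X X' a; iso_mor C Y Y' b; iso_mor C Z Z' c;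
        f' \<cdot> a = b \<cdot> f; g' \<cdot> b = c \<cdot> g; h' \<cdot> c = ShM C a \<cdot> h\<rbrakk>
        \<Longrightarrow> Tri C X' Y' Z' f' g' h'"
    and Tri_Ident:
      "\<lbrakk>X \<in> Ob C; zero_object C Z\<rbrakk> \<Longrightarrow> Tri C X X Z (Ident C X) 0 0"
    and Tri_complete:
      "\<lbrakk>X \<in> Ob C; Y \<in> Ob C; f \<in> Hom C X Y\<rbrakk> \<Longrightarrow> \<exists>Z g h. Tri C X Y Z f g h"
    and Tri_rotate:
      "\<lbrakk>X \<in> Ob C; Y \<in> Ob C; Z \<in> Ob C;
        f \<in> Hom C X Y; g \<in> Hom C Y Z; h \<in> Hom C Z (ShO C X)\<rbrakk>
        \<Longrightarrow> Tri C X Y Z f g h \<longleftrightarrow> Tri C Y Z (ShO C X) g h (- ShM C f)"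
    and Tri_morphism:
      "\<lbrakk>Tri C X Y Z f g h; Tri C X' Y' Z' f' g' h';
        a \<in> Hom C X X'; b \<in> Hom C Y Y'; f' \<cdot> a = b \<cdot> f\<rbrakk>
        \<Longrightarrow> \<exists>c \<in> Hom C Z Z'. g' \<cdot> b = c \<cdot> g \<and> h' \<cdot> c = ShM C a \<cdot> h"
    and Tri_octahedral:
      "\<lbrakk>Tri C X Y Z' f i i'; Tri C Y Z X' g j j'; Tri C X Z Y' (g \<cdot> f) k k'\<rbrakk>
        \<Longrightarrow> \<exists>u v. Tri C Z' Y' X' u v (ShM C i \<cdot> j') \<and>
               u \<cdot> i = k \<cdot> g \<and> k' \<cdot> u = i' \<and>
               v \<cdot> k = j \<and> j' \<cdot> v = ShM C f \<cdot> k'"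

text \<open>
  The dual of a subspace \<open>V\<close>; functionals are \<open>undefined\<close> outside \<open>V\<close>, so that equality of functions
  is equality on \<open>V\<close>.
\<close>

definition dual_space ::
  "('o, 'a::ab_group_add, 'k::field, 'z) linear_cat_scheme \<Rightarrow> 'a set \<Rightarrow> ('a \<Rightarrow> 'k) set"
where
  "dual_space C V =
     {u \<in> extensional V.
        (\<forall>x\<in>V. \<forall>y\<in>V. u (x + y) = u x + u y) \<and>
        (\<forall>a. \<forall>x\<in>V. u (Scale C a x) = a * u x)}"

text \<open>
  \<open>\<Phi> X Y\<close> is the isomorphism from \<open>\<C>(X, \<Sigma>Y)\<close> to the dual of \<open>\<C>(Y, \<Sigma>X)\<close>; the last two conditions
  are naturality in \<open>X\<close> and in \<open>Y\<close>.
\<close>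

definition calabi_yau2 ::
  "('o, 'a::ab_group_add, 'k::field, 'z) triangulated_cat_scheme \<Rightarrow> bool"
where
  "calabi_yau2 C \<longleftrightarrow>
     (\<exists>\<Phi> :: 'o \<Rightarrow> 'o \<Rightarrow> 'a \<Rightarrow> 'a \<Rightarrow> 'k.
        (\<forall>X \<in> Ob C. \<forall>Y \<in> Ob C.
           bij_betw (\<Phi> X Y) (Hom C X (ShO C Y)) (dual_space C (Hom C Y (ShO C X))) \<and>
           (\<forall>f \<in> Hom C X (ShO C Y). \<forall>f' \<in> Hom C X (ShO C Y). \<forall>u \<in> Hom C Y (ShO C X).
              \<Phi> X Y (f + f') u = \<Phi> X Y f u + \<Phi> X Y f' u) \<and>
           (\<forall>a. \<forall>f \<in> Hom C X (ShO C Y). \<forall>u \<in> Hom C Y (ShO C X).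
              \<Phi> X Y (Scale C a f) u = a * \<Phi> X Y f u)) \<and>
        (\<forall>X \<in> Ob C. \<forall>X' \<in> Ob C. \<forall>Y \<in> Ob C.
           \<forall>a \<in> Hom C X' X. \<forall>f \<in> Hom C X (ShO C Y). \<forall>u \<in> Hom C Y (ShO C X').
             \<Phi> X' Y (f \<cdot>\<^bsub>C\<^esub> a) u = \<Phi> X Y f (ShM C a \<cdot>\<^bsub>C\<^esub> u)) \<and>
        (\<forall>X \<in> Ob C. \<forall>Y \<in> Ob C. \<forall>Y' \<in> Ob C.
           \<forall>b \<in> Hom C Y Y'. \<forall>f \<in> Hom C X (ShO C Y). \<forall>u \<in> Hom C Y' (ShO C X).
             \<Phi> X Y' (ShM C b \<cdot>\<^bsub>C\<^esub> f) u = \<Phi> X Y f (u \<cdot>\<^bsub>C\<^esub> b)))"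

section \<open>Rigid objects, exchange triangles and mutation\<close>

definition rigid ::
  "('o, 'a::ab_group_add, 'k, 'z) triangulated_cat_scheme \<Rightarrow> 'o \<Rightarrow> bool"
where
  "rigid C R \<longleftrightarrow> R \<in> Ob C \<and> Hom C R (ShO C R) = {0}"

definition basic_rigid_decomposition ::
  "('o, 'a::ab_group_add, 'k, 'z) triangulated_cat_scheme \<Rightarrow> nat \<Rightarrow> (nat \<Rightarrow> 'o) \<Rightarrow> 'o \<Rightarrow> bool"
where
  "basic_rigid_decomposition C m Rs R \<longleftrightarrow>
     rigid C R \<and> direct_sum_of C {1..m} Rs R \<and>
     (\<forall>i\<in>{1..m}. indecomposable C (Rs i)) \<and>
     (\<forall>i\<in>{1..m}. \<forall>j\<in>{1..m}. i \<noteq> j \<longrightarrow> \<not> isomorphic C (Rs i) (Rs j))"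

text \<open>
  A choice of the exchange triangles of \<open>X\<close> with respect to \<open>R\<close>. They are determined only up to
  isomorphism.
\<close>

definition exchange_triangles ::
  "('o, 'a::ab_group_add, 'k, 'z) triangulated_cat_scheme \<Rightarrow> 'o \<Rightarrow> 'o \<Rightarrow>
   (int \<Rightarrow> 'o) \<Rightarrow> (int \<Rightarrow> 'o) \<Rightarrow> (int \<Rightarrow> 'a) \<Rightarrow> (int \<Rightarrow> 'a) \<Rightarrow> (int \<Rightarrow> 'a) \<Rightarrow> bool"
where
  "exchange_triangles C R X Xs B f g h \<longleftrightarrow>
     Xs 0 = X \<and>
     (\<forall>c. Tri C (Xs c) (B c) (Xs (c + 1)) (f c) (g c) (h c) \<and>
        left_approximation C (add_closure C R) (Xs c) (B c) (f c) \<and>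
        left_minimal C (B c) (f c) \<and>
        right_approximation C (add_closure C R) (B c) (Xs (c + 1)) (g c) \<and>
        right_minimal C (B c) (g c))"

definition is_twist ::
  "('o, 'a::ab_group_add, 'k, 'z) triangulated_cat_scheme \<Rightarrow> 'o \<Rightarrow> 'o \<Rightarrow> 'o \<Rightarrow> bool"
where
  "is_twist C R X Y \<longleftrightarrow> (\<exists>Xs B f g h. exchange_triangles C R X Xs B f g h \<and> Xs 1 = Y)"

definition is_mutation ::
  "('o, 'a::ab_group_add, 'k, 'z) triangulated_cat_scheme \<Rightarrow>
   nat \<Rightarrow> (nat \<Rightarrow> 'o) \<Rightarrow> nat \<Rightarrow> (nat \<Rightarrow> 'o) \<Rightarrow> bool"
where
  "is_mutation C m Rs k Rs' \<longleftrightarrow>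
     (\<exists>U. direct_sum_of C ({1..m} - {k}) Rs U \<and> is_twist C U (Rs k) (Rs' k)) \<and>
     (\<forall>i \<in> {1..m} - {k}. Rs' i = Rs i)"

section \<open>Coloured quivers\<close>

text \<open>An infinite period is represented by \<open>0\<close>, in accordance with \<open>\<int>/0 = \<int>\<close>.\<close>

definition periodicity ::
  "('o, 'a::ab_group_add, 'k, 'z) triangulated_cat_scheme \<Rightarrow> (int \<Rightarrow> 'o) \<Rightarrow> nat"
where
  "periodicity C Xs =
     (if \<exists>d>0. isomorphic C (Xs (int d)) (Xs 0)
      then LEAST d. d > 0 \<and> isomorphic C (Xs (int d)) (Xs 0)
      else 0)"

text \<open>
  The set \<open>\<int>/d\<close>. The class of an integer \<open>c\<close> is represented by \<open>c mod int d\<close>, also for \<open>d = 0\<close>, since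
  \<open>c mod 0 = c\<close>.
\<close>

definition colours :: "nat \<Rightarrow> int set" where
  "colours d = (if d = 0 then UNIV else {0..<int d})"

text \<open>
  \<open>arrows Q c i j\<close> is the number of \<open>c\<close>-coloured arrows from \<open>i\<close> to \<open>j\<close>; it is meaningful only for
  vertices \<open>i\<close>, \<open>j\<close> and \<open>c \<in> colours (period Q i)\<close>.
\<close>

record coloured_quiver =
  vertices :: "nat set"
  period :: "nat \<Rightarrow> nat"
  arrows :: "int \<Rightarrow> nat \<Rightarrow> nat \<Rightarrow> nat"

definition has_coloured_quiver ::
  "('o, 'a::ab_group_add, 'k, 'z) triangulated_cat_scheme \<Rightarrow>
   nat \<Rightarrow> (nat \<Rightarrow> 'o) \<Rightarrow> coloured_quiver \<Rightarrow> bool"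
where
  "has_coloured_quiver C m Rs Q \<longleftrightarrow>
     vertices Q = {1..m} \<and>
     (\<forall>i\<in>{1..m}. \<exists>U Xs B f g h.
        direct_sum_of C ({1..m} - {i}) Rs U \<and>
        exchange_triangles C U (Rs i) Xs B f g h \<and>
        period Q i = periodicity C Xs \<and>
        (\<forall>j\<in>{1..m}. \<forall>c \<in> colours (period Q i).
           arrows Q c i j = multiplicity C (Rs j) (B c)))"

end

theory Submission
  imports Defs
begin

text \<open>
  Minimal approximations are unique up to isomorphism, so a sequence of exchange triangles is
  determined, in both directions, by any one of its objects (\<open>exchange_sequence_unique\<close>). The object
  that replaces \<open>R\<^sub>k\<close> is the next term of the sequence of \<open>R\<^sub>k\<close>, and the summands to which the
  approximations refer are the same before and after mutation. The new sequence at \<open>k\<close> is therefore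
  the old one shifted by one step, which is the first part of the theorem.

  For the second part, let \<open>V\<close> consist of the summands of \<open>R\<close> other than \<open>R\<^sub>i\<close> and \<open>P = R\<^sub>k\<close>, and let
  \<open>P \<rightarrow> E \<rightarrow> P' \<rightarrow> \<Sigma>P\<close> be the exchange triangle that defines the mutation. That there are no arrows of
  colour \<open>0\<close> from \<open>k\<close> to \<open>i\<close> means that \<open>E\<close> is a sum of objects of \<open>V\<close>. Modulo morphisms that factor
  through such sums, the objects orthogonal to \<open>V\<close> form a triangulated category whose shift \<open>\<langle>1\<rangle>\<close> is the
  twist with respect to \<open>V\<close> (Iyama-Yoshino reduction), and there \<open>P' = P\<langle>1\<rangle>\<close>. Let \<open>X\<^sub>c\<close> be the exchange
  sequence of \<open>R\<^sub>i\<close> with respect to \<open>V\<close> and \<open>P\<close>, with middle terms \<open>B\<^sub>c\<close>. Shifting its triangles yields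
  approximations with respect to \<open>V\<close> and \<open>P'\<close>, so the exchange sequence of \<open>R\<^sub>i\<close> after mutation should
  be \<open>X\<^sub>c\<^sub>-\<^sub>1\<langle>1\<rangle>\<close>; the index is right at \<open>c = 0\<close> because \<open>P\<close> has no nonzero morphism to \<open>R\<^sub>i\<close> in the
  quotient, so that \<open>R\<^sub>i = X\<^sub>-\<^sub>1\<langle>1\<rangle>\<close>.

  The proof carries this out in the category itself. Replacing each summand \<open>P\<close> of \<open>B\<^sub>c\<close> by \<open>E\<close> gives an
  object \<open>G\<^sub>c\<close>; the cone of \<open>B\<^sub>c \<rightarrow> G\<^sub>c\<close> is a sum \<open>Q\<^sub>c\<close> of copies of \<open>P'\<close>, and the cone \<open>Z\<^sub>c\<^sub>+\<^sub>1\<close> of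
  \<open>X\<^sub>c \<rightarrow> B\<^sub>c \<rightarrow> G\<^sub>c\<close> represents \<open>X\<^sub>c\<langle>1\<rangle>\<close>. Two uses of the octahedral axiom (\<open>octahedron\<close>, \<open>mayer_vietoris\<close>)
  produce triangles \<open>Z\<^sub>c \<rightarrow> Q\<^sub>c\<^sub>-\<^sub>1 \<oplus> G\<^sub>c \<rightarrow> Z\<^sub>c\<^sub>+\<^sub>1 \<rightarrow> \<Sigma>Z\<^sub>c\<close> whose maps are approximations with respect to \<open>V\<close> and
  \<open>P'\<close> (\<open>tower_triangle\<close>). They need not be minimal, so the new exchange sequence agrees with \<open>Z\<^sub>c\<close> only
  up to summands in the additive closure (\<open>summand_modulo_up\<close>, \<open>summand_modulo_down\<close>). Such extra
  summands do not disturb the count of \<open>P'\<close>, nor that of an object of \<open>V\<close> that does not occur in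
  \<open>E\<close>, because none of these is a summand of any \<open>Z\<^sub>c\<close> (\<open>P'_not_retract_Z\<close>, \<open>V_not_retract_Z\<close>,
  \<open>multiplicity_middle\<close>). Reading off multiplicities in \<open>Q\<^sub>c\<^sub>-\<^sub>1 \<oplus> G\<^sub>c\<close> gives the formulas for the arrows.
  The periods agree because isomorphisms can be carried back and forth between the objects \<open>X\<^sub>c\<^sub>-\<^sub>1\<close>
  and their cones \<open>Z\<^sub>c\<close>.
\<close>

section \<open>Morphisms with source and target\<close>

context linear_category
begin

interpretation vs: vector_space "Scale C"
  by (rule vector_space_Scale)

text \<open>
  Membership in \<open>hom X Y\<close> includes that \<open>X\<close> and \<open>Y\<close> are objects, so that a typing fact for a morphism
  carries all side conditions of the axioms.
\<close>

definition hom :: "'o \<Rightarrow> 'o \<Rightarrow> 'a set" where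
  "hom X Y = {f \<in> Hom C X Y. X \<in> Ob C \<and> Y \<in> Ob C}"

abbreviation one :: "'o \<Rightarrow> 'a" where
  "one \<equiv> Ident C"

lemma homI: "f \<in> Hom C X Y \<Longrightarrow> X \<in> Ob C \<Longrightarrow> Y \<in> Ob C \<Longrightarrow> f \<in> hom X Y"
  by (simp add: hom_def)

lemma hom_Hom: "f \<in> hom X Y \<Longrightarrow> f \<in> Hom C X Y"
  by (simp add: hom_def)

lemma hom_src: "f \<in> hom X Y \<Longrightarrow> X \<in> Ob C"
  by (simp add: hom_def)

lemma hom_trg: "f \<in> hom X Y \<Longrightarrow> Y \<in> Ob C"
  by (simp add: hom_def)

lemma comp_hom [intro]: "f \<in> hom X Y \<Longrightarrow> g \<in> hom Y Z \<Longrightarrow> g \<cdot> f \<in> hom X Z"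
  unfolding hom_def using Comp_in_Hom by blast

lemma comp_assoc:
  "f \<in> hom W X \<Longrightarrow> g \<in> hom X Y \<Longrightarrow> h \<in> hom Y Z \<Longrightarrow> (h \<cdot> g) \<cdot> f = h \<cdot> (g \<cdot> f)"
  unfolding hom_def using Comp_assoc by blast

lemma one_hom [intro]: "X \<in> Ob C \<Longrightarrow> one X \<in> hom X X"
  by (simp add: hom_def Ident_in_Hom)

lemma comp_one: "f \<in> hom X Y \<Longrightarrow> f \<cdot> one X = f"
  unfolding hom_def using Comp_Ident by blast

lemma one_comp: "f \<in> hom X Y \<Longrightarrow> one Y \<cdot> f = f"
  unfolding hom_def using Ident_Comp by blast

lemma zero_hom [intro]: "X \<in> Ob C \<Longrightarrow> Y \<in> Ob C \<Longrightarrow> 0 \<in> hom X Y"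
  unfolding hom_def using vs.subspace_0[OF subspace_Hom] by blast

lemma add_hom [intro]: "f \<in> hom X Y \<Longrightarrow> g \<in> hom X Y \<Longrightarrow> f + g \<in> hom X Y"
  unfolding hom_def using vs.subspace_add[OF subspace_Hom] by blast

lemma minus_hom [intro]: "f \<in> hom X Y \<Longrightarrow> - f \<in> hom X Y"
  unfolding hom_def using vs.subspace_neg[OF subspace_Hom] by blast

lemma diff_hom [intro]: "f \<in> hom X Y \<Longrightarrow> g \<in> hom X Y \<Longrightarrow> f - g \<in> hom X Y"
  unfolding hom_def using vs.subspace_diff[OF subspace_Hom] by blast

lemma sum_hom:
  "X \<in> Ob C \<Longrightarrow> Y \<in> Ob C \<Longrightarrow> (\<And>i. i \<in> I \<Longrightarrow> f i \<in> hom X Y) \<Longrightarrow> (\<Sum>i\<in>I. f i) \<in> hom X Y"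
  by (induction I rule: infinite_finite_induct) auto

lemma comp_add:
  "f \<in> hom X Y \<Longrightarrow> f' \<in> hom X Y \<Longrightarrow> g \<in> hom Y Z \<Longrightarrow> g \<cdot> (f + f') = g \<cdot> f + g \<cdot> f'"
  unfolding hom_def using Comp_add_right by blast

lemma add_comp:
  "f \<in> hom X Y \<Longrightarrow> g \<in> hom Y Z \<Longrightarrow> g' \<in> hom Y Z \<Longrightarrow> (g + g') \<cdot> f = g \<cdot> f + g' \<cdot> f"
  unfolding hom_def using Comp_add_left by blast

lemma comp_zero: "g \<in> hom Y Z \<Longrightarrow> g \<cdot> 0 = 0"
  using comp_add[of 0 Y Y 0 g Z] zero_hom[of Y Y] by (simp add: hom_src)

lemma zero_comp: "f \<in> hom X Y \<Longrightarrow> 0 \<cdot> f = 0"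
  using add_comp[of f X Y 0 Y 0] zero_hom[of Y Y] by (simp add: hom_trg)

lemma comp_minus:
  assumes "f \<in> hom X Y" "g \<in> hom Y Z"
  shows "g \<cdot> (- f) = - (g \<cdot> f)"
  using comp_add[OF assms(1) minus_hom[OF assms(1)] assms(2)] comp_zero[OF assms(2)]
  by (simp add: eq_neg_iff_add_eq_0 add.commute)

lemma minus_comp:
  assumes "f \<in> hom X Y" "g \<in> hom Y Z"
  shows "(- g) \<cdot> f = - (g \<cdot> f)"
  using add_comp[OF assms(1) assms(2) minus_hom[OF assms(2)]] zero_comp[OF assms(1)]
  by (simp add: eq_neg_iff_add_eq_0 add.commute)

lemma comp_diff:
  "f \<in> hom X Y \<Longrightarrow> f' \<in> hom X Y \<Longrightarrow> g \<in> hom Y Z \<Longrightarrow> g \<cdot> (f - f') = g \<cdot> f - g \<cdot> f'"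
  using comp_add[of f X Y "- f'" g Z] by (simp add: comp_minus minus_hom)

lemma diff_comp:
  "f \<in> hom X Y \<Longrightarrow> g \<in> hom Y Z \<Longrightarrow> g' \<in> hom Y Z \<Longrightarrow> (g - g') \<cdot> f = g \<cdot> f - g' \<cdot> f"
  using add_comp[of f X Y g Z "- g'"] by (simp add: minus_comp minus_hom)

lemma comp_sum:
  assumes "X \<in> Ob C" "g \<in> hom Y Z" "\<And>i. i \<in> I \<Longrightarrow> f i \<in> hom X Y"
  shows "g \<cdot> (\<Sum>i\<in>I. f i) = (\<Sum>i\<in>I. g \<cdot> f i)"
  using assms(3)
proof (induction I rule: infinite_finite_induct)
  case (insert i I)
  have "(\<Sum>i\<in>I. f i) \<in> hom X Y"
    using insert.prems assms(1) hom_src[OF assms(2)] by (intro sum_hom) auto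
  then show ?case using insert comp_add[OF _ _ assms(2), of "f i" X "sum f I"] by simp
qed (simp_all add: comp_zero[OF assms(2)])

lemma sum_comp:
  assumes "Z \<in> Ob C" "f \<in> hom X Y" "\<And>i. i \<in> I \<Longrightarrow> g i \<in> hom Y Z"
  shows "(\<Sum>i\<in>I. g i) \<cdot> f = (\<Sum>i\<in>I. g i \<cdot> f)"
  using assms(3)
proof (induction I rule: infinite_finite_induct)
  case (insert i I)
  have "(\<Sum>i\<in>I. g i) \<in> hom Y Z"
    using insert.prems assms(1) hom_trg[OF assms(2)] by (intro sum_hom) auto
  then show ?case using insert add_comp[OF assms(2), of "g i" Z "sum g I"] by simp
qed (simp_all add: zero_comp[OF assms(2)])

text \<open>Associativity followed by the replacement of two adjacent factors by their composite.\<close>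

lemma comp_eqR:
  "f \<in> hom W X \<Longrightarrow> g \<in> hom X Y \<Longrightarrow> h \<in> hom Y Z \<Longrightarrow> g \<cdot> f = t \<Longrightarrow> (h \<cdot> g) \<cdot> f = h \<cdot> t"
  by (simp add: comp_assoc)

lemma comp_eqL:
  "f \<in> hom W X \<Longrightarrow> g \<in> hom X Y \<Longrightarrow> h \<in> hom Y Z \<Longrightarrow> h \<cdot> g = t \<Longrightarrow> h \<cdot> (g \<cdot> f) = t \<cdot> f"
  by (simp add: comp_assoc[symmetric])

section \<open>Isomorphisms and retracts\<close>

lemma isoI:
  "f \<in> hom X Y \<Longrightarrow> g \<in> hom Y X \<Longrightarrow> g \<cdot> f = one X \<Longrightarrow> f \<cdot> g = one Y \<Longrightarrow> iso_mor C X Y f"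
  unfolding iso_mor_def hom_def by blast

lemma isoE:
  assumes "iso_mor C X Y f" "X \<in> Ob C" "Y \<in> Ob C"
  obtains g where "f \<in> hom X Y" "g \<in> hom Y X" "g \<cdot> f = one X" "f \<cdot> g = one Y"
  using assms unfolding iso_mor_def hom_def by blast

lemma iso_inverse:
  assumes "f \<in> hom X Y" "g \<in> hom Y X" "h \<in> hom Y X" "g \<cdot> f = one X" "f \<cdot> h = one Y"
  shows "iso_mor C X Y f"
proof -
  have "g = g \<cdot> (f \<cdot> h)" using comp_one[OF assms(2)] assms(5) by simp
  also have "\<dots> = h"
    using comp_assoc[OF assms(3) assms(1) assms(2)] one_comp[OF assms(3)] assms(4) by simp
  finally show ?thesis using isoI[OF assms(1,2,4)] assms(5) by simp
qed

lemma iso_two_sided: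
  assumes b: "b \<in> hom X Y" and k: "k \<in> hom Y X" and l: "l \<in> hom Y X"
    and kb: "iso_mor C X X (k \<cdot> b)" and bl: "iso_mor C Y Y (b \<cdot> l)"
  shows "iso_mor C X Y b"
proof -
  have X: "X \<in> Ob C" and Y: "Y \<in> Ob C" using b hom_src hom_trg by blast+
  obtain s where s: "s \<in> hom X X" "s \<cdot> (k \<cdot> b) = one X" by (rule isoE[OF kb X X])
  obtain t where t: "t \<in> hom Y Y" "(b \<cdot> l) \<cdot> t = one Y" by (rule isoE[OF bl Y Y])
  show ?thesis
  proof (rule iso_inverse[OF b])
    show "s \<cdot> k \<in> hom Y X" "l \<cdot> t \<in> hom Y X" using s t k l by blast+
    show "(s \<cdot> k) \<cdot> b = one X" using comp_assoc[OF b k s(1)] s by simp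
    show "b \<cdot> (l \<cdot> t) = one Y" using comp_assoc[OF t(1) l b] t by simp
  qed
qed

lemma iso_one: "X \<in> Ob C \<Longrightarrow> iso_mor C X X (one X)"
  using isoI[of "one X" X X "one X"] comp_one one_hom by auto

lemma iso_minus:
  assumes "iso_mor C X Y f" "X \<in> Ob C" "Y \<in> Ob C"
  shows "iso_mor C X Y (- f)"
proof -
  obtain g where g: "f \<in> hom X Y" "g \<in> hom Y X" "g \<cdot> f = one X" "f \<cdot> g = one Y"
    by (rule isoE[OF assms])
  show ?thesis
    using g isoI[of "- f" X Y "- g"] minus_hom comp_minus[of "f" X Y "- g" X]
      comp_minus[of g Y X "- f" Y] minus_comp[of f X Y g X] minus_comp[of g Y X f Y]
    by (simp add: minus_hom)
qed

lemma isomorphicE: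
  assumes "isomorphic C X Y" "X \<in> Ob C" "Y \<in> Ob C"
  obtains f g where "f \<in> hom X Y" "g \<in> hom Y X" "g \<cdot> f = one X" "f \<cdot> g = one Y"
  using assms isoE unfolding isomorphic_def by metis

lemma isomorphicI:
  "f \<in> hom X Y \<Longrightarrow> g \<in> hom Y X \<Longrightarrow> g \<cdot> f = one X \<Longrightarrow> f \<cdot> g = one Y \<Longrightarrow> isomorphic C X Y"
  unfolding isomorphic_def using isoI by blast

lemma isomorphic_refl: "X \<in> Ob C \<Longrightarrow> isomorphic C X X"
  unfolding isomorphic_def using iso_one by blast

lemma isomorphic_sym: "isomorphic C X Y \<Longrightarrow> isomorphic C Y X"
  unfolding isomorphic_def iso_mor_def by blast

lemma iso_comp:
  assumes "iso_mor C X Y f" "iso_mor C Y Z f'" "X \<in> Ob C" "Y \<in> Ob C" "Z \<in> Ob C"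
  shows "iso_mor C X Z (f' \<cdot> f)"
proof -
  obtain g where f: "f \<in> hom X Y" "g \<in> hom Y X" "g \<cdot> f = one X" "f \<cdot> g = one Y"
    by (rule isoE[OF assms(1,3,4)])
  obtain g' where f': "f' \<in> hom Y Z" "g' \<in> hom Z Y" "g' \<cdot> f' = one Y" "f' \<cdot> g' = one Z"
    by (rule isoE[OF assms(2,4,5)])
  have "(g \<cdot> g') \<cdot> (f' \<cdot> f) = one X"
    using comp_assoc[OF comp_hom[OF f(1) f'(1)] f'(2) f(2)] comp_eqL[OF f(1) f'(1,2,3)]
      one_comp[OF f(1)] f(3) by simp
  moreover have "(f' \<cdot> f) \<cdot> (g \<cdot> g') = one Z"
    using comp_assoc[OF comp_hom[OF f'(2) f(2)] f(1) f'(1)] comp_eqL[OF f'(2) f(2,1,4)]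
      one_comp[OF f'(2)] f'(4) by simp
  ultimately show ?thesis
    using isoI[OF comp_hom[OF f(1) f'(1)] comp_hom[OF f'(2) f(2)]] by simp
qed

lemma isomorphic_trans:
  "isomorphic C X Y \<Longrightarrow> isomorphic C Y Z \<Longrightarrow> X \<in> Ob C \<Longrightarrow> Y \<in> Ob C \<Longrightarrow> Z \<in> Ob C
    \<Longrightarrow> isomorphic C X Z"
  unfolding isomorphic_def using iso_comp by blast

lemma iso_one_plus_nilpotent:
  assumes u: "u \<in> hom Z Z" and uu: "u \<cdot> u = 0"
  shows "iso_mor C Z Z (one Z + u)"
proof -
  have Z: "Z \<in> Ob C" using hom_src[OF u] .
  note o = one_hom[OF Z]
  have "(one Z - u) \<cdot> (one Z + u) = one Z"
    using comp_add[OF o u diff_hom[OF o u]] comp_one[OF diff_hom[OF o u]] diff_comp[OF u o u]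
      one_comp[OF u] uu by simp
  moreover have "(one Z + u) \<cdot> (one Z - u) = one Z"
    using comp_diff[OF o u add_hom[OF o u]] comp_one[OF add_hom[OF o u]] add_comp[OF u o u]
      one_comp[OF u] uu by simp
  ultimately show ?thesis using isoI[OF add_hom[OF o u] diff_hom[OF o u]] by simp
qed

lemma zero_object_in: "f \<in> hom X Z \<Longrightarrow> zero_object C Z \<Longrightarrow> f = 0"
  using one_comp zero_comp unfolding zero_object_def by metis

lemma zero_object_out: "f \<in> hom Z X \<Longrightarrow> zero_object C Z \<Longrightarrow> f = 0"
  using comp_one comp_zero unfolding zero_object_def by metis

definition retract :: "'o \<Rightarrow> 'o \<Rightarrow> bool" where
  "retract X Y \<longleftrightarrow> (\<exists>s \<in> hom X Y. \<exists>r \<in> hom Y X. r \<cdot> s = one X)"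

lemma retract_ob: "retract X Y \<Longrightarrow> X \<in> Ob C \<and> Y \<in> Ob C"
  unfolding retract_def hom_def by blast

lemma retractI_iso:
  assumes s: "s \<in> hom X Y" and r: "r \<in> hom Y X" and i: "iso_mor C X X (r \<cdot> s)"
  shows "retract X Y"
proof -
  have X: "X \<in> Ob C" using s hom_src by blast
  obtain t where t: "t \<in> hom X X" "t \<cdot> (r \<cdot> s) = one X" by (rule isoE[OF i X X])
  have "(t \<cdot> r) \<cdot> s = one X" using comp_assoc[OF s r t(1)] t by simp
  then show ?thesis unfolding retract_def using s comp_hom[OF r t(1)] by blast
qed

lemma isomorphic_retract:
  "isomorphic C X Y \<Longrightarrow> X \<in> Ob C \<Longrightarrow> Y \<in> Ob C \<Longrightarrow> retract X Y"
  unfolding retract_def using isomorphicE by metis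

lemma retract_trans:
  assumes "retract X Y" "retract Y Z"
  shows "retract X Z"
proof -
  obtain s r where s: "s \<in> hom X Y" "r \<in> hom Y X" "r \<cdot> s = one X"
    using assms(1) unfolding retract_def by blast
  obtain s' r' where s': "s' \<in> hom Y Z" "r' \<in> hom Z Y" "r' \<cdot> s' = one Y"
    using assms(2) unfolding retract_def by blast
  have "(r \<cdot> r') \<cdot> (s' \<cdot> s) = one X"
    using comp_assoc[OF comp_hom[OF s(1) s'(1)] s'(2) s(2)] comp_eqL[OF s(1) s'(1,2,3)]
      one_comp[OF s(1)] s(3) by simp
  then show ?thesis unfolding retract_def using comp_hom[OF s(1) s'(1)] comp_hom[OF s'(2) s(2)]
    by blast
qed

text \<open>
  Let \<open>r\<close> be a split epimorphism that kills a left minimal map \<open>f\<close>. Then the idempotent complementary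
  to \<open>r\<close> fixes \<open>f\<close>, so by minimality it is invertible; as \<open>r\<close> kills it, \<open>r = 0\<close>.
\<close>

lemma left_minimal_split_epi:
  assumes m: "left_minimal C B f" and f: "f \<in> hom X B" and r: "r \<in> hom B A" and s: "s \<in> hom A B"
    and rs: "iso_mor C A A (r \<cdot> s)" and 0: "r \<cdot> f = 0"
  shows "one A = 0"
proof -
  have A: "A \<in> Ob C" and B: "B \<in> Ob C" using r hom_src hom_trg by blast+
  obtain t where t: "t \<in> hom A A" "t \<cdot> (r \<cdot> s) = one A" "(r \<cdot> s) \<cdot> t = one A"
    by (rule isoE[OF rs A A])
  define e where "e = (s \<cdot> t) \<cdot> r"
  have st: "s \<cdot> t \<in> hom A B" using s t by blast
  have e: "e \<in> hom B B" unfolding e_def using comp_hom[OF r st] .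
  have "e \<cdot> f = 0" unfolding e_def using comp_eqR[OF f r st 0] comp_zero[OF st] by simp
  then have "(one B - e) \<cdot> f = f" using diff_comp[OF f one_hom[OF B] e] one_comp[OF f] by simp
  then have "iso_mor C B B (one B - e)"
    using m e B unfolding left_minimal_def by (meson diff_hom hom_Hom one_hom)
  then obtain k where k: "k \<in> hom B B" "(one B - e) \<cdot> k = one B" by (rule isoE[OF _ B B])
  have "r \<cdot> e = r"
    unfolding e_def using comp_assoc[OF r st r] comp_assoc[OF t(1) s r] t(3) one_comp[OF r] by simp
  then have "r \<cdot> (one B - e) = 0" using comp_diff[OF one_hom[OF B] e r] comp_one[OF r] by simp
  then have "r = 0"
    using comp_assoc[OF k(1) diff_hom[OF one_hom[OF B] e] r] k(2) comp_one[OF r] zero_comp[OF k(1)]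
    by simp
  then show ?thesis using t zero_comp[OF s] comp_zero[OF t(1)] by simp
qed

section \<open>Direct sums\<close>

definition biproduct ::
  "'i set \<Rightarrow> ('i \<Rightarrow> 'o) \<Rightarrow> 'o \<Rightarrow> ('i \<Rightarrow> 'a) \<Rightarrow> ('i \<Rightarrow> 'a) \<Rightarrow> bool"
where
  "biproduct I X S \<iota> \<pi> \<longleftrightarrow>
     finite I \<and> S \<in> Ob C \<and>
     (\<forall>i\<in>I. \<iota> i \<in> hom (X i) S \<and> \<pi> i \<in> hom S (X i)) \<and>
     (\<forall>i\<in>I. \<forall>j\<in>I. \<pi> j \<cdot> \<iota> i = (if i = j then one (X i) else 0)) \<and>
     (\<Sum>i\<in>I. \<iota> i \<cdot> \<pi> i) = one S"

lemma direct_sum_iff_biproduct: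
  "direct_sum_of C I X S \<longleftrightarrow> (\<exists>\<iota> \<pi>. biproduct I X S \<iota> \<pi>)"
proof
  assume "direct_sum_of C I X S"
  then show "\<exists>\<iota> \<pi>. biproduct I X S \<iota> \<pi>"
    unfolding direct_sum_of_def biproduct_def hom_def by blast
next
  assume "\<exists>\<iota> \<pi>. biproduct I X S \<iota> \<pi>"
  then obtain \<iota> \<pi> where "biproduct I X S \<iota> \<pi>" by blast
  then show "direct_sum_of C I X S"
    unfolding direct_sum_of_def biproduct_def hom_def
    by (intro conjI exI[of _ \<iota>] exI[of _ \<pi>]) auto
qed

lemma biproductD:
  assumes "biproduct I X S \<iota> \<pi>"
  shows "finite I" "S \<in> Ob C"
    "\<And>i. i \<in> I \<Longrightarrow> \<iota> i \<in> hom (X i) S" "\<And>i. i \<in> I \<Longrightarrow> \<pi> i \<in> hom S (X i)"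
    "\<And>i. i \<in> I \<Longrightarrow> \<pi> i \<cdot> \<iota> i = one (X i)"
    "\<And>i j. i \<in> I \<Longrightarrow> j \<in> I \<Longrightarrow> i \<noteq> j \<Longrightarrow> \<pi> j \<cdot> \<iota> i = 0"
    "(\<Sum>i\<in>I. \<iota> i \<cdot> \<pi> i) = one S"
  using assms unfolding biproduct_def by auto

lemma biproduct_in:
  assumes b: "biproduct I X S \<iota> \<pi>" and u: "u \<in> hom W S"
  shows "(\<Sum>i\<in>I. \<iota> i \<cdot> (\<pi> i \<cdot> u)) = u"
proof -
  have "(\<Sum>i\<in>I. \<iota> i \<cdot> (\<pi> i \<cdot> u)) = (\<Sum>i\<in>I. (\<iota> i \<cdot> \<pi> i) \<cdot> u)"
    using comp_assoc[OF u biproductD(4)[OF b] biproductD(3)[OF b]] by simp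
  also have "\<dots> = (\<Sum>i\<in>I. \<iota> i \<cdot> \<pi> i) \<cdot> u"
    using sum_comp[OF hom_trg[OF u] u, of I "\<lambda>i. \<iota> i \<cdot> \<pi> i"]
      comp_hom[OF biproductD(4)[OF b] biproductD(3)[OF b]] by simp
  finally show ?thesis using biproductD(7)[OF b] one_comp[OF u] by simp
qed

lemma biproduct_out:
  assumes b: "biproduct I X S \<iota> \<pi>" and u: "u \<in> hom S W"
  shows "(\<Sum>i\<in>I. (u \<cdot> \<iota> i) \<cdot> \<pi> i) = u"
proof -
  have "(\<Sum>i\<in>I. (u \<cdot> \<iota> i) \<cdot> \<pi> i) = (\<Sum>i\<in>I. u \<cdot> (\<iota> i \<cdot> \<pi> i))"
    using comp_assoc[OF biproductD(4)[OF b] biproductD(3)[OF b] u] by simp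
  also have "\<dots> = u \<cdot> (\<Sum>i\<in>I. \<iota> i \<cdot> \<pi> i)"
    using comp_sum[OF hom_src[OF u] u, of I "\<lambda>i. \<iota> i \<cdot> \<pi> i"]
      comp_hom[OF biproductD(4)[OF b] biproductD(3)[OF b]] by simp
  finally show ?thesis using biproductD(7)[OF b] comp_one[OF u] by simp
qed

lemma cotuple:
  assumes b: "biproduct I X S \<iota> \<pi>" and W: "W \<in> Ob C" and f': "\<forall>i\<in>I. f i \<in> hom (X i) W"
  shows "(\<Sum>i\<in>I. f i \<cdot> \<pi> i) \<in> hom S W"
    and "\<And>j. j \<in> I \<Longrightarrow> (\<Sum>i\<in>I. f i \<cdot> \<pi> i) \<cdot> \<iota> j = f j"
proof -
  note t = biproductD(3)[OF b] biproductD(4)[OF b] and f = bspec[OF f']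
  show "(\<Sum>i\<in>I. f i \<cdot> \<pi> i) \<in> hom S W"
    using comp_hom[OF t(2) f] biproductD(2)[OF b] W by (intro sum_hom) auto
  fix j assume j: "j \<in> I"
  have "(f i \<cdot> \<pi> i) \<cdot> \<iota> j = (if i = j then f j else 0)" if i: "i \<in> I" for i
    using comp_assoc[OF t(1)[OF j] t(2)[OF i] f[OF i]] biproductD(5)[OF b j]
      biproductD(6)[OF b j i] comp_one[OF f[OF j]] comp_zero[OF f[OF i]] by auto
  then show "(\<Sum>i\<in>I. f i \<cdot> \<pi> i) \<cdot> \<iota> j = f j"
    using sum_comp[OF W t(1)[OF j], of I "\<lambda>i. f i \<cdot> \<pi> i"] comp_hom[OF t(2) f]
      biproductD(1)[OF b] j by simp
qed

lemma tuple:
  assumes b: "biproduct I X S \<iota> \<pi>" and W: "W \<in> Ob C" and f': "\<forall>i\<in>I. f i \<in> hom W (X i)"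
  shows "(\<Sum>i\<in>I. \<iota> i \<cdot> f i) \<in> hom W S"
    and "\<And>j. j \<in> I \<Longrightarrow> \<pi> j \<cdot> (\<Sum>i\<in>I. \<iota> i \<cdot> f i) = f j"
proof -
  note t = biproductD(3)[OF b] biproductD(4)[OF b] and f = bspec[OF f']
  show "(\<Sum>i\<in>I. \<iota> i \<cdot> f i) \<in> hom W S"
    using comp_hom[OF f t(1)] biproductD(2)[OF b] W by (intro sum_hom) auto
  fix j assume j: "j \<in> I"
  have "\<pi> j \<cdot> (\<iota> i \<cdot> f i) = (if i = j then f j else 0)" if i: "i \<in> I" for i
    using comp_assoc[OF f[OF i] t(1)[OF i] t(2)[OF j]] biproductD(5)[OF b j]
      biproductD(6)[OF b i j] one_comp[OF f[OF j]] zero_comp[OF f[OF i]] by auto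
  then show "\<pi> j \<cdot> (\<Sum>i\<in>I. \<iota> i \<cdot> f i) = f j"
    using comp_sum[OF W t(2)[OF j], of I "\<lambda>i. \<iota> i \<cdot> f i"] comp_hom[OF f t(1)]
      biproductD(1)[OF b] j by simp
qed

lemma diagonal:
  assumes b: "biproduct I X S \<iota> \<pi>" and b': "biproduct I X' S' \<iota>' \<pi>'"
    and f: "\<forall>i\<in>I. f i \<in> hom (X i) (X' i)"
  defines "F \<equiv> (\<Sum>i\<in>I. \<iota>' i \<cdot> (f i \<cdot> \<pi> i))"
  shows "F \<in> hom S S'"
    and "\<And>j. j \<in> I \<Longrightarrow> F \<cdot> \<iota> j = \<iota>' j \<cdot> f j"
    and "\<And>j. j \<in> I \<Longrightarrow> \<pi>' j \<cdot> F = f j \<cdot> \<pi> j"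
proof -
  note t = biproductD(3)[OF b'] biproductD(4)[OF b] bspec[OF f]
  have 1: "\<forall>i\<in>I. f i \<cdot> \<pi> i \<in> hom S (X' i)" using comp_hom[OF t(2,3)] by blast
  have 2: "\<forall>i\<in>I. \<iota>' i \<cdot> f i \<in> hom (X i) S'" using comp_hom[OF t(3,1)] by blast
  have F: "F = (\<Sum>i\<in>I. (\<iota>' i \<cdot> f i) \<cdot> \<pi> i)"
    unfolding F_def using comp_assoc[OF t(2,3,1)] by simp
  show "F \<in> hom S S'" "\<And>j. j \<in> I \<Longrightarrow> \<pi>' j \<cdot> F = f j \<cdot> \<pi> j"
    unfolding F_def using tuple[OF b' biproductD(2)[OF b] 1] by blast+
  show "\<And>j. j \<in> I \<Longrightarrow> F \<cdot> \<iota> j = \<iota>' j \<cdot> f j"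
    unfolding F using cotuple(2)[OF b biproductD(2)[OF b'] 2] .
qed

lemma biproduct_out_eqI:
  assumes b: "biproduct I X S \<iota> \<pi>" and u: "u \<in> hom S W" and v: "v \<in> hom S W"
    and eq: "\<And>i. i \<in> I \<Longrightarrow> u \<cdot> \<iota> i = v \<cdot> \<iota> i"
  shows "u = v"
proof -
  have "(\<Sum>i\<in>I. (u \<cdot> \<iota> i) \<cdot> \<pi> i) = (\<Sum>i\<in>I. (v \<cdot> \<iota> i) \<cdot> \<pi> i)"
    by (rule sum.cong[OF refl]) (simp only: eq)
  then show ?thesis by (simp only: biproduct_out[OF b u] biproduct_out[OF b v])
qed

lemma biproduct_in_eqI:
  assumes b: "biproduct I X S \<iota> \<pi>" and u: "u \<in> hom W S" and v: "v \<in> hom W S"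
    and eq: "\<And>i. i \<in> I \<Longrightarrow> \<pi> i \<cdot> u = \<pi> i \<cdot> v"
  shows "u = v"
proof -
  have "(\<Sum>i\<in>I. \<iota> i \<cdot> (\<pi> i \<cdot> u)) = (\<Sum>i\<in>I. \<iota> i \<cdot> (\<pi> i \<cdot> v))"
    by (rule sum.cong[OF refl]) (simp only: eq)
  then show ?thesis by (simp only: biproduct_in[OF b u] biproduct_in[OF b v])
qed

lemma biproduct_retract: "biproduct I X S \<iota> \<pi> \<Longrightarrow> i \<in> I \<Longrightarrow> retract (X i) S"
  unfolding retract_def using biproductD(3,4,5) by metis

lemma biproduct_Sigma:
  assumes b: "biproduct I S B \<iota> \<pi>"
    and b': "\<And>i. i \<in> I \<Longrightarrow> biproduct (J i) (Y i) (S i) (\<iota>' i) (\<pi>' i)"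
  shows "biproduct (Sigma I J) (\<lambda>(i, a). Y i a) B
    (\<lambda>(i, a). \<iota> i \<cdot> \<iota>' i a) (\<lambda>(i, a). \<pi>' i a \<cdot> \<pi> i)"
  unfolding biproduct_def
proof (intro conjI ballI)
  show "finite (Sigma I J)" using biproductD(1)[OF b] biproductD(1)[OF b'] by blast
  show "B \<in> Ob C" using biproductD(2)[OF b] .
next
  fix x assume "x \<in> Sigma I J"
  then obtain i a where x: "x = (i, a)" "i \<in> I" "a \<in> J i" by blast
  note t = biproductD(3)[OF b'[OF x(2)] x(3)] biproductD(3)[OF b x(2)]
    biproductD(4)[OF b x(2)] biproductD(4)[OF b'[OF x(2)] x(3)]
  show "(case x of (i, a) \<Rightarrow> \<iota> i \<cdot> \<iota>' i a) \<in> hom (case x of (i, a) \<Rightarrow> Y i a) B"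
    "(case x of (i, a) \<Rightarrow> \<pi>' i a \<cdot> \<pi> i) \<in> hom B (case x of (i, a) \<Rightarrow> Y i a)"
    using comp_hom[OF t(1,2)] comp_hom[OF t(3,4)] x by simp_all
  fix y assume "y \<in> Sigma I J"
  then obtain j d where y: "y = (j, d)" "j \<in> I" "d \<in> J j" by blast
  note u = biproductD(3)[OF b'[OF y(2)] y(3)] biproductD(3)[OF b y(2)]
    biproductD(4)[OF b y(2)] biproductD(4)[OF b'[OF y(2)] y(3)]
  have "(\<pi>' j d \<cdot> \<pi> j) \<cdot> (\<iota> i \<cdot> \<iota>' i a) = \<pi>' j d \<cdot> ((\<pi> j \<cdot> \<iota> i) \<cdot> \<iota>' i a)"
    using comp_assoc[OF comp_hom[OF t(1,2)] u(3,4)] comp_assoc[OF t(1,2) u(3)] by simp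
  also have "\<dots> = (if x = y then one (Y i a) else 0)"
  proof (cases "i = j")
    case True
    then show ?thesis
      using biproductD(5)[OF b y(2)] biproductD(5,6)[OF b'[OF y(2)]] one_comp[OF t(1)] x y
      by auto
  next
    case False
    then show ?thesis
      using biproductD(6)[OF b x(2) y(2)] zero_comp[OF t(1)] comp_zero[OF u(4)] x y by simp
  qed
  finally show "(case y of (i, a) \<Rightarrow> \<pi>' i a \<cdot> \<pi> i) \<cdot> (case x of (i, a) \<Rightarrow> \<iota> i \<cdot> \<iota>' i a) =
      (if x = y then one (case x of (i, a) \<Rightarrow> Y i a) else 0)"
    using x y by simp
next
  have "(\<Sum>a\<in>J i. (\<iota> i \<cdot> \<iota>' i a) \<cdot> (\<pi>' i a \<cdot> \<pi> i)) = \<iota> i \<cdot> \<pi> i" if i: "i \<in> I" for i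
  proof -
    note t = biproductD(3)[OF b i] biproductD(4)[OF b i]
    note t' = biproductD(3)[OF b'[OF i]] biproductD(4)[OF b'[OF i]]
    have "(\<iota> i \<cdot> \<iota>' i a) \<cdot> (\<pi>' i a \<cdot> \<pi> i) = \<iota> i \<cdot> (\<iota>' i a \<cdot> (\<pi>' i a \<cdot> \<pi> i))" if "a \<in> J i" for a
      using comp_assoc[OF comp_hom[OF t(2) t'(2)] t'(1) t(1)] that by simp
    then have "(\<Sum>a\<in>J i. (\<iota> i \<cdot> \<iota>' i a) \<cdot> (\<pi>' i a \<cdot> \<pi> i)) =
        (\<Sum>a\<in>J i. \<iota> i \<cdot> (\<iota>' i a \<cdot> (\<pi>' i a \<cdot> \<pi> i)))" by simp
    also have "\<dots> = \<iota> i \<cdot> (\<Sum>a\<in>J i. \<iota>' i a \<cdot> (\<pi>' i a \<cdot> \<pi> i))"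
      using comp_sum[OF biproductD(2)[OF b] t(1), of "J i" "\<lambda>a. \<iota>' i a \<cdot> (\<pi>' i a \<cdot> \<pi> i)"]
        comp_hom[OF comp_hom[OF t(2) t'(2)] t'(1)] by simp
    finally show ?thesis using biproduct_in[OF b'[OF i] t(2)] by simp
  qed
  then show "(\<Sum>x\<in>Sigma I J. (case x of (i, a) \<Rightarrow> \<iota> i \<cdot> \<iota>' i a) \<cdot>
      (case x of (i, a) \<Rightarrow> \<pi>' i a \<cdot> \<pi> i)) = one B"
    using biproductD(1)[OF b] biproductD(1)[OF b'] biproductD(7)[OF b]
      sum.Sigma[of I J "\<lambda>i a. (\<iota> i \<cdot> \<iota>' i a) \<cdot> (\<pi>' i a \<cdot> \<pi> i)"]
    by (simp add: split_def)
qed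

lemma biproduct_isomorphic:
  assumes b: "biproduct I X S \<iota> \<pi>" and i: "isomorphic C S S'" and S': "S' \<in> Ob C"
  shows "\<exists>\<iota>' \<pi>'. biproduct I X S' \<iota>' \<pi>'"
proof -
  obtain f g where f: "f \<in> hom S S'" "g \<in> hom S' S" "g \<cdot> f = one S" "f \<cdot> g = one S'"
    by (rule isomorphicE[OF i biproductD(2)[OF b] S'])
  note t = biproductD(3)[OF b] biproductD(4)[OF b]
  have "(\<pi> j \<cdot> g) \<cdot> (f \<cdot> \<iota> i) = \<pi> j \<cdot> \<iota> i" if "i \<in> I" "j \<in> I" for i j
    using comp_assoc[OF comp_hom[OF t(1) f(1)] f(2) t(2)] comp_eqL[OF t(1) f(1,2,3)]
      one_comp[OF t(1)] that by simp
  moreover have "(\<Sum>i\<in>I. (f \<cdot> \<iota> i) \<cdot> (\<pi> i \<cdot> g)) = one S'"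
  proof -
    have "(f \<cdot> \<iota> i) \<cdot> (\<pi> i \<cdot> g) = f \<cdot> (\<iota> i \<cdot> (\<pi> i \<cdot> g))" if "i \<in> I" for i
      using comp_assoc[OF comp_hom[OF f(2) t(2)] t(1) f(1)] that by simp
    then have "(\<Sum>i\<in>I. (f \<cdot> \<iota> i) \<cdot> (\<pi> i \<cdot> g)) = f \<cdot> (\<Sum>i\<in>I. \<iota> i \<cdot> (\<pi> i \<cdot> g))"
      using comp_sum[OF S' f(1), of I "\<lambda>i. \<iota> i \<cdot> (\<pi> i \<cdot> g)"]
        comp_hom[OF comp_hom[OF f(2) t(2)] t(1)] by simp
    then show ?thesis using biproduct_in[OF b f(2)] f(4) by simp
  qed
  ultimately have "biproduct I X S' (\<lambda>i. f \<cdot> \<iota> i) (\<lambda>i. \<pi> i \<cdot> g)"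
    unfolding biproduct_def using biproductD[OF b] S' comp_hom[OF t(1) f(1)] comp_hom[OF f(2) t(2)]
    by simp
  then show ?thesis by blast
qed

text \<open>Binary sums are given by named injections and projections instead of families over \<open>bool\<close>.\<close>

definition biproduct2 :: "'o \<Rightarrow> 'o \<Rightarrow> 'o \<Rightarrow> 'a \<Rightarrow> 'a \<Rightarrow> 'a \<Rightarrow> 'a \<Rightarrow> bool" where
  "biproduct2 X Y S i p j q \<longleftrightarrow>
     i \<in> hom X S \<and> p \<in> hom S X \<and> j \<in> hom Y S \<and> q \<in> hom S Y \<and>
     p \<cdot> i = one X \<and> q \<cdot> j = one Y \<and> p \<cdot> j = 0 \<and> q \<cdot> i = 0 \<and> i \<cdot> p + j \<cdot> q = one S"

lemma biproduct2D:
  assumes "biproduct2 X Y S i p j q"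
  shows "i \<in> hom X S" "p \<in> hom S X" "j \<in> hom Y S" "q \<in> hom S Y" "p \<cdot> i = one X" "q \<cdot> j = one Y"
    "p \<cdot> j = 0" "q \<cdot> i = 0" "i \<cdot> p + j \<cdot> q = one S"
  using assms unfolding biproduct2_def by auto

lemma biproduct2_sym: "biproduct2 X Y S i p j q \<Longrightarrow> biproduct2 Y X S j q i p"
  unfolding biproduct2_def by (auto simp: add.commute)

lemma biproduct2_biproduct:
  assumes "biproduct2 X Y S i p j q"
  shows "biproduct UNIV (\<lambda>b. if b then X else Y) S (\<lambda>b. if b then i else j) (\<lambda>b. if b then p else q)"
  using biproduct2D[OF assms] hom_trg[OF biproduct2D(1)[OF assms]]
  unfolding biproduct_def by (auto simp: UNIV_bool add.commute)

lemma direct_sum2_iff: "direct_sum2 C X Y S \<longleftrightarrow> (\<exists>i p j q. biproduct2 X Y S i p j q)"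
proof
  assume "direct_sum2 C X Y S"
  then obtain \<iota> \<pi> where b: "biproduct UNIV (\<lambda>b. if b then X else Y) S \<iota> \<pi>"
    unfolding direct_sum_iff_biproduct by blast
  have "biproduct2 X Y S (\<iota> True) (\<pi> True) (\<iota> False) (\<pi> False)"
    unfolding biproduct2_def
    using biproductD(3,4)[OF b, of True] biproductD(3,4)[OF b, of False]
      biproductD(5)[OF b, of True] biproductD(5)[OF b, of False]
      biproductD(6)[OF b, of True False] biproductD(6)[OF b, of False True] biproductD(7)[OF b]
    by (simp add: UNIV_bool add.commute)
  then show "\<exists>i p j q. biproduct2 X Y S i p j q" by blast
next
  assume "\<exists>i p j q. biproduct2 X Y S i p j q"
  then show "direct_sum2 C X Y S"
    unfolding direct_sum_iff_biproduct using biproduct2_biproduct by blast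
qed

section \<open>Objects with local endomorphism ring\<close>

definition local_object :: "'o \<Rightarrow> bool" where
  "local_object X \<longleftrightarrow> X \<in> Ob C \<and> local_End C X"

lemma local_object_ob: "local_object X \<Longrightarrow> X \<in> Ob C"
  by (simp add: local_object_def)

lemma local_object_nonzero: "local_object X \<Longrightarrow> one X \<noteq> 0"
  by (simp add: local_object_def local_End_def)

lemma local_object_add:
  "local_object X \<Longrightarrow> f \<in> hom X X \<Longrightarrow> g \<in> hom X X \<Longrightarrow> iso_mor C X X (f + g)
    \<Longrightarrow> iso_mor C X X f \<or> iso_mor C X X g"
  unfolding local_object_def local_End_def hom_def by blast

lemma zero_not_iso: "X \<in> Ob C \<Longrightarrow> one X \<noteq> 0 \<Longrightarrow> \<not> iso_mor C X X 0"
  using isoE comp_zero by metis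

lemma local_object_sum:
  assumes X: "local_object X" and f: "\<And>i. i \<in> I \<Longrightarrow> f i \<in> hom X X"
    and iso: "iso_mor C X X (\<Sum>i\<in>I. f i)"
  shows "\<exists>i\<in>I. iso_mor C X X (f i)"
  using f iso
proof (induction I rule: infinite_finite_induct)
  case (insert i I)
  have "(\<Sum>i\<in>I. f i) \<in> hom X X"
    using insert.prems local_object_ob[OF X] by (intro sum_hom) auto
  then show ?case using insert local_object_add[OF X, of "f i" "sum f I"] by auto
qed (use zero_not_iso local_object_ob[OF X] local_object_nonzero[OF X] in auto)

lemma retract_via_sum:
  assumes X: "local_object X" and st: "\<And>i. i \<in> I \<Longrightarrow> s i \<in> hom X (S i) \<and> r i \<in> hom (S i) X"
    and iso: "iso_mor C X X (\<Sum>i\<in>I. r i \<cdot> s i)"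
  shows "\<exists>i\<in>I. retract X (S i)"
  using local_object_sum[OF X _ iso] st retractI_iso comp_hom by metis

text \<open>
  An idempotent of a local endomorphism ring is trivial, so a local object has no proper nonzero
  direct summand.
\<close>

lemma split_mono_into_local_object:
  assumes Y: "local_object Y" and s: "s \<in> hom X Y" and r: "r \<in> hom Y X" and rs: "r \<cdot> s = one X"
    and nz: "one X \<noteq> 0"
  shows "iso_mor C X Y s"
proof -
  have ob: "Y \<in> Ob C" using local_object_ob[OF Y] .
  define e where "e = s \<cdot> r"
  have e: "e \<in> hom Y Y" unfolding e_def using comp_hom[OF r s] .
  have es: "e \<cdot> s = s" unfolding e_def using comp_eqR[OF s r s rs] comp_one[OF s] by simp
  have "iso_mor C Y Y (e + (one Y - e))" using iso_one[OF ob] by simp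
  then consider "iso_mor C Y Y e" | "iso_mor C Y Y (one Y - e)"
    using local_object_add[OF Y e diff_hom[OF one_hom[OF ob] e]] by blast
  then show ?thesis
  proof cases
    case 1
    obtain k where k: "k \<in> hom Y Y" "e \<cdot> k = one Y" by (rule isoE[OF 1 ob ob])
    have "s \<cdot> (r \<cdot> k) = one Y" using k comp_assoc[OF k(1) r s] unfolding e_def by simp
    then show ?thesis using iso_inverse[OF s r comp_hom[OF k(1) r] rs] by simp
  next
    case 2
    obtain k where k: "k \<in> hom Y Y" "k \<cdot> (one Y - e) = one Y" by (rule isoE[OF 2 ob ob])
    have "(one Y - e) \<cdot> s = 0" using diff_comp[OF s one_hom[OF ob] e] one_comp[OF s] es by simp
    then have "s = 0"
      using comp_assoc[OF s diff_hom[OF one_hom[OF ob] e] k(1)] k(2) one_comp[OF s]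
        comp_zero[OF k(1)] by simp
    then show ?thesis using nz rs comp_zero[OF r] by simp
  qed
qed

lemma retract_local_object:
  assumes "retract X Y" "local_object X" "local_object Y"
  shows "isomorphic C X Y"
  using assms split_mono_into_local_object local_object_nonzero
  unfolding retract_def isomorphic_def by metis

lemma retract_biproduct:
  assumes X: "local_object X" and b: "biproduct I S B \<iota> \<pi>" and re: "retract X B"
  shows "\<exists>i\<in>I. retract X (S i)"
proof -
  obtain s r where s: "s \<in> hom X B" "r \<in> hom B X" "r \<cdot> s = one X"
    using re unfolding retract_def by blast
  note t = biproductD(3)[OF b] biproductD(4)[OF b]
  have "(\<Sum>i\<in>I. (r \<cdot> \<iota> i) \<cdot> (\<pi> i \<cdot> s)) = one X"
  proof -
    have "(r \<cdot> \<iota> i) \<cdot> (\<pi> i \<cdot> s) = r \<cdot> (\<iota> i \<cdot> (\<pi> i \<cdot> s))" if "i \<in> I" for i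
      using comp_assoc[OF comp_hom[OF s(1) t(2)] t(1) s(2)] that by simp
    then have "(\<Sum>i\<in>I. (r \<cdot> \<iota> i) \<cdot> (\<pi> i \<cdot> s)) = r \<cdot> (\<Sum>i\<in>I. \<iota> i \<cdot> (\<pi> i \<cdot> s))"
      using comp_sum[OF local_object_ob[OF X] s(2), of I "\<lambda>i. \<iota> i \<cdot> (\<pi> i \<cdot> s)"]
        comp_hom[OF comp_hom[OF s(1) t(2)] t(1)] by simp
    then show ?thesis using biproduct_in[OF b s(1)] s(3) by simp
  qed
  then have "iso_mor C X X (\<Sum>i\<in>I. (r \<cdot> \<iota> i) \<cdot> (\<pi> i \<cdot> s))"
    using iso_one[OF local_object_ob[OF X]] by simp
  then show ?thesis
    using retract_via_sum[OF X, of I "\<lambda>i. \<pi> i \<cdot> s" S "\<lambda>i. r \<cdot> \<iota> i"] comp_hom[OF s(1) t(2)]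
      comp_hom[OF t(1) s(2)] by blast
qed

lemma local_object_isomorphic:
  assumes X: "local_object X" and i: "isomorphic C X Y" and Y: "Y \<in> Ob C"
  shows "local_object Y"
proof -
  have ob: "X \<in> Ob C" using local_object_ob[OF X] .
  obtain f g where f: "f \<in> hom X Y" "g \<in> hom Y X" "g \<cdot> f = one X" "f \<cdot> g = one Y"
    by (rule isomorphicE[OF i ob Y])
  have if1: "iso_mor C X Y f" and ig: "iso_mor C Y X g" using isoI f by blast+
  have conj: "f \<cdot> ((g \<cdot> (u \<cdot> f)) \<cdot> g) = u" if u: "u \<in> hom Y Y" for u
  proof -
    have "(g \<cdot> (u \<cdot> f)) \<cdot> g = g \<cdot> u"
      using comp_assoc[OF f(2) comp_hom[OF f(1) u] f(2)] comp_eqR[OF f(2) f(1) u f(4)]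
        comp_one[OF u] by simp
    then show ?thesis using comp_eqL[OF u f(2,1,4)] one_comp[OF u] by simp
  qed
  have iso_u: "iso_mor C Y Y u" if u: "u \<in> hom Y Y" and iu: "iso_mor C X X (g \<cdot> (u \<cdot> f))" for u
    using iso_comp[OF iso_comp[OF ig iu Y ob ob] if1 Y ob Y] conj[OF u] by simp
  have "one Y \<noteq> 0"
    using local_object_nonzero[OF X] one_comp[OF f(1)] zero_comp[OF f(1)] f(3) comp_zero[OF f(2)]
    by auto
  moreover have "iso_mor C Y Y u \<or> iso_mor C Y Y v"
    if u: "u \<in> hom Y Y" and v: "v \<in> hom Y Y" and uv: "iso_mor C Y Y (u + v)" for u v
  proof -
    have "iso_mor C X X (g \<cdot> ((u + v) \<cdot> f))"
      using iso_comp[OF iso_comp[OF if1 uv ob Y Y] ig ob Y ob] .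
    moreover have "g \<cdot> ((u + v) \<cdot> f) = g \<cdot> (u \<cdot> f) + g \<cdot> (v \<cdot> f)"
      using add_comp[OF f(1) u v] comp_add[OF comp_hom[OF f(1) u] comp_hom[OF f(1) v] f(2)] by simp
    ultimately show ?thesis
      using local_object_add[OF X comp_hom[OF comp_hom[OF f(1) u] f(2)]
          comp_hom[OF comp_hom[OF f(1) v] f(2)]] iso_u[OF u] iso_u[OF v] by auto
  qed
  ultimately show ?thesis
    unfolding local_object_def local_End_def using Y homI by metis
qed

section \<open>Uniqueness of decompositions\<close>

text \<open>
  Gaussian elimination: the composite of an \<open>A \<times> J\<close> and a \<open>J \<times> A\<close> matrix is the identity of \<open>X\<^sup>A\<close>, and
  each diagonal entry \<open>1\<close> forces an invertible entry of the \<open>J \<times> A\<close> matrix, that is, a summand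
  isomorphic to \<open>X\<close>; clearing its row removes one index from both \<open>A\<close> and \<open>J\<close>.
\<close>

lemma card_le_multiplicity:
  assumes X: "local_object X" and "finite A" "finite J"
    and "\<And>i. i \<in> J \<Longrightarrow> local_object (Y i)"
    and "\<And>a i. a \<in> A \<Longrightarrow> i \<in> J \<Longrightarrow> s a i \<in> hom X (Y i)"
    and "\<And>a i. a \<in> A \<Longrightarrow> i \<in> J \<Longrightarrow> r a i \<in> hom (Y i) X"
    and "\<And>a b. a \<in> A \<Longrightarrow> b \<in> A \<Longrightarrow> (\<Sum>i\<in>J. r a i \<cdot> s b i) = (if a = b then one X else 0)"
  shows "card A \<le> card {i \<in> J. isomorphic C (Y i) X}"
  using assms(2-)
proof (induction A arbitrary: J s rule: finite_induct)
  case (insert n A)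
  note Y = insert.prems(2) and s = insert.prems(3) and r = insert.prems(4) and rs = insert.prems(5)
  have ob: "X \<in> Ob C" using local_object_ob[OF X] .
  have "iso_mor C X X (\<Sum>i\<in>J. r n i \<cdot> s n i)" using rs[of n n] iso_one[OF ob] by simp
  then obtain i0 where i0: "i0 \<in> J" and iso: "iso_mor C X X (r n i0 \<cdot> s n i0)"
    using local_object_sum[OF X, of J "\<lambda>i. r n i \<cdot> s n i"] comp_hom[OF s r] by blast
  have s0: "s n i0 \<in> hom X (Y i0)" and r0: "r n i0 \<in> hom (Y i0) X" using s r i0 by simp_all
  obtain k where k: "k \<in> hom X X" "k \<cdot> (r n i0 \<cdot> s n i0) = one X" by (rule isoE[OF iso ob ob])
  have "(k \<cdot> r n i0) \<cdot> s n i0 = one X" using comp_assoc[OF s0 r0 k(1)] k(2) by simp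
  then have "iso_mor C X (Y i0) (s n i0)"
    using split_mono_into_local_object[OF Y[OF i0] s0 comp_hom[OF r0 k(1)]]
      local_object_nonzero[OF X] by simp
  then obtain t where t: "t \<in> hom (Y i0) X" "t \<cdot> s n i0 = one X" "s n i0 \<cdot> t = one (Y i0)"
    by (rule isoE[OF _ ob local_object_ob[OF Y[OF i0]]])
  have "isomorphic C (Y i0) X" using isomorphicI[OF t(1) s0] t by simp
  then have "{i \<in> J. isomorphic C (Y i) X} = insert i0 {i \<in> J - {i0}. isomorphic C (Y i) X}"
    using i0 by blast
  then have card: "card {i \<in> J. isomorphic C (Y i) X} =
      Suc (card {i \<in> J - {i0}. isomorphic C (Y i) X})"
    using insert.prems(1) by simp
  define s' where "s' b i = s b i - s n i \<cdot> (t \<cdot> s b i0)" for b i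
  have ts: "t \<cdot> s b i0 \<in> hom X X" if "b \<in> A" for b
    using comp_hom[OF s[of b i0] t(1)] that i0 by simp
  have s': "s' b i \<in> hom X (Y i)" if "b \<in> A" "i \<in> J" for b i
    unfolding s'_def using diff_hom[OF s[of b i] comp_hom[OF ts s[of n i]]] that by simp
  have s'0: "s' b i0 = 0" if b: "b \<in> A" for b
    unfolding s'_def using comp_eqL[OF s[of b i0] t(1) s0 t(3)] one_comp[OF s[of b i0]] b i0
    by simp
  have "card A \<le> card {i \<in> J - {i0}. isomorphic C (Y i) X}"
  proof (rule insert.IH)
    show "finite (J - {i0})" using insert.prems(1) by simp
    show "\<And>i. i \<in> J - {i0} \<Longrightarrow> local_object (Y i)" using Y by blast
    show "\<And>a i. a \<in> A \<Longrightarrow> i \<in> J - {i0} \<Longrightarrow> s' a i \<in> hom X (Y i)" using s' by blast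
    show "\<And>a i. a \<in> A \<Longrightarrow> i \<in> J - {i0} \<Longrightarrow> r a i \<in> hom (Y i) X" using r by blast
  next
    fix a b assume a: "a \<in> A" and b: "b \<in> A"
    have "a \<noteq> n" using a insert.hyps(2) by blast
    have eq: "r a i \<cdot> s' b i = r a i \<cdot> s b i - (r a i \<cdot> s n i) \<cdot> (t \<cdot> s b i0)" if i: "i \<in> J" for i
      unfolding s'_def
      using comp_diff[OF s[of b i] comp_hom[OF ts[OF b] s[of n i]] r[of a i]]
        comp_assoc[OF ts[OF b] s[of n i] r[of a i]] a b i by simp
    have "(\<Sum>i\<in>J. r a i \<cdot> s' b i) =
        (\<Sum>i\<in>J. r a i \<cdot> s b i) - (\<Sum>i\<in>J. r a i \<cdot> s n i) \<cdot> (t \<cdot> s b i0)"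
      using eq sum_comp[OF ob ts[OF b], of J "\<lambda>i. r a i \<cdot> s n i"] comp_hom[OF s r] a
      by (simp add: sum_subtractf)
    also have "\<dots> = (if a = b then one X else 0)"
      using rs[of a b] rs[of a n] a b \<open>a \<noteq> n\<close> zero_comp[OF ts[OF b]] by simp
    finally have "(\<Sum>i\<in>J. r a i \<cdot> s' b i) = (if a = b then one X else 0)" .
    moreover have "r a i0 \<cdot> s' b i0 = 0" using s'0[OF b] comp_zero[OF r[of a i0]] a i0 by simp
    ultimately show "(\<Sum>i\<in>J - {i0}. r a i \<cdot> s' b i) = (if a = b then one X else 0)"
      using insert.prems(1) i0 by (simp add: sum_diff1)
  qed
  then show ?case using card insert.hyps by simp
qed simp

lemma multiplicity_le:
  assumes X: "local_object X"
    and b: "biproduct I Y B \<iota> \<pi>" and Y: "\<And>i. i \<in> I \<Longrightarrow> local_object (Y i)"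
    and b': "biproduct J Y' B \<iota>' \<pi>'" and Y': "\<And>i. i \<in> J \<Longrightarrow> local_object (Y' i)"
  shows "card {i \<in> I. isomorphic C (Y i) X} \<le> card {i \<in> J. isomorphic C (Y' i) X}"
proof -
  define A where "A = {i \<in> I. isomorphic C (Y i) X}"
  have ob: "X \<in> Ob C" using local_object_ob[OF X] .
  have "\<forall>a\<in>A. \<exists>f g. f \<in> hom X (Y a) \<and> g \<in> hom (Y a) X \<and> g \<cdot> f = one X"
    unfolding A_def using isomorphicE[OF isomorphic_sym ob] local_object_ob[OF Y] by (metis mem_Collect_eq)
  then obtain f g where fg: "\<And>a. a \<in> A \<Longrightarrow> f a \<in> hom X (Y a)" "\<And>a. a \<in> A \<Longrightarrow> g a \<in> hom (Y a) X"
    "\<And>a. a \<in> A \<Longrightarrow> g a \<cdot> f a = one X" by metis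
  have A: "a \<in> I" if "a \<in> A" for a using that unfolding A_def by blast
  define s where "s a = \<iota> a \<cdot> f a" for a
  define r where "r a = g a \<cdot> \<pi> a" for a
  have s: "s a \<in> hom X B" if "a \<in> A" for a
    unfolding s_def using comp_hom[OF fg(1) biproductD(3)[OF b A]] that by blast
  have r: "r a \<in> hom B X" if "a \<in> A" for a
    unfolding r_def using comp_hom[OF biproductD(4)[OF b A] fg(2)] that by blast
  have rs: "r a \<cdot> s d = (if a = d then one X else 0)" if a: "a \<in> A" and d: "d \<in> A" for a d
  proof -
    note t = fg(1)[OF d] biproductD(3)[OF b A[OF d]] biproductD(4)[OF b A[OF a]] fg(2)[OF a]
    have "r a \<cdot> s d = g a \<cdot> ((\<pi> a \<cdot> \<iota> d) \<cdot> f d)"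
      unfolding r_def s_def
      using comp_assoc[OF comp_hom[OF t(1,2)] t(3,4)] comp_assoc[OF t(1,2,3)] by simp
    then show ?thesis
      using biproductD(5)[OF b A[OF d]] biproductD(6)[OF b A[OF d] A[OF a]] fg(3)[OF d]
        one_comp[OF t(1)] zero_comp[OF t(1)] comp_zero[OF t(4)] by auto
  qed
  note t' = biproductD(3)[OF b'] biproductD(4)[OF b']
  have "card A \<le> card {i \<in> J. isomorphic C (Y' i) X}"
  proof (rule card_le_multiplicity[OF X])
    show "finite A" "finite J" using biproductD(1)[OF b] biproductD(1)[OF b'] unfolding A_def by auto
    show "\<And>i. i \<in> J \<Longrightarrow> local_object (Y' i)" using Y' .
    show "\<And>a i. a \<in> A \<Longrightarrow> i \<in> J \<Longrightarrow> \<pi>' i \<cdot> s a \<in> hom X (Y' i)" using comp_hom[OF s t'(2)] .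
    show "\<And>a i. a \<in> A \<Longrightarrow> i \<in> J \<Longrightarrow> r a \<cdot> \<iota>' i \<in> hom (Y' i) X" using comp_hom[OF t'(1) r] .
  next
    fix a d assume a: "a \<in> A" and d: "d \<in> A"
    have "(r a \<cdot> \<iota>' i) \<cdot> (\<pi>' i \<cdot> s d) = r a \<cdot> (\<iota>' i \<cdot> (\<pi>' i \<cdot> s d))" if "i \<in> J" for i
      using comp_assoc[OF comp_hom[OF s[OF d] t'(2)] t'(1) r[OF a]] that by simp
    then have "(\<Sum>i\<in>J. (r a \<cdot> \<iota>' i) \<cdot> (\<pi>' i \<cdot> s d)) = r a \<cdot> (\<Sum>i\<in>J. \<iota>' i \<cdot> (\<pi>' i \<cdot> s d))"
      using comp_sum[OF ob r[OF a], of J "\<lambda>i. \<iota>' i \<cdot> (\<pi>' i \<cdot> s d)"]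
        comp_hom[OF comp_hom[OF s[OF d] t'(2)] t'(1)] by simp
    then show "(\<Sum>i\<in>J. (r a \<cdot> \<iota>' i) \<cdot> (\<pi>' i \<cdot> s d)) = (if a = d then one X else 0)"
      using biproduct_in[OF b' s[OF d]] rs[OF a d] by simp
  qed
  then show ?thesis unfolding A_def .
qed

end

section \<open>Exactness in a triangulated category\<close>

context additive_category
begin

lemma ex_biproduct:
  fixes I :: "nat set"
  assumes "finite I" "\<And>i. i \<in> I \<Longrightarrow> X i \<in> Ob C"
  obtains S \<iota> \<pi> where "biproduct I X S \<iota> \<pi>"
  using ex_direct_sum[of I X] assms unfolding direct_sum_iff_biproduct by blast

lemma ex_zero_object: "\<exists>Z. zero_object C Z"
proof -
  obtain S \<iota> \<pi> where "biproduct ({} :: nat set) undefined S \<iota> \<pi>"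
    using ex_biproduct[of "{}" undefined] by auto
  then show ?thesis unfolding zero_object_def biproduct_def by auto
qed

lemma ex_biproduct2:
  assumes "X \<in> Ob C" "Y \<in> Ob C"
  obtains S i p j q where "biproduct2 X Y S i p j q"
proof -
  obtain S \<iota> \<pi> where b: "biproduct {0, 1 :: nat} (\<lambda>n. if n = 0 then X else Y) S \<iota> \<pi>"
    by (rule ex_biproduct[of "{0, 1 :: nat}" "\<lambda>n. if n = 0 then X else Y"]) (use assms in auto)
  have "biproduct2 X Y S (\<iota> 0) (\<pi> 0) (\<iota> 1) (\<pi> 1)"
    unfolding biproduct2_def
    using biproductD(3,4)[OF b, of 0] biproductD(3,4)[OF b, of 1]
      biproductD(5)[OF b, of 0] biproductD(5)[OF b, of 1]
      biproductD(6)[OF b, of 0 1] biproductD(6)[OF b, of 1 0] biproductD(7)[OF b]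
    by simp
  then show ?thesis using that by blast
qed

end

context triangulated_category
begin

abbreviation sh :: "'o \<Rightarrow> 'o" where
  "sh \<equiv> ShO C"

abbreviation shm :: "'a \<Rightarrow> 'a" where
  "shm \<equiv> ShM C"

lemma shm_hom: "f \<in> hom X Y \<Longrightarrow> shm f \<in> hom (sh X) (sh Y)"
  unfolding hom_def using bij_betwE[OF ShM_bij] ShO_Ob by blast

lemma shm_comp: "f \<in> hom X Y \<Longrightarrow> g \<in> hom Y Z \<Longrightarrow> shm (g \<cdot> f) = shm g \<cdot> shm f"
  unfolding hom_def using ShM_Comp by blast

lemma shm_add: "f \<in> hom X Y \<Longrightarrow> g \<in> hom X Y \<Longrightarrow> shm (f + g) = shm f + shm g"
  unfolding hom_def using ShM_add by blast

lemma shm_zero: "X \<in> Ob C \<Longrightarrow> Y \<in> Ob C \<Longrightarrow> shm 0 = 0"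
  using shm_add[of 0 X Y 0] zero_hom by simp

lemma shm_minus: "f \<in> hom X Y \<Longrightarrow> shm (- f) = - shm f"
  using shm_add[of f X Y "- f"] shm_zero[of X Y] hom_src[of f X Y] hom_trg[of f X Y] minus_hom[of f X Y]
  by (simp add: eq_neg_iff_add_eq_0 add.commute)

lemma shm_diff: "f \<in> hom X Y \<Longrightarrow> g \<in> hom X Y \<Longrightarrow> shm (f - g) = shm f - shm g"
  using shm_add[of f X Y "- g"] by (simp add: shm_minus minus_hom)

lemma shm_inj: "f \<in> hom X Y \<Longrightarrow> g \<in> hom X Y \<Longrightarrow> shm f = shm g \<Longrightarrow> f = g"
  unfolding hom_def using bij_betw_imp_inj_on[OF ShM_bij] by (auto dest: inj_onD)

lemma shm_surj:
  assumes "u \<in> hom (sh X) (sh Y)" "X \<in> Ob C" "Y \<in> Ob C"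
  obtains f where "f \<in> hom X Y" "u = shm f"
  using assms bij_betw_imp_surj_on[OF ShM_bij[OF assms(2,3)]] unfolding hom_def by blast

lemma iso_shmD:
  assumes f: "f \<in> hom X Y" and i: "iso_mor C (sh X) (sh Y) (shm f)"
  shows "iso_mor C X Y f"
proof -
  have X: "X \<in> Ob C" and Y: "Y \<in> Ob C" using f hom_src hom_trg by blast+
  obtain u where u: "u \<in> hom (sh Y) (sh X)" "u \<cdot> shm f = one (sh X)" "shm f \<cdot> u = one (sh Y)"
    by (rule isoE[OF i ShO_Ob[OF X] ShO_Ob[OF Y]])
  obtain g where g: "g \<in> hom Y X" "u = shm g" by (rule shm_surj[OF u(1) Y X])
  have "g \<cdot> f = one X"
    using shm_inj[OF comp_hom[OF f g(1)] one_hom[OF X]] shm_comp[OF f g(1)] u(2) g(2)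
      ShM_Ident[OF X] by simp
  moreover have "f \<cdot> g = one Y"
    using shm_inj[OF comp_hom[OF g(1) f] one_hom[OF Y]] shm_comp[OF g(1) f] u(3) g(2)
      ShM_Ident[OF Y] by simp
  ultimately show ?thesis using isoI[OF f g(1)] by simp
qed

lemma zero_object_sh: "zero_object C Z \<Longrightarrow> zero_object C (sh Z)"
  unfolding zero_object_def using ShO_Ob ShM_Ident shm_zero by metis

lemma triD:
  assumes "Tri C X Y Z f g h"
  shows "f \<in> hom X Y" "g \<in> hom Y Z" "h \<in> hom Z (sh X)" "X \<in> Ob C" "Y \<in> Ob C" "Z \<in> Ob C"
  using Tri_typed[OF assms] ShO_Ob unfolding hom_def by auto

lemma rot: "Tri C X Y Z f g h \<Longrightarrow> Tri C Y Z (sh X) g h (- shm f)"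
  using Tri_rotate Tri_typed by metis

lemma fill_third:
  assumes "Tri C X Y Z f g h" "Tri C X' Y' Z' f' g' h'"
    "a \<in> hom X X'" "b \<in> hom Y Y'" "f' \<cdot> a = b \<cdot> f"
  obtains c where "c \<in> hom Z Z'" "g' \<cdot> b = c \<cdot> g" "h' \<cdot> c = shm a \<cdot> h"
  using Tri_morphism[OF assms(1,2) hom_Hom[OF assms(3)] hom_Hom[OF assms(4)] assms(5)]
    triD(6)[OF assms(1)] triD(6)[OF assms(2)] unfolding hom_def by blast

lemma tri_Ident: "X \<in> Ob C \<Longrightarrow> zero_object C Z \<Longrightarrow> Tri C X X Z (one X) 0 0"
  using Tri_Ident .

lemma tri_Ident':
  assumes X: "X \<in> Ob C" and Z: "zero_object C Z"
  shows "Tri C Z X X 0 (one X) 0"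
proof -
  have ob: "Z \<in> Ob C" using Z unfolding zero_object_def by simp
  have "Tri C X X (sh Z) (one X) 0 (- shm 0)"
    using tri_Ident[OF X zero_object_sh[OF Z]] shm_zero[OF ob X] by simp
  then show ?thesis
    using Tri_rotate[OF ob X X, of 0 "one X" 0] zero_hom[OF ob X] zero_hom[OF X ShO_Ob[OF ob]]
      one_hom[OF X] hom_Hom by blast
qed

lemma tri_gf:
  assumes T: "Tri C X Y Z f g h"
  shows "g \<cdot> f = 0"
proof -
  obtain O' where O': "zero_object C O'" using ex_zero_object by blast
  note t = triD[OF T]
  obtain c where c: "c \<in> hom O' Z" "g \<cdot> f = c \<cdot> 0"
    by (rule fill_third[OF tri_Ident[OF t(4) O'] T one_hom[OF t(4)] t(1)]) auto
  then show ?thesis using comp_zero[OF c(1)] by simp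
qed

lemma tri_hg: "Tri C X Y Z f g h \<Longrightarrow> h \<cdot> g = 0"
  using tri_gf[OF rot] .

lemma tri_shf_h:
  assumes T: "Tri C X Y Z f g h"
  shows "shm f \<cdot> h = 0"
  using tri_hg[OF rot[OF T]] minus_comp[OF triD(3)[OF T] shm_hom[OF triD(1)[OF T]]] by simp

text \<open>
  Exactness of the contravariant hom functor: \<open>u\<close> is a component of a morphism to the triangle
  \<open>0 \<rightarrow> W \<rightarrow> W \<rightarrow> \<Sigma>0\<close>, and the filler is the extension. Dually, lifts below come from the
  triangle \<open>W \<rightarrow> W \<rightarrow> 0 \<rightarrow> \<Sigma>W\<close>.
\<close>

lemma tri_extend:
  assumes T: "Tri C X Y Z f g h" and u: "u \<in> hom Y W" and 0: "u \<cdot> f = 0"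
  obtains t where "t \<in> hom Z W" "t \<cdot> g = u"
proof -
  obtain O' where O': "zero_object C O'" using ex_zero_object by blast
  note t = triD[OF T]
  have ob: "O' \<in> Ob C" using O' unfolding zero_object_def by simp
  have z: "0 \<in> hom X O'" using zero_hom[OF t(4) ob] .
  obtain c where "c \<in> hom Z W" "one W \<cdot> u = c \<cdot> g"
    using fill_third[OF T tri_Ident'[OF hom_trg[OF u] O'] z u] 0 zero_comp[OF z] by metis
  then show ?thesis using that one_comp[OF u] by simp
qed

lemma tri_lift:
  assumes T: "Tri C X Y Z f g h" and u: "u \<in> hom W Y" and 0: "g \<cdot> u = 0"
  obtains t where "t \<in> hom W X" "f \<cdot> t = u"
proof -
  obtain O' where O': "zero_object C O'" using ex_zero_object by blast
  note t = triD[OF T]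
  have W: "W \<in> Ob C" using hom_src[OF u] .
  have ob: "O' \<in> Ob C" using O' unfolding zero_object_def by simp
  have z: "0 \<in> hom O' Z" using zero_hom[OF ob t(6)] .
  obtain c where c: "c \<in> hom (sh W) (sh X)" "(- shm f) \<cdot> c = shm u \<cdot> (- shm (one W))"
    using fill_third[OF rot[OF tri_Ident[OF W O']] rot[OF T] u z] 0 comp_zero[OF z] by metis
  obtain s where s: "s \<in> hom W X" "c = shm s" by (rule shm_surj[OF c(1) W t(4)])
  have "shm u \<cdot> (- shm (one W)) = - shm u"
    using comp_minus[OF one_hom[OF ShO_Ob[OF W]] shm_hom[OF u]] comp_one[OF shm_hom[OF u]]
      ShM_Ident[OF W] by simp
  moreover have "(- shm f) \<cdot> c = - shm (f \<cdot> s)"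
    using minus_comp[OF c(1) shm_hom[OF t(1)]] shm_comp[OF s(1) t(1)] s(2) by simp
  ultimately have "shm (f \<cdot> s) = shm u" using c(2) by simp
  then have "f \<cdot> s = u" using shm_inj[OF comp_hom[OF s(1) t(1)] u] by simp
  then show ?thesis using that s(1) by blast
qed

lemma tri_extend_second:
  assumes T: "Tri C X Y Z f g h" and u: "u \<in> hom Z W" and 0: "u \<cdot> g = 0"
  obtains t where "t \<in> hom (sh X) W" "t \<cdot> h = u"
  using tri_extend[OF rot[OF T] u 0] .

lemma tri_lift_second:
  assumes T: "Tri C X Y Z f g h" and u: "u \<in> hom W Z" and 0: "h \<cdot> u = 0"
  obtains t where "t \<in> hom W Y" "g \<cdot> t = u"
  using tri_lift[OF rot[OF T] u 0] .

text \<open>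
  Two rotations turn an extension along \<open>f\<close> into an extension of \<open>\<Sigma>u\<close> along \<open>- \<Sigma>f\<close>; fullness of the shift
  brings the solution back.
\<close>

lemma tri_extend_first:
  assumes T: "Tri C X Y Z f g h" and u: "u \<in> hom X W" and 0: "shm u \<cdot> h = 0"
  obtains t where "t \<in> hom Y W" "t \<cdot> f = u"
proof -
  note t = triD[OF T]
  obtain c where c: "c \<in> hom (sh Y) (sh W)" "c \<cdot> (- shm f) = shm u"
    using tri_extend[OF rot[OF rot[OF T]] shm_hom[OF u] 0] .
  obtain s where s: "s \<in> hom Y W" "c = shm s" by (rule shm_surj[OF c(1) t(5) hom_trg[OF u]])
  have "shm ((- s) \<cdot> f) = shm u"
    using c(2) s comp_minus[OF shm_hom[OF t(1)] shm_hom[OF s(1)]] minus_comp[OF t(1) s(1)]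
      shm_minus[OF comp_hom[OF t(1) s(1)]] shm_comp[OF t(1) s(1)] by simp
  then have "(- s) \<cdot> f = u" using shm_inj[OF comp_hom[OF t(1) minus_hom[OF s(1)]] u] by simp
  then show ?thesis using that minus_hom[OF s(1)] by blast
qed

definition ext_zero :: "'o \<Rightarrow> 'o \<Rightarrow> bool" where
  "ext_zero X Y \<longleftrightarrow> X \<in> Ob C \<and> Y \<in> Ob C \<and> (\<forall>u \<in> hom X (sh Y). u = 0)"

lemma ext_zeroD: "ext_zero X Y \<Longrightarrow> u \<in> hom X (sh Y) \<Longrightarrow> u = 0"
  unfolding ext_zero_def by blast

lemma extend_ext_zero:
  assumes T: "Tri C X Y Z f g h" and u: "u \<in> hom X W" and 0: "ext_zero Z W"
  obtains t where "t \<in> hom Y W" "t \<cdot> f = u"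
  using tri_extend_first[OF T u] ext_zeroD[OF 0 comp_hom[OF triD(3)[OF T] shm_hom[OF u]]] by blast

lemma lift_ext_zero:
  assumes T: "Tri C X Y Z f g h" and u: "u \<in> hom W Z" and 0: "ext_zero W X"
  obtains t where "t \<in> hom W Y" "g \<cdot> t = u"
  using tri_lift_second[OF T u] ext_zeroD[OF 0 comp_hom[OF u triD(3)[OF T]]] by blast

lemma fill_first:
  assumes T: "Tri C X Y Z f g h" and T': "Tri C X' Y' Z' f' g' h'"
    and b: "b \<in> hom Y Y'" and c: "c \<in> hom Z Z'" and eq: "g' \<cdot> b = c \<cdot> g"
  obtains a where "a \<in> hom X X'" "f' \<cdot> a = b \<cdot> f" "shm a \<cdot> h = h' \<cdot> c"
proof -
  note t = triD[OF T] and t' = triD[OF T']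
  obtain d where d: "d \<in> hom (sh X) (sh X')" "h' \<cdot> c = d \<cdot> h" "(- shm f') \<cdot> d = shm b \<cdot> (- shm f)"
    using fill_third[OF rot[OF T] rot[OF T'] b c eq] .
  obtain a where a: "a \<in> hom X X'" "d = shm a" by (rule shm_surj[OF d(1) t(4) t'(4)])
  have "shm (f' \<cdot> a) = shm (b \<cdot> f)"
    using d(3) a(2) minus_comp[OF d(1) shm_hom[OF t'(1)]] comp_minus[OF shm_hom[OF t(1)] shm_hom[OF b]]
      shm_comp[OF a(1) t'(1)] shm_comp[OF t(1) b] by simp
  then have "f' \<cdot> a = b \<cdot> f" using shm_inj[OF comp_hom[OF a(1) t'(1)] comp_hom[OF t(1) b]] by simp
  then show ?thesis using that a d(2) by simp
qed

text \<open>
  \<open>\<theta> - 1\<close> vanishes on \<open>Y\<close>, so it factors through \<open>h\<close>; since \<open>h\<close> kills it, it squares to zero.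
\<close>

lemma iso_of_endomorphism_third:
  assumes T: "Tri C X Y Z f g h" and th: "\<theta> \<in> hom Z Z" and g: "\<theta> \<cdot> g = g" and h: "h \<cdot> \<theta> = h"
  shows "iso_mor C Z Z \<theta>"
proof -
  note t = triD[OF T]
  define u where "u = \<theta> - one Z"
  have u: "u \<in> hom Z Z" unfolding u_def using diff_hom[OF th one_hom[OF t(6)]] .
  have "u \<cdot> g = 0" unfolding u_def using diff_comp[OF t(2) th one_hom[OF t(6)]] one_comp[OF t(2)] g by simp
  then obtain x where x: "x \<in> hom (sh X) Z" "x \<cdot> h = u" using tri_extend_second[OF T u] by blast
  have "h \<cdot> u = 0" unfolding u_def using comp_diff[OF th one_hom[OF t(6)] t(3)] comp_one[OF t(3)] h by simp
  then have "u \<cdot> u = 0" using comp_assoc[OF u t(3) x(1)] x(2) comp_zero[OF x(1)] by simp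
  then show ?thesis using iso_one_plus_nilpotent[OF u] unfolding u_def by simp
qed

text \<open>
  A filler of the inverse square composes with \<open>c\<close>, on either side, to an endomorphism that is
  compatible with the identities of the other two objects.
\<close>

lemma five_third:
  assumes T: "Tri C X Y Z f g h" and T': "Tri C X' Y' Z' f' g' h'"
    and a: "iso_mor C X X' a" and b: "iso_mor C Y Y' b" and c: "c \<in> hom Z Z'"
    and 1: "f' \<cdot> a = b \<cdot> f" and 2: "g' \<cdot> b = c \<cdot> g" and 3: "h' \<cdot> c = shm a \<cdot> h"
  shows "iso_mor C Z Z' c"
proof -
  note t = triD[OF T] and t' = triD[OF T']
  obtain a' where a': "a \<in> hom X X'" "a' \<in> hom X' X" "a' \<cdot> a = one X" "a \<cdot> a' = one X'"
    by (rule isoE[OF a t(4) t'(4)])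
  obtain b' where b': "b \<in> hom Y Y'" "b' \<in> hom Y' Y" "b' \<cdot> b = one Y" "b \<cdot> b' = one Y'"
    by (rule isoE[OF b t(5) t'(5)])
  have "b' \<cdot> f' = b' \<cdot> ((f' \<cdot> a) \<cdot> a')"
    using comp_assoc[OF a'(2,1) t'(1)] a'(4) comp_one[OF t'(1)] by simp
  also have "\<dots> = f \<cdot> a'"
    using 1 comp_assoc[OF a'(2) t(1) b'(1)] comp_eqL[OF comp_hom[OF a'(2) t(1)] b'(1,2,3)]
      one_comp[OF comp_hom[OF a'(2) t(1)]] by simp
  finally have 4: "f \<cdot> a' = b' \<cdot> f'" by simp
  obtain d where d: "d \<in> hom Z' Z" "g \<cdot> b' = d \<cdot> g'" "h \<cdot> d = shm a' \<cdot> h'"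
    using fill_third[OF T' T a'(2) b'(2) 4] .
  have sa: "shm a' \<cdot> shm a = one (sh X)" "shm a \<cdot> shm a' = one (sh X')"
    using shm_comp[OF a'(1,2)] shm_comp[OF a'(2,1)] a'(3,4) ShM_Ident t t' by simp_all
  have "(d \<cdot> c) \<cdot> g = g"
    using comp_assoc[OF t(2) c d(1)] 2[symmetric] comp_assoc[OF b'(1) t'(2) d(1)] d(2)[symmetric]
      comp_assoc[OF b'(1,2) t(2)] b'(3) comp_one[OF t(2)] by simp
  moreover have "h \<cdot> (d \<cdot> c) = h"
    using comp_assoc[OF c d(1) t(3)] d(3) comp_assoc[OF c t'(3) shm_hom[OF a'(2)]] 3
      comp_assoc[OF t(3) shm_hom[OF a'(1)] shm_hom[OF a'(2)]] sa one_comp[OF t(3)] by simp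
  ultimately have dc: "iso_mor C Z Z (d \<cdot> c)"
    using iso_of_endomorphism_third[OF T comp_hom[OF c d(1)]] by simp
  have "(c \<cdot> d) \<cdot> g' = g'"
    using comp_assoc[OF t'(2) d(1) c] d(2)[symmetric] comp_assoc[OF b'(2) t(2) c] 2[symmetric]
      comp_assoc[OF b'(2,1) t'(2)] b'(4) comp_one[OF t'(2)] by simp
  moreover have "h' \<cdot> (c \<cdot> d) = h'"
    using comp_assoc[OF d(1) c t'(3)] 3 comp_assoc[OF d(1) t(3) shm_hom[OF a'(1)]] d(3)
      comp_assoc[OF t'(3) shm_hom[OF a'(2)] shm_hom[OF a'(1)]] sa one_comp[OF t'(3)] by simp
  ultimately have cd: "iso_mor C Z' Z' (c \<cdot> d)"
    using iso_of_endomorphism_third[OF T' comp_hom[OF d(1) c]] by simp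
  show ?thesis using iso_two_sided[OF c d(1) d(1) dc cd] .
qed

lemma five_first:
  assumes T: "Tri C X Y Z f g h" and T': "Tri C X' Y' Z' f' g' h'"
    and a: "a \<in> hom X X'" and b: "iso_mor C Y Y' b" and c: "iso_mor C Z Z' c"
    and 1: "f' \<cdot> a = b \<cdot> f" and 2: "g' \<cdot> b = c \<cdot> g" and 3: "h' \<cdot> c = shm a \<cdot> h"
  shows "iso_mor C X X' a"
proof -
  note t = triD[OF T] and t' = triD[OF T']
  have bh: "b \<in> hom Y Y'" using isoE[OF b t(5) t'(5)] .
  have "(- shm f') \<cdot> shm a = shm b \<cdot> (- shm f)"
    using minus_comp[OF shm_hom[OF a] shm_hom[OF t'(1)]] comp_minus[OF shm_hom[OF t(1)] shm_hom[OF bh]]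
      shm_comp[OF a t'(1)] shm_comp[OF t(1) bh] 1 by simp
  then have "iso_mor C (sh X) (sh X') (shm a)"
    using five_third[OF rot[OF T] rot[OF T'] b c shm_hom[OF a] 2 3] by simp
  then show ?thesis using iso_shmD[OF a] by simp
qed

lemma tri_replace_third:
  assumes T: "Tri C X Y Z f g h" and i: "iso_mor C Z Z' \<alpha>" and Z': "Z' \<in> Ob C"
  shows "\<exists>h'. Tri C X Y Z' f (\<alpha> \<cdot> g) h'"
proof -
  note t = triD[OF T]
  obtain \<beta> where a: "\<alpha> \<in> hom Z Z'" "\<beta> \<in> hom Z' Z" "\<beta> \<cdot> \<alpha> = one Z" "\<alpha> \<cdot> \<beta> = one Z'"
    by (rule isoE[OF i t(6) Z'])
  have "Tri C X Y Z' f (\<alpha> \<cdot> g) (h \<cdot> \<beta>)"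
  proof (rule Tri_iso[OF T t(4) t(5) Z'])
    show "f \<in> Hom C X Y" "\<alpha> \<cdot> g \<in> Hom C Y Z'" "h \<cdot> \<beta> \<in> Hom C Z' (sh X)"
      using hom_Hom t(1) comp_hom[OF t(2) a(1)] comp_hom[OF a(2) t(3)] by blast+
    show "iso_mor C X X (one X)" "iso_mor C Y Y (one Y)" "iso_mor C Z Z' \<alpha>"
      using iso_one t i by blast+
    show "f \<cdot> one X = one Y \<cdot> f" using comp_one[OF t(1)] one_comp[OF t(1)] by simp
    show "\<alpha> \<cdot> g \<cdot> one Y = \<alpha> \<cdot> g" using comp_one[OF comp_hom[OF t(2) a(1)]] .
    show "h \<cdot> \<beta> \<cdot> \<alpha> = shm (one X) \<cdot> h"
      using comp_assoc[OF a(1,2) t(3)] a(3) comp_one[OF t(3)] one_comp[OF t(3)] ShM_Ident[OF t(4)]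
      by simp
  qed
  then show ?thesis by blast
qed

text \<open>
  Because \<open>i\<close> is a split monomorphism, the third map of a triangle on \<open>i\<close> vanishes, and its cone is
  identified with \<open>B\<close> through \<open>q\<close>.
\<close>

lemma split_triangle:
  assumes b: "biproduct2 A B M i p j q"
  shows "Tri C A M B i q 0"
proof -
  note t = biproduct2D[OF b]
  have A: "A \<in> Ob C" and M: "M \<in> Ob C" and B: "B \<in> Ob C" using hom_src hom_trg t by blast+
  obtain K \<kappa> h where T: "Tri C A M K i \<kappa> h" using Tri_complete[OF A M hom_Hom[OF t(1)]] by blast
  note k = triD[OF T]
  have "h = shm (p \<cdot> i) \<cdot> h" using t(5) ShM_Ident[OF A] one_comp[OF k(3)] by simp
  also have "\<dots> = 0"
    using shm_comp[OF t(1,2)] comp_eqR[OF k(3) shm_hom[OF t(1)] shm_hom[OF t(2)] tri_shf_h[OF T]]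
      comp_zero[OF shm_hom[OF t(2)]] by simp
  finally have h: "h = 0" .
  obtain c where c: "c \<in> hom K B" "c \<cdot> \<kappa> = q" using tri_extend[OF T t(4) t(8)] .
  have kj: "\<kappa> \<cdot> j \<in> hom B K" using comp_hom[OF t(3) k(2)] .
  have 1: "c \<cdot> (\<kappa> \<cdot> j) = one B" using comp_eqL[OF t(3) k(2) c] t(6) by simp
  have "j \<cdot> q = one M - i \<cdot> p" using t(9) by (simp add: algebra_simps)
  then have "\<kappa> \<cdot> (j \<cdot> q) = \<kappa>"
    using comp_diff[OF one_hom[OF M] comp_hom[OF t(2,1)] k(2)] comp_one[OF k(2)]
      comp_eqL[OF t(2,1) k(2) tri_gf[OF T]] zero_comp[OF t(2)] by simp
  then have "((\<kappa> \<cdot> j) \<cdot> c) \<cdot> \<kappa> = \<kappa>"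
    using comp_eqR[OF k(2) c(1) kj c(2)] comp_assoc[OF t(4,3) k(2)] by simp
  then have "((\<kappa> \<cdot> j) \<cdot> c - one K) \<cdot> \<kappa> = 0"
    using diff_comp[OF k(2) comp_hom[OF c(1) kj] one_hom[OF k(6)]] one_comp[OF k(2)] by simp
  then obtain y where y: "y \<in> hom (sh A) K" "y \<cdot> h = (\<kappa> \<cdot> j) \<cdot> c - one K"
    using tri_extend_second[OF T diff_hom[OF comp_hom[OF c(1) kj] one_hom[OF k(6)]]] by blast
  then have "(\<kappa> \<cdot> j) \<cdot> c = one K" using h comp_zero[OF y(1)] by simp
  then have ic: "iso_mor C K B c" using isoI[OF c(1) kj _ 1] by simp
  obtain h' where T': "Tri C A M B i (c \<cdot> \<kappa>) h'" using tri_replace_third[OF T ic B] by blast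
  have "h' = 0"
    using comp_assoc[OF t(3,4) triD(3)[OF T']] tri_hg[OF T'] c(2) t(6) comp_one[OF triD(3)[OF T']]
      zero_comp[OF t(3)] by simp
  then show ?thesis using T' c(2) by simp
qed

text \<open>Idempotents split: the cone of a split monomorphism is a complement.\<close>

lemma retract_complement:
  assumes s: "s \<in> hom B S" and r: "r \<in> hom S B" and rs: "r \<cdot> s = one B"
  obtains K t \<kappa> where "biproduct2 B K S s r t \<kappa>"
proof -
  have B: "B \<in> Ob C" and S: "S \<in> Ob C" using hom_src hom_trg s by blast+
  obtain K \<kappa> h where T: "Tri C B S K s \<kappa> h" using Tri_complete[OF B S hom_Hom[OF s]] by blast
  note k = triD[OF T]
  have "h = shm (r \<cdot> s) \<cdot> h" using rs ShM_Ident[OF B] one_comp[OF k(3)] by simp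
  also have "\<dots> = 0"
    using shm_comp[OF s r] comp_eqR[OF k(3) shm_hom[OF s] shm_hom[OF r] tri_shf_h[OF T]]
      comp_zero[OF shm_hom[OF r]] by simp
  finally have h: "h = 0" .
  define e where "e = one S - s \<cdot> r"
  have e: "e \<in> hom S S" unfolding e_def using diff_hom[OF one_hom[OF S] comp_hom[OF r s]] .
  have "e \<cdot> s = 0"
    unfolding e_def using diff_comp[OF s one_hom[OF S] comp_hom[OF r s]] one_comp[OF s]
      comp_eqR[OF s r s rs] comp_one[OF s] by simp
  then obtain t where t: "t \<in> hom K S" "t \<cdot> \<kappa> = e" using tri_extend[OF T e] by blast
  have epi: "u = v" if u: "u \<in> hom K W" and v: "v \<in> hom K W" and eq: "u \<cdot> \<kappa> = v \<cdot> \<kappa>" for u v W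
  proof -
    obtain y where y: "y \<in> hom (sh B) W" "y \<cdot> h = u - v"
      using tri_extend_second[OF T diff_hom[OF u v]] diff_comp[OF k(2) u v] eq by auto
    then show ?thesis using h comp_zero[OF y(1)] by simp
  qed
  have "(\<kappa> \<cdot> t) \<cdot> \<kappa> = \<kappa>"
    using comp_assoc[OF k(2) t(1) k(2)] t(2) comp_diff[OF one_hom[OF S] comp_hom[OF r s] k(2)]
      comp_one[OF k(2)] comp_eqL[OF r s k(2) tri_gf[OF T]] zero_comp[OF r] unfolding e_def by simp
  then have kt: "\<kappa> \<cdot> t = one K"
    using epi[OF comp_hom[OF t(1) k(2)] one_hom[OF k(6)]] one_comp[OF k(2)] by simp
  have "(r \<cdot> t) \<cdot> \<kappa> = 0"
    using comp_assoc[OF k(2) t(1) r] t(2) comp_diff[OF one_hom[OF S] comp_hom[OF r s] r]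
      comp_one[OF r] comp_eqL[OF r s r rs] one_comp[OF r] unfolding e_def by simp
  then have rt: "r \<cdot> t = 0"
    using epi[OF comp_hom[OF t(1) r] zero_hom[OF k(6) B]] zero_comp[OF k(2)] by simp
  have "biproduct2 B K S s r t \<kappa>"
    unfolding biproduct2_def using s r t k(2) rs kt rt tri_gf[OF T] unfolding e_def by simp
  then show ?thesis using that by blast
qed

section \<open>Direct sums of triangles\<close>

lemma biproduct_sh:
  assumes b: "biproduct I X S \<iota> \<pi>"
  shows "biproduct I (\<lambda>i. sh (X i)) (sh S) (\<lambda>i. shm (\<iota> i)) (\<lambda>i. shm (\<pi> i))"
proof -
  note t = biproductD(3)[OF b] biproductD(4)[OF b]
  have X: "X i \<in> Ob C" if "i \<in> I" for i using hom_src[OF t(1)[OF that]] .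
  have eq: "shm (\<pi> j) \<cdot> shm (\<iota> i) = (if i = j then one (sh (X i)) else 0)"
    if i: "i \<in> I" and j: "j \<in> I" for i j
    using shm_comp[OF t(1)[OF i] t(2)[OF j]] biproductD(5)[OF b i] biproductD(6)[OF b i j]
      ShM_Ident[OF X[OF i]] shm_zero[OF X[OF i] X[OF j]] by auto
  have "shm (\<Sum>i\<in>J. \<iota> i \<cdot> \<pi> i) = (\<Sum>i\<in>J. shm (\<iota> i) \<cdot> shm (\<pi> i))" if "J \<subseteq> I" for J
    using finite_subset[OF that biproductD(1)[OF b]] that
  proof (induction J rule: finite_induct)
    case empty
    then show ?case using shm_zero[OF biproductD(2)[OF b] biproductD(2)[OF b]] by simp
  next
    case (insert i J)
    have "(\<Sum>i\<in>J. \<iota> i \<cdot> \<pi> i) \<in> hom S S"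
      using sum_hom[OF biproductD(2)[OF b] biproductD(2)[OF b], of J "\<lambda>i. \<iota> i \<cdot> \<pi> i"]
        comp_hom[OF t(2,1)] insert.prems by blast
    then show ?case
      using insert shm_add[OF comp_hom[OF t(2,1), of i]] shm_comp[OF t(2,1), of i] by simp
  qed
  from this[of I] have "(\<Sum>i\<in>I. shm (\<iota> i) \<cdot> shm (\<pi> i)) = one (sh S)"
    using biproductD(7)[OF b] ShM_Ident[OF biproductD(2)[OF b]] by simp
  then show ?thesis
    unfolding biproduct_def
    using biproductD(1)[OF b] ShO_Ob[OF biproductD(2)[OF b]] shm_hom[OF t(1)] shm_hom[OF t(2)] eq
    by simp
qed

text \<open>
  The comparison map from the sum of the cones to the cone of the sum has the comparison map in the
  other direction as an inverse up to isomorphism: both composites differ from the identity by a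
  map of square zero.
\<close>

lemma sum_of_triangles:
  assumes bX: "biproduct I X S \<iota> \<pi>" and bY: "biproduct I Y S' \<iota>' \<pi>'"
    and bZ: "biproduct I Z S'' \<iota>'' \<pi>''"
    and T: "\<And>i. i \<in> I \<Longrightarrow> Tri C (X i) (Y i) (Z i) (f i) (g i) (h i)"
  shows "Tri C S S' S'' (\<Sum>i\<in>I. \<iota>' i \<cdot> (f i \<cdot> \<pi> i)) (\<Sum>i\<in>I. \<iota>'' i \<cdot> (g i \<cdot> \<pi>' i))
    (\<Sum>i\<in>I. shm (\<iota> i) \<cdot> (h i \<cdot> \<pi>'' i))" (is "Tri C S S' S'' ?F ?G ?H")
proof -
  note tX = biproductD(3)[OF bX] biproductD(4)[OF bX]
  note tY = biproductD(3)[OF bY] biproductD(4)[OF bY]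
  note tZ = biproductD(3)[OF bZ] biproductD(4)[OF bZ]
  note tf = triD(1)[OF T] triD(2)[OF T] triD(3)[OF T]
  have tf': "\<forall>i\<in>I. f i \<in> hom (X i) (Y i)" "\<forall>i\<in>I. g i \<in> hom (Y i) (Z i)"
    "\<forall>i\<in>I. h i \<in> hom (Z i) (sh (X i))" using tf by blast+
  note F = diagonal[OF bX bY tf'(1)]
  note G = diagonal[OF bY bZ tf'(2)]
  note H = diagonal[OF bZ biproduct_sh[OF bX] tf'(3)]
  have ob: "S \<in> Ob C" "S' \<in> Ob C" "S'' \<in> Ob C"
    using biproductD(2)[OF bX] biproductD(2)[OF bY] biproductD(2)[OF bZ] .
  obtain K k l where K: "Tri C S S' K ?F k l" using Tri_complete[OF ob(1,2) hom_Hom[OF F(1)]] by blast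
  note tK = triD[OF K]
  have "\<forall>i\<in>I. \<exists>c. c \<in> hom (Z i) K \<and> k \<cdot> \<iota>' i = c \<cdot> g i \<and> l \<cdot> c = shm (\<iota> i) \<cdot> h i"
    using fill_third[OF T K tX(1) tY(1) F(2)] by blast
  then obtain c where c: "\<forall>i\<in>I. c i \<in> hom (Z i) K"
    "\<And>i. i \<in> I \<Longrightarrow> k \<cdot> \<iota>' i = c i \<cdot> g i" "\<And>i. i \<in> I \<Longrightarrow> l \<cdot> c i = shm (\<iota> i) \<cdot> h i" by metis
  have "\<forall>i\<in>I. \<exists>d. d \<in> hom K (Z i) \<and> g i \<cdot> \<pi>' i = d \<cdot> k \<and> h i \<cdot> d = shm (\<pi> i) \<cdot> l"
    using fill_third[OF K T tX(2) tY(2) F(3)[symmetric]] by blast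
  then obtain d where d: "\<forall>i\<in>I. d i \<in> hom K (Z i)"
    "\<And>i. i \<in> I \<Longrightarrow> g i \<cdot> \<pi>' i = d i \<cdot> k" "\<And>i. i \<in> I \<Longrightarrow> h i \<cdot> d i = shm (\<pi> i) \<cdot> l" by metis
  define c' where "c' = (\<Sum>i\<in>I. c i \<cdot> \<pi>'' i)"
  define d' where "d' = (\<Sum>i\<in>I. \<iota>'' i \<cdot> d i)"
  note c' = cotuple[OF bZ tK(6) c(1), folded c'_def]
  note d' = tuple[OF bZ tK(6) d(1), folded d'_def]
  have cG: "c' \<cdot> ?G = k"
  proof (rule biproduct_out_eqI[OF bY comp_hom[OF G(1) c'(1)] tK(2)])
    fix i assume i: "i \<in> I"
    show "(c' \<cdot> ?G) \<cdot> \<iota>' i = k \<cdot> \<iota>' i"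
      using comp_eqR[OF tY(1)[OF i] G(1) c'(1) G(2)[OF i]]
        comp_eqL[OF tf(2)[OF i] tZ(1)[OF i] c'(1) c'(2)[OF i]] c(2)[OF i] by simp
  qed
  have lc: "l \<cdot> c' = ?H"
  proof (rule biproduct_out_eqI[OF bZ comp_hom[OF c'(1) tK(3)] H(1)])
    fix i assume i: "i \<in> I"
    show "(l \<cdot> c') \<cdot> \<iota>'' i = ?H \<cdot> \<iota>'' i"
      using comp_eqR[OF tZ(1)[OF i] c'(1) tK(3) c'(2)[OF i]] H(2)[OF i] c(3)[OF i] by simp
  qed
  have dk: "d' \<cdot> k = ?G"
  proof (rule biproduct_in_eqI[OF bZ comp_hom[OF tK(2) d'(1)] G(1)])
    fix i assume i: "i \<in> I"
    show "\<pi>'' i \<cdot> (d' \<cdot> k) = \<pi>'' i \<cdot> ?G"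
      using comp_eqL[OF tK(2) d'(1) tZ(2)[OF i] d'(2)[OF i]] G(3)[OF i] d(2)[OF i] by simp
  qed
  have Hd: "?H \<cdot> d' = l"
  proof (rule biproduct_in_eqI[OF biproduct_sh[OF bX] comp_hom[OF d'(1) H(1)] tK(3)])
    fix i assume i: "i \<in> I"
    show "shm (\<pi> i) \<cdot> (?H \<cdot> d') = shm (\<pi> i) \<cdot> l"
      using comp_eqL[OF d'(1) H(1) shm_hom[OF tX(2)[OF i]] H(3)[OF i]]
        comp_eqR[OF d'(1) tZ(2)[OF i] tf(3)[OF i] d'(2)[OF i]] d(3)[OF i] by simp
  qed
  have "(c' \<cdot> d') \<cdot> k = k" using comp_eqR[OF tK(2) d'(1) c'(1) dk] cG by simp
  moreover have "l \<cdot> (c' \<cdot> d') = l" using comp_eqL[OF d'(1) c'(1) tK(3) lc] Hd by simp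
  ultimately have cd: "iso_mor C K K (c' \<cdot> d')"
    using iso_of_endomorphism_third[OF K comp_hom[OF d'(1) c'(1)]] by simp
  define u where "u = d' \<cdot> c' - one S''"
  have u: "u \<in> hom S'' S''"
    unfolding u_def using diff_hom[OF comp_hom[OF c'(1) d'(1)] one_hom[OF ob(3)]] .
  have uG: "u \<cdot> ?G = 0"
    unfolding u_def using diff_comp[OF G(1) comp_hom[OF c'(1) d'(1)] one_hom[OF ob(3)]]
      comp_eqR[OF G(1) c'(1) d'(1) cG] dk one_comp[OF G(1)] by simp
  have Hu: "?H \<cdot> u = 0"
    unfolding u_def using comp_diff[OF comp_hom[OF c'(1) d'(1)] one_hom[OF ob(3)] H(1)]
      comp_eqL[OF c'(1) d'(1) H(1) Hd] lc comp_one[OF H(1)] by simp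
  have "\<exists>x. x \<in> hom (sh (X i)) S'' \<and> x \<cdot> h i = u \<cdot> \<iota>'' i" if i: "i \<in> I" for i
  proof -
    have "(u \<cdot> \<iota>'' i) \<cdot> g i = 0"
      using comp_assoc[OF tf(2)[OF i] tZ(1)[OF i] u] G(2)[OF i] comp_eqL[OF tY(1)[OF i] G(1) u uG]
        zero_comp[OF tY(1)[OF i]] by simp
    then show ?thesis
      using tri_extend_second[OF T[OF i] comp_hom[OF tZ(1)[OF i] u]] by blast
  qed
  then obtain x where x: "\<forall>i\<in>I. x i \<in> hom (sh (X i)) S''"
    "\<And>i. i \<in> I \<Longrightarrow> x i \<cdot> h i = u \<cdot> \<iota>'' i" by metis
  define x' where "x' = (\<Sum>i\<in>I. x i \<cdot> shm (\<pi> i))"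
  note x' = cotuple[OF biproduct_sh[OF bX] ob(3) x(1), folded x'_def]
  have "x' \<cdot> ?H = u"
  proof (rule biproduct_out_eqI[OF bZ comp_hom[OF H(1) x'(1)] u])
    fix i assume i: "i \<in> I"
    show "(x' \<cdot> ?H) \<cdot> \<iota>'' i = u \<cdot> \<iota>'' i"
      using comp_eqR[OF tZ(1)[OF i] H(1) x'(1) H(2)[OF i]]
        comp_eqL[OF tf(3)[OF i] shm_hom[OF tX(1)[OF i]] x'(1) x'(2)[OF i]] x(2)[OF i] by simp
  qed
  then have "u \<cdot> u = 0" using comp_eqR[OF u H(1) x'(1) Hu] comp_zero[OF x'(1)] by simp
  then have dc: "iso_mor C S'' S'' (d' \<cdot> c')"
    using iso_one_plus_nilpotent[OF u] unfolding u_def by simp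
  have "iso_mor C S'' K c'" using iso_two_sided[OF c'(1) d'(1) d'(1) dc cd] .
  then obtain e where e: "e \<in> hom K S''" "e \<cdot> c' = one S''" "c' \<cdot> e = one K"
    by (rule isoE[OF _ ob(3) tK(6)])
  have ie: "iso_mor C K S'' e" using isoI[OF e(1) c'(1)] e by simp
  show ?thesis
  proof (rule Tri_iso[OF K ob])
    show "?F \<in> Hom C S S'" "?G \<in> Hom C S' S''" "?H \<in> Hom C S'' (sh S)"
      using F(1) G(1) H(1) hom_Hom by blast+
    show "iso_mor C S S (one S)" "iso_mor C S' S' (one S')" "iso_mor C K S'' e"
      using iso_one ob ie by blast+
    show "?F \<cdot> one S = one S' \<cdot> ?F" using comp_one[OF F(1)] one_comp[OF F(1)] by simp
    show "?G \<cdot> one S' = e \<cdot> k"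
      using comp_one[OF G(1)] comp_eqL[OF G(1) c'(1) e(1,2)] one_comp[OF G(1)] cG by simp
    show "?H \<cdot> e = shm (one S) \<cdot> l"
      using comp_eqR[OF e(1) c'(1) tK(3) e(3)] lc comp_one[OF tK(3)] one_comp[OF tK(3)]
        ShM_Ident[OF ob(1)] by simp
  qed
qed

text \<open>
  The octahedron over \<open>Z \<rightarrow> Q \<oplus> G \<rightarrow> Q\<close> relates the cone of \<open>Z \<rightarrow> Q \<oplus> G\<close> to \<open>\<Sigma>X \<rightarrow> \<Sigma>G\<close>. That map is \<open>\<Sigma>x\<close>,
  so the cone is the cone \<open>Z'\<close> of \<open>x\<close>.
\<close>

lemma mayer_vietoris:
  assumes T1: "Tri C X Z Q u v w" and T2: "Tri C X G Z' x z \<zeta>"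
    and y: "y \<in> hom Z G" and yu: "y \<cdot> u = x" and b: "biproduct2 Q G M i p j q"
  shows "\<exists>\<mu> \<delta>. Tri C Z M Z' (i \<cdot> v + j \<cdot> y) \<mu> \<delta>"
proof -
  note t1 = triD[OF T1] and t2 = triD[OF T2] and t = biproduct2D[OF b]
  define \<phi> where "\<phi> = i \<cdot> v + j \<cdot> y"
  note iv = comp_hom[OF t1(2) t(1)] and jy = comp_hom[OF y t(3)]
  have f: "\<phi> \<in> hom Z M" unfolding \<phi>_def using add_hom[OF iv jy] .
  have M: "M \<in> Ob C" using hom_trg[OF f] .
  obtain N n n' where N: "Tri C Z M N \<phi> n n'" using Tri_complete[OF t1(5) M hom_Hom[OF f]] by blast
  note tN = triD[OF N]
  have pf: "p \<cdot> \<phi> = v"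
    unfolding \<phi>_def using comp_add[OF iv jy t(2)] comp_eqL[OF t1(2) t(1,2,5)] comp_eqL[OF y t(3,2,7)]
      one_comp[OF t1(2)] zero_comp[OF y] by simp
  have R1: "Tri C M Q (sh G) p 0 (- shm j)" using rot[OF split_triangle[OF biproduct2_sym[OF b]]] .
  have R2: "Tri C Z Q (sh X) (p \<cdot> \<phi>) w (- shm u)" using rot[OF T1] pf by simp
  obtain a d where A: "Tri C N (sh X) (sh G) a d (shm n \<cdot> (- shm j))"
    and d: "(- shm j) \<cdot> d = shm \<phi> \<cdot> (- shm u)"
    using Tri_octahedral[OF N R1 R2] by blast
  have dh: "d \<in> hom (sh X) (sh G)" using triD(2)[OF A] .
  have "\<phi> \<cdot> u = j \<cdot> x"
    unfolding \<phi>_def using add_comp[OF t1(1) iv jy] comp_eqR[OF t1(1) t1(2) t(1) tri_gf[OF T1]]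
      comp_eqR[OF t1(1) y t(3) yu] comp_zero[OF t(1)] by simp
  then have "shm j \<cdot> d = shm j \<cdot> shm x"
    using d minus_comp[OF dh shm_hom[OF t(3)]] comp_minus[OF shm_hom[OF t1(1)] shm_hom[OF f]]
      shm_comp[OF t1(1) f] shm_comp[OF t2(1) t(3)] by simp
  then have "shm (q \<cdot> j) \<cdot> d = shm (q \<cdot> j) \<cdot> shm x"
    using shm_comp[OF t(3,4)] comp_assoc[OF dh shm_hom[OF t(3)] shm_hom[OF t(4)]]
      comp_assoc[OF shm_hom[OF t2(1)] shm_hom[OF t(3)] shm_hom[OF t(4)]] by simp
  then have dx: "d = shm x"
    using t(6) ShM_Ident[OF t2(5)] one_comp[OF dh] one_comp[OF shm_hom[OF t2(1)]] by simp
  have B: "Tri C Z' (sh X) (sh G) \<zeta> (- shm x) (- shm z)" using rot[OF rot[OF T2]] .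
  have sX: "sh X \<in> Ob C" and sG: "sh G \<in> Ob C" using ShO_Ob t1 t2 by blast+
  have eq: "(- shm x) \<cdot> one (sh X) = (- one (sh G)) \<cdot> d"
    using dx comp_one[OF minus_hom[OF shm_hom[OF t2(1)]]] minus_comp[OF dh one_hom[OF sG]]
      one_comp[OF dh] by simp
  obtain \<alpha> where al: "\<alpha> \<in> hom N Z'" "\<zeta> \<cdot> \<alpha> = one (sh X) \<cdot> a"
    "shm \<alpha> \<cdot> (shm n \<cdot> (- shm j)) = (- shm z) \<cdot> (- one (sh G))"
    using fill_first[OF A B one_hom[OF sX] minus_hom[OF one_hom[OF sG]] eq] .
  have "iso_mor C N Z' \<alpha>"
    using five_first[OF A B al(1) iso_one[OF sX] iso_minus[OF iso_one[OF sG] sG sG] al(2) eq]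
      al(3) by simp
  then show ?thesis using tri_replace_third[OF N _ t2(6)] unfolding \<phi>_def by blast
qed

end

section \<open>Indecomposable objects\<close>

locale krull_schmidt_triangulated = triangulated_category C
  for C :: "('o, 'a::ab_group_add, 'k::field, 'z) triangulated_cat_scheme" (structure) +
  assumes krull_schmidt: "krull_schmidt C"
begin

lemma decomposition:
  assumes "X \<in> Ob C"
  obtains n :: nat and Y \<iota> \<pi> where "biproduct {..<n} Y X \<iota> \<pi>" "\<And>i. i \<in> {..<n} \<Longrightarrow> local_object (Y i)"
proof -
  obtain n :: nat and Y where Y: "direct_sum_of C {..<n} Y X" "\<forall>i<n. local_End C (Y i)"
    using krull_schmidt assms unfolding krull_schmidt_def by blast
  then have "\<forall>i\<in>{..<n}. local_object (Y i)"
    unfolding local_object_def direct_sum_of_def by auto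
  then show ?thesis using that Y(1) unfolding direct_sum_iff_biproduct by blast
qed

text \<open>
  The first local summand of an indecomposable object has a complement, which must vanish. Conversely, a
  nonzero summand of a local object is the whole object.
\<close>

lemma indecomposable_iff_local: "indecomposable C X \<longleftrightarrow> local_object X"
proof
  assume ind: "indecomposable C X"
  then have X: "X \<in> Ob C" "\<not> zero_object C X" unfolding indecomposable_def by auto
  obtain n :: nat and Y \<iota> \<pi> where b: "biproduct {..<n} Y X \<iota> \<pi>"
    and Y: "\<And>i. i \<in> {..<n} \<Longrightarrow> local_object (Y i)" by (rule decomposition[OF X(1)]) blast
  have "n \<noteq> 0" using biproductD(7)[OF b] X unfolding zero_object_def by (cases n) auto
  then have 0: "0 \<in> {..<n}" by simp
  obtain K t \<kappa> where b2: "biproduct2 (Y 0) K X (\<iota> 0) (\<pi> 0) t \<kappa>"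
    using retract_complement[OF biproductD(3,4,5)[OF b 0]] .
  have "\<not> zero_object C (Y 0)" using local_object_nonzero[OF Y[OF 0]] unfolding zero_object_def by simp
  then have K: "zero_object C K" using ind b2 unfolding indecomposable_def direct_sum2_iff by blast
  have "t = 0" using zero_object_out[OF biproduct2D(3)[OF b2] K] .
  then have "\<iota> 0 \<cdot> \<pi> 0 = one X"
    using biproduct2D(9)[OF b2] zero_comp[OF biproduct2D(4)[OF b2]] by simp
  then have "isomorphic C (Y 0) X"
    using isomorphicI[OF biproductD(3,4,5)[OF b 0]] by simp
  then show "local_object X" using local_object_isomorphic[OF Y[OF 0]] X(1) by blast
next
  assume X: "local_object X"
  have "zero_object C Y \<or> zero_object C Z" if "direct_sum2 C Y Z X" for Y Z
  proof -
    obtain i p j q where b: "biproduct2 Y Z X i p j q" using \<open>direct_sum2 C Y Z X\<close> direct_sum2_iff by blast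
    note t = biproduct2D[OF b]
    show ?thesis
    proof (rule ccontr)
      assume "\<not> ?thesis"
      then have nz: "one Y \<noteq> 0" "one Z \<noteq> 0"
        using t hom_src unfolding zero_object_def by blast+
      have "iso_mor C Y X i" using split_mono_into_local_object[OF X t(1,2,5) nz(1)] .
      then obtain k where k: "k \<in> hom X Y" "i \<cdot> k = one X"
        by (rule isoE[OF _ hom_src[OF t(1)] local_object_ob[OF X]])
      have "q = 0" using comp_eqL[OF k(1) t(1,4,8)] k(2) comp_one[OF t(4)] zero_comp[OF k(1)] by simp
      then show False using t(6) nz(2) zero_comp[OF t(3)] by simp
    qed
  qed
  then show "indecomposable C X"
    unfolding indecomposable_def zero_object_def
    using local_object_ob[OF X] local_object_nonzero[OF X] by blast
qed

section \<open>Additive closures\<close>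

text \<open>
  This is the additive closure of \<open>L\<close> when \<open>L\<close> consists of local objects, by the Krull-Schmidt property.
  Describing it through local summands makes its closure properties immediate and does not depend
  on a choice of direct sum of \<open>L\<close>.
\<close>

definition Add :: "'o set \<Rightarrow> 'o set" where
  "Add L = {B \<in> Ob C. \<forall>X. local_object X \<longrightarrow> retract X B \<longrightarrow> (\<exists>A\<in>L. isomorphic C X A)}"

lemma Add_ob: "B \<in> Add L \<Longrightarrow> B \<in> Ob C"
  by (simp add: Add_def)

lemma Add_mono: "L \<subseteq> L' \<Longrightarrow> Add L \<subseteq> Add L'"
  unfolding Add_def by blast

lemma AddD: "B \<in> Add L \<Longrightarrow> local_object X \<Longrightarrow> retract X B \<Longrightarrow> \<exists>A\<in>L. isomorphic C X A"
  unfolding Add_def by blast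

lemma retract_refl: "X \<in> Ob C \<Longrightarrow> retract X X"
  using isomorphic_retract isomorphic_refl by blast

lemma Add_generator: "A \<in> L \<Longrightarrow> local_object A \<Longrightarrow> A \<in> Add L"
  unfolding Add_def using retract_local_object local_object_ob by blast

lemma Add_retract: "B \<in> Add L \<Longrightarrow> retract A B \<Longrightarrow> A \<in> Add L"
  unfolding Add_def using retract_trans retract_ob by blast

lemma Add_biproduct: "biproduct I S B \<iota> \<pi> \<Longrightarrow> (\<And>i. i \<in> I \<Longrightarrow> S i \<in> Add L) \<Longrightarrow> B \<in> Add L"
  unfolding Add_def using retract_biproduct biproductD(2) by blast

lemma Add_biproduct2: "biproduct2 X Y S i p j q \<Longrightarrow> X \<in> Add L \<Longrightarrow> Y \<in> Add L \<Longrightarrow> S \<in> Add L"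
  using Add_biproduct[OF biproduct2_biproduct] by (metis (full_types))

lemma Add_zero: "zero_object C Z \<Longrightarrow> Z \<in> Add L"
  unfolding Add_def retract_def zero_object_def
  using zero_object_in comp_zero local_object_nonzero unfolding zero_object_def by fastforce

lemma add_closure_eq_Add:
  fixes I :: "nat set"
  assumes U: "direct_sum_of C I Rs U" and loc: "\<And>l. l \<in> I \<Longrightarrow> local_object (Rs l)"
  shows "add_closure C U = Add (Rs ` I)"
proof
  obtain \<iota> \<pi> where bU: "biproduct I Rs U \<iota> \<pi>" using U direct_sum_iff_biproduct by blast
  have UA: "U \<in> Add (Rs ` I)" using Add_biproduct[OF bU] Add_generator loc by blast
  show "add_closure C U \<subseteq> Add (Rs ` I)"
  proof
    fix X assume "X \<in> add_closure C U"
    then obtain n :: nat and Y S where S: "direct_sum_of C {..<n} (\<lambda>_. U) S" "direct_sum2 C X Y S"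
      unfolding add_closure_def by blast
    have "S \<in> Add (Rs ` I)" using S(1) Add_biproduct UA unfolding direct_sum_iff_biproduct by blast
    moreover have "retract X S"
      using S(2) unfolding direct_sum2_iff retract_def biproduct2_def by blast
    ultimately show "X \<in> Add (Rs ` I)" using Add_retract by blast
  qed
  show "Add (Rs ` I) \<subseteq> add_closure C U"
  proof
    fix B assume B: "B \<in> Add (Rs ` I)"
    obtain n :: nat and Y \<iota>' \<pi>' where b: "biproduct {..<n} Y B \<iota>' \<pi>'"
      and Y: "\<And>i. i \<in> {..<n} \<Longrightarrow> local_object (Y i)" by (rule decomposition[OF Add_ob[OF B]]) blast
    have "retract (Y i) U" if i: "i \<in> {..<n}" for i
    proof -
      obtain l where l: "l \<in> I" "isomorphic C (Y i) (Rs l)"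
        using AddD[OF B Y[OF i] biproduct_retract[OF b i]] by blast
      show ?thesis
        using retract_trans[OF isomorphic_retract[OF l(2)] biproduct_retract[OF bU l(1)]]
          local_object_ob Y[OF i] loc[OF l(1)] by blast
    qed
    then have "\<forall>i\<in>{..<n}. \<exists>s r. s \<in> hom (Y i) U \<and> r \<in> hom U (Y i) \<and> r \<cdot> s = one (Y i)"
      unfolding retract_def by blast
    then obtain s r where s: "\<forall>i\<in>{..<n}. s i \<in> hom (Y i) U" and r: "\<forall>i\<in>{..<n}. r i \<in> hom U (Y i)"
      and rs: "\<forall>i\<in>{..<n}. r i \<cdot> s i = one (Y i)" by metis
    obtain S \<iota>'' \<pi>'' where bS: "biproduct {..<n} (\<lambda>_. U) S \<iota>'' \<pi>''"
      by (rule ex_biproduct[of "{..<n}" "\<lambda>_. U"]) (use Add_ob[OF UA] in auto)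
    note F = diagonal[OF b bS s] and R = diagonal[OF bS b r]
    define F' where "F' = (\<Sum>i<n. \<iota>'' i \<cdot> (s i \<cdot> \<pi>' i))"
    define R' where "R' = (\<Sum>i<n. \<iota>' i \<cdot> (r i \<cdot> \<pi>'' i))"
    note F = F[folded F'_def] and R = R[folded R'_def]
    have "R' \<cdot> F' = one B"
    proof (rule biproduct_out_eqI[OF b comp_hom[OF F(1) R(1)] one_hom[OF Add_ob[OF B]]])
      fix i assume i: "i \<in> {..<n}"
      note ti = biproductD(3)[OF b i] biproductD(3)[OF bS i]
      have "(R' \<cdot> F') \<cdot> \<iota>' i = (R' \<cdot> \<iota>'' i) \<cdot> s i"
        using comp_eqR[OF ti(1) F(1) R(1) F(2)[OF i]] comp_assoc[OF s[rule_format, OF i] ti(2) R(1)]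
        by simp
      also have "\<dots> = \<iota>' i"
        using R(2)[OF i] comp_eqR[OF s[rule_format, OF i] r[rule_format, OF i] ti(1) rs[rule_format, OF i]]
          comp_one[OF ti(1)] by simp
      finally show "(R' \<cdot> F') \<cdot> \<iota>' i = one B \<cdot> \<iota>' i" using one_comp[OF ti(1)] by simp
    qed
    then obtain K t \<kappa> where "biproduct2 B K S F' R' t \<kappa>"
      using retract_complement[OF F(1) R(1)] by blast
    then show "B \<in> add_closure C U"
      unfolding add_closure_def using Add_ob[OF B] bS direct_sum2_iff direct_sum_iff_biproduct by blast
  qed
qed

section \<open>Multiplicities\<close>

lemma multiplicity_eq:
  assumes X: "local_object X" and b: "biproduct I Y B \<iota> \<pi>"
    and Y: "\<And>i. i \<in> I \<Longrightarrow> local_object (Y i)"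
  shows "multiplicity C X B = card {i \<in> I. isomorphic C (Y i) X}"
  unfolding multiplicity_def
proof (rule the_equality)
  obtain n :: nat and Y' \<iota>' \<pi>' where b': "biproduct {..<n} Y' B \<iota>' \<pi>'"
    and Y': "\<And>i. i \<in> {..<n} \<Longrightarrow> local_object (Y' i)"
    by (rule decomposition[OF biproductD(2)[OF b]]) blast
  have "card {i \<in> I. isomorphic C (Y i) X} = card {i \<in> {..<n}. isomorphic C (Y' i) X}"
    using multiplicity_le[OF X b Y b' Y'] multiplicity_le[OF X b' Y' b Y] by simp
  then show "\<exists>(n::nat) Y'. direct_sum_of C {..<n} Y' B \<and> (\<forall>i<n. indecomposable C (Y' i)) \<and>
      card {i \<in> I. isomorphic C (Y i) X} = card {i. i < n \<and> isomorphic C (Y' i) X}"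
    using b' Y' unfolding direct_sum_iff_biproduct indecomposable_iff_local
    by (intro exI[of _ n] exI[of _ Y']) auto
next
  fix r assume "\<exists>(n::nat) Y'. direct_sum_of C {..<n} Y' B \<and> (\<forall>i<n. indecomposable C (Y' i)) \<and>
      r = card {i. i < n \<and> isomorphic C (Y' i) X}"
  then obtain n :: nat and Y' \<iota>' \<pi>' where b': "biproduct {..<n} Y' B \<iota>' \<pi>'"
    and Y': "\<forall>i<n. local_object (Y' i)" and r: "r = card {i. i < n \<and> isomorphic C (Y' i) X}"
    unfolding direct_sum_iff_biproduct indecomposable_iff_local by blast
  have Y'': "\<And>i. i \<in> {..<n} \<Longrightarrow> local_object (Y' i)" using Y' by simp
  have "{i. i < n \<and> isomorphic C (Y' i) X} = {i \<in> {..<n}. isomorphic C (Y' i) X}" by auto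
  then show "r = card {i \<in> I. isomorphic C (Y i) X}"
    using r multiplicity_le[OF X b Y b' Y''] multiplicity_le[OF X b' Y'' b Y] by simp
qed

lemma multiplicity_isomorphic:
  assumes X: "local_object X" and i: "isomorphic C B B'" and B: "B \<in> Ob C" and B': "B' \<in> Ob C"
  shows "multiplicity C X B = multiplicity C X B'"
proof -
  obtain n :: nat and Y \<iota> \<pi> where b: "biproduct {..<n} Y B \<iota> \<pi>"
    and Y: "\<And>i. i \<in> {..<n} \<Longrightarrow> local_object (Y i)" by (rule decomposition[OF B]) blast
  obtain \<iota>' \<pi>' where b': "biproduct {..<n} Y B' \<iota>' \<pi>'" using biproduct_isomorphic[OF b i B'] by blast
  show ?thesis using multiplicity_eq[OF X b Y] multiplicity_eq[OF X b' Y] by simp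
qed

lemma multiplicity_biproduct:
  assumes X: "local_object X" and b: "biproduct I S B \<iota> \<pi>"
  shows "multiplicity C X B = (\<Sum>i\<in>I. multiplicity C X (S i))"
proof -
  have "\<exists>n Y \<iota>' \<pi>'. biproduct {..<n::nat} Y (S i) \<iota>' \<pi>' \<and> (\<forall>a\<in>{..<n}. local_object (Y a))"
    if i: "i \<in> I" for i
    using decomposition[OF hom_src[OF biproductD(3)[OF b i]]] by metis
  then obtain n Y \<iota>' \<pi>' where b': "\<And>i. i \<in> I \<Longrightarrow> biproduct {..<n i::nat} (Y i) (S i) (\<iota>' i) (\<pi>' i)"
    and Y: "\<And>i. i \<in> I \<Longrightarrow> \<forall>a\<in>{..<n i}. local_object (Y i a)" by metis
  have fin: "finite I" using biproductD(1)[OF b] .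
  have "multiplicity C X B = card {x \<in> (SIGMA i:I. {..<n i}). isomorphic C (case x of (i, a) \<Rightarrow> Y i a) X}"
    using multiplicity_eq[OF X biproduct_Sigma[OF b b']] Y by auto
  also have "{x \<in> (SIGMA i:I. {..<n i}). isomorphic C (case x of (i, a) \<Rightarrow> Y i a) X} =
      (SIGMA i:I. {a \<in> {..<n i}. isomorphic C (Y i a) X})" by auto
  also have "card \<dots> = (\<Sum>i\<in>I. card {a \<in> {..<n i}. isomorphic C (Y i a) X})"
    using fin by (intro card_SigmaI) auto
  also have "\<dots> = (\<Sum>i\<in>I. multiplicity C X (S i))"
    using multiplicity_eq[OF X b'] Y by (intro sum.cong) auto
  finally show ?thesis .
qed

lemma multiplicity_biproduct2:
  "local_object X \<Longrightarrow> biproduct2 Y Z S i p j q \<Longrightarrow>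
    multiplicity C X S = multiplicity C X Y + multiplicity C X Z"
  using multiplicity_biproduct[OF _ biproduct2_biproduct] by (simp add: UNIV_bool add.commute)

lemma multiplicity_local:
  assumes X: "local_object X" and Y: "local_object Y"
  shows "multiplicity C X Y = (if isomorphic C Y X then 1 else 0)"
proof -
  note o = one_hom[OF local_object_ob[OF Y]]
  have b: "biproduct {()} (\<lambda>_. Y) Y (\<lambda>_. one Y) (\<lambda>_. one Y)"
    unfolding biproduct_def using o comp_one[OF o] local_object_ob[OF Y] by simp
  show ?thesis using multiplicity_eq[OF X b] Y by simp
qed

lemma multiplicity_eq_0_iff:
  assumes X: "local_object X" and B: "B \<in> Ob C"
  shows "multiplicity C X B = 0 \<longleftrightarrow> \<not> retract X B"
proof -
  obtain n :: nat and Y \<iota> \<pi> where b: "biproduct {..<n} Y B \<iota> \<pi>"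
    and Y: "\<And>i. i \<in> {..<n} \<Longrightarrow> local_object (Y i)" by (rule decomposition[OF B]) blast
  have "multiplicity C X B = 0 \<longleftrightarrow> (\<forall>i\<in>{..<n}. \<not> isomorphic C (Y i) X)"
    using multiplicity_eq[OF X b Y] by auto
  also have "\<dots> \<longleftrightarrow> \<not> retract X B"
  proof
    assume "\<forall>i\<in>{..<n}. \<not> isomorphic C (Y i) X"
    then show "\<not> retract X B"
      using retract_biproduct[OF X b] retract_local_object[OF _ X Y] isomorphic_sym by blast
  next
    assume "\<not> retract X B"
    then show "\<forall>i\<in>{..<n}. \<not> isomorphic C (Y i) X"
      using retract_trans[OF isomorphic_retract[OF isomorphic_sym] biproduct_retract[OF b]]
        local_object_ob[OF Y] local_object_ob[OF X] by blast
  qed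
  finally show ?thesis .
qed

text \<open>
  In a local endomorphism ring, one of two elements with sum \<open>1\<close> is invertible.
\<close>

lemma retract_through:
  assumes X: "local_object X" and s: "s \<in> hom X S" and r: "r \<in> hom S X"
    and s': "s' \<in> hom X S'" and r': "r' \<in> hom S' X" and eq: "r \<cdot> s + r' \<cdot> s' = one X"
  shows "retract X S \<or> retract X S'"
  using local_object_add[OF X comp_hom[OF s r] comp_hom[OF s' r']] eq iso_one[OF local_object_ob[OF X]]
    retractI_iso[OF s r] retractI_iso[OF s' r'] by auto

section \<open>Orthogonality\<close>

lemma ext_zero_retract_left:
  assumes re: "retract X' X" and e: "ext_zero X Y"
  shows "ext_zero X' Y"
proof -
  obtain s r where s: "s \<in> hom X' X" "r \<in> hom X X'" "r \<cdot> s = one X'"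
    using re unfolding retract_def by blast
  have "u = 0" if u: "u \<in> hom X' (sh Y)" for u
    using comp_assoc[OF s(1,2) u] s(3) comp_one[OF u] ext_zeroD[OF e comp_hom[OF s(2) u]]
      zero_comp[OF s(1)] by simp
  then show ?thesis using e hom_src[OF s(1)] unfolding ext_zero_def by blast
qed

lemma ext_zero_retract_right:
  assumes re: "retract Y' Y" and e: "ext_zero X Y"
  shows "ext_zero X Y'"
proof -
  obtain s r where s: "s \<in> hom Y' Y" "r \<in> hom Y Y'" "r \<cdot> s = one Y'"
    using re unfolding retract_def by blast
  have ob: "Y' \<in> Ob C" using hom_src[OF s(1)] .
  have "u = 0" if u: "u \<in> hom X (sh Y')" for u
    using comp_assoc[OF u shm_hom[OF s(1)] shm_hom[OF s(2)]] shm_comp[OF s(1,2)] s(3)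
      ShM_Ident[OF ob] one_comp[OF u] ext_zeroD[OF e comp_hom[OF u shm_hom[OF s(1)]]]
      comp_zero[OF shm_hom[OF s(2)]] by simp
  then show ?thesis using e ob unfolding ext_zero_def by blast
qed

lemma ext_zero_Add_left:
  assumes B: "B \<in> Add L" and Y: "Y \<in> Ob C" and e: "\<And>A. A \<in> L \<Longrightarrow> ext_zero A Y"
  shows "ext_zero B Y"
proof -
  obtain n :: nat and Z \<iota> \<pi> where b: "biproduct {..<n} Z B \<iota> \<pi>"
    and Z: "\<And>i. i \<in> {..<n} \<Longrightarrow> local_object (Z i)" by (rule decomposition[OF Add_ob[OF B]]) blast
  have eZ: "ext_zero (Z i) Y" if i: "i \<in> {..<n}" for i
  proof -
    obtain A where A: "A \<in> L" "isomorphic C (Z i) A"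
      using AddD[OF B Z[OF i] biproduct_retract[OF b i]] by blast
    have "A \<in> Ob C" using e[OF A(1)] unfolding ext_zero_def by blast
    then show ?thesis
      using ext_zero_retract_left[OF isomorphic_retract[OF A(2) local_object_ob[OF Z[OF i]]] e[OF A(1)]]
      by blast
  qed
  have "u = 0" if u: "u \<in> hom B (sh Y)" for u
  proof (rule biproduct_out_eqI[OF b u zero_hom[OF Add_ob[OF B] hom_trg[OF u]]])
    fix i assume i: "i \<in> {..<n}"
    show "u \<cdot> \<iota> i = 0 \<cdot> \<iota> i"
      using ext_zeroD[OF eZ[OF i] comp_hom[OF biproductD(3)[OF b i] u]]
        zero_comp[OF biproductD(3)[OF b i]] by simp
  qed
  then show ?thesis unfolding ext_zero_def using Add_ob[OF B] Y by blast
qed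

lemma ext_zero_Add_right:
  assumes B: "B \<in> Add L" and X: "X \<in> Ob C" and e: "\<And>A. A \<in> L \<Longrightarrow> ext_zero X A"
  shows "ext_zero X B"
proof -
  obtain n :: nat and Z \<iota> \<pi> where b: "biproduct {..<n} Z B \<iota> \<pi>"
    and Z: "\<And>i. i \<in> {..<n} \<Longrightarrow> local_object (Z i)" by (rule decomposition[OF Add_ob[OF B]]) blast
  have eZ: "ext_zero X (Z i)" if i: "i \<in> {..<n}" for i
  proof -
    obtain A where A: "A \<in> L" "isomorphic C (Z i) A"
      using AddD[OF B Z[OF i] biproduct_retract[OF b i]] by blast
    have "A \<in> Ob C" using e[OF A(1)] unfolding ext_zero_def by blast
    then show ?thesis
      using ext_zero_retract_right[OF isomorphic_retract[OF A(2) local_object_ob[OF Z[OF i]]] e[OF A(1)]]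
      by blast
  qed
  note b' = biproduct_sh[OF b]
  have "u = 0" if u: "u \<in> hom X (sh B)" for u
  proof (rule biproduct_in_eqI[OF b' u zero_hom[OF X hom_trg[OF u]]])
    fix i assume i: "i \<in> {..<n}"
    show "shm (\<pi> i) \<cdot> u = shm (\<pi> i) \<cdot> 0"
      using ext_zeroD[OF eZ[OF i] comp_hom[OF u biproductD(4)[OF b' i]]]
        comp_zero[OF biproductD(4)[OF b' i]] by simp
  qed
  then show ?thesis unfolding ext_zero_def using Add_ob[OF B] X by blast
qed

section \<open>Exchange triangles\<close>

text \<open>
  The approximations refer to a set \<open>L\<close> of indecomposable objects rather than to their direct sum, so
  that sequences coming from different choices of this sum can be compared.
\<close>

definition exchange_tri ::
  "'o set \<Rightarrow> 'o \<Rightarrow> 'o \<Rightarrow> 'o \<Rightarrow> 'a \<Rightarrow> 'a \<Rightarrow> 'a \<Rightarrow> bool"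
where
  "exchange_tri L X B Y f g h \<longleftrightarrow>
     Tri C X B Y f g h \<and>
     left_approximation C (Add L) X B f \<and> left_minimal C B f \<and>
     right_approximation C (Add L) B Y g \<and> right_minimal C B g"

lemma left_approxE:
  assumes "left_approximation C (Add L) X B f" "A \<in> Add L" "u \<in> hom X A"
  obtains v where "v \<in> hom B A" "v \<cdot> f = u"
  using assms Add_ob unfolding left_approximation_def hom_def by blast

lemma right_approxE:
  assumes "right_approximation C (Add L) B Y g" "A \<in> Add L" "u \<in> hom A Y"
  obtains v where "v \<in> hom A B" "g \<cdot> v = u"
  using assms Add_ob unfolding right_approximation_def hom_def by blast

lemma exchange_triD:
  assumes "exchange_tri L X B Y f g h"
  shows "Tri C X B Y f g h" "left_approximation C (Add L) X B f" "left_minimal C B f"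
    "right_approximation C (Add L) B Y g" "right_minimal C B g" "B \<in> Add L"
  using assms unfolding exchange_tri_def left_approximation_def by blast+

lemma left_minimalD:
  "left_minimal C B f \<Longrightarrow> v \<in> hom B B \<Longrightarrow> v \<cdot> f = f \<Longrightarrow> iso_mor C B B v"
  unfolding left_minimal_def hom_def by blast

lemma right_minimalD:
  "right_minimal C B g \<Longrightarrow> v \<in> hom B B \<Longrightarrow> g \<cdot> v = g \<Longrightarrow> iso_mor C B B v"
  unfolding right_minimal_def hom_def by blast

text \<open>
  A map \<open>Y \<rightarrow> \<Sigma>A\<close> vanishes on \<open>B\<close>, hence comes from a map \<open>X \<rightarrow> A\<close>; this one extends to \<open>B\<close> because \<open>f\<close> is a
  left approximation, and such maps induce \<open>0\<close> on \<open>Y\<close>. The next lemma is the dual statement for \<open>X\<close>.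
\<close>

lemma ext_zero_third:
  assumes T: "exchange_tri L X B Y f g h" and e: "\<And>A A'. A \<in> L \<Longrightarrow> A' \<in> L \<Longrightarrow> ext_zero A A'"
    and A: "A \<in> L" and loc: "local_object A"
  shows "ext_zero Y A"
proof -
  note t = triD[OF exchange_triD(1)[OF T]]
  have AO: "A \<in> Ob C" using local_object_ob[OF loc] .
  have eB: "ext_zero B A" using ext_zero_Add_left[OF exchange_triD(6)[OF T] AO] e[OF _ A] by blast
  have "u = 0" if u: "u \<in> hom Y (sh A)" for u
  proof -
    obtain w where w: "w \<in> hom (sh X) (sh A)" "w \<cdot> h = u"
      using tri_extend_second[OF exchange_triD(1)[OF T] u] ext_zeroD[OF eB comp_hom[OF t(2) u]] by blast
    obtain w' where w': "w' \<in> hom X A" "w = shm w'" by (rule shm_surj[OF w(1) t(4) AO])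
    obtain v where v: "v \<in> hom B A" "v \<cdot> f = w'"
      using left_approxE[OF exchange_triD(2)[OF T] Add_generator[OF A loc] w'(1)] .
    have "u = shm v \<cdot> (shm f \<cdot> h)"
      using w(2) w'(2) v(2) shm_comp[OF t(1) v(1)] comp_assoc[OF t(3) shm_hom[OF t(1)] shm_hom[OF v(1)]]
      by simp
    then show ?thesis using tri_shf_h[OF exchange_triD(1)[OF T]] comp_zero[OF shm_hom[OF v(1)]] by simp
  qed
  then show ?thesis unfolding ext_zero_def using t AO by blast
qed

lemma ext_zero_first:
  assumes T: "exchange_tri L X B Y f g h" and e: "\<And>A A'. A \<in> L \<Longrightarrow> A' \<in> L \<Longrightarrow> ext_zero A A'"
    and A: "A \<in> L" and loc: "local_object A"
  shows "ext_zero A X"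
proof -
  note t = triD[OF exchange_triD(1)[OF T]]
  have AO: "A \<in> Ob C" using local_object_ob[OF loc] .
  have eB: "ext_zero A B" using ext_zero_Add_right[OF exchange_triD(6)[OF T] AO] e[OF A] by blast
  have "u = 0" if u: "u \<in> hom A (sh X)" for u
  proof -
    have "(- shm f) \<cdot> u = 0"
      using minus_comp[OF u shm_hom[OF t(1)]] ext_zeroD[OF eB comp_hom[OF u shm_hom[OF t(1)]]] by simp
    then obtain w where w: "w \<in> hom A Y" "h \<cdot> w = u"
      using tri_lift_second[OF rot[OF exchange_triD(1)[OF T]] u] by blast
    obtain v where v: "v \<in> hom A B" "g \<cdot> v = w"
      using right_approxE[OF exchange_triD(4)[OF T] Add_generator[OF A loc] w(1)] .
    show ?thesis
      using w(2) v(2) comp_eqL[OF v(1) t(2,3) tri_hg[OF exchange_triD(1)[OF T]]] zero_comp[OF v(1)]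
      by simp
  qed
  then show ?thesis unfolding ext_zero_def using t AO by blast
qed

text \<open>
  The inverse of an outer component extends, by the approximation property, to a map \<open>B' \<rightarrow> B\<close>, and
  minimality makes both composites with \<open>b\<close> invertible.
\<close>

lemma middle_iso_of_first:
  assumes T: "exchange_tri L X B Y f g h" and T': "exchange_tri L X' B' Y' f' g' h'"
    and a: "iso_mor C X X' a" and b: "b \<in> hom B B'" and eq: "f' \<cdot> a = b \<cdot> f"
  shows "iso_mor C B B' b"
proof -
  note t = triD[OF exchange_triD(1)[OF T]] and t' = triD[OF exchange_triD(1)[OF T']]
  obtain a' where a': "a \<in> hom X X'" "a' \<in> hom X' X" "a' \<cdot> a = one X" "a \<cdot> a' = one X'"
    by (rule isoE[OF a t(4) t'(4)])
  obtain k where k: "k \<in> hom B' B" "k \<cdot> f' = f \<cdot> a'"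
    using left_approxE[OF exchange_triD(2)[OF T'] exchange_triD(6)[OF T] comp_hom[OF a'(2) t(1)]] .
  have "(k \<cdot> b) \<cdot> f = f"
    using comp_assoc[OF t(1) b k(1)] eq[symmetric] comp_assoc[OF a'(1) t'(1) k(1)] k(2)
      comp_assoc[OF a'(1,2) t(1)] a'(3) comp_one[OF t(1)] by simp
  then have kb: "iso_mor C B B (k \<cdot> b)"
    using left_minimalD[OF exchange_triD(3)[OF T] comp_hom[OF b k(1)]] by simp
  have "(b \<cdot> k) \<cdot> f' = f'"
    using comp_assoc[OF t'(1) k(1) b] k(2) comp_assoc[OF a'(2) t(1) b] eq[symmetric]
      comp_assoc[OF a'(2,1) t'(1)] a'(4) comp_one[OF t'(1)] by simp
  then have bk: "iso_mor C B' B' (b \<cdot> k)"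
    using left_minimalD[OF exchange_triD(3)[OF T'] comp_hom[OF k(1) b]] by simp
  show ?thesis using iso_two_sided[OF b k(1) k(1) kb bk] .
qed

lemma middle_iso_of_third:
  assumes T: "exchange_tri L X B Y f g h" and T': "exchange_tri L X' B' Y' f' g' h'"
    and c: "iso_mor C Y Y' c" and b: "b \<in> hom B B'" and eq: "g' \<cdot> b = c \<cdot> g"
  shows "iso_mor C B B' b"
proof -
  note t = triD[OF exchange_triD(1)[OF T]] and t' = triD[OF exchange_triD(1)[OF T']]
  obtain c' where c': "c \<in> hom Y Y'" "c' \<in> hom Y' Y" "c' \<cdot> c = one Y" "c \<cdot> c' = one Y'"
    by (rule isoE[OF c t(6) t'(6)])
  obtain k where k: "k \<in> hom B' B" "g \<cdot> k = c' \<cdot> g'"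
    using right_approxE[OF exchange_triD(4)[OF T] exchange_triD(6)[OF T'] comp_hom[OF t'(2) c'(2)]] .
  have "g \<cdot> (k \<cdot> b) = g"
    using comp_assoc[OF b k(1) t(2)] k(2) comp_assoc[OF b t'(2) c'(2)] eq
      comp_assoc[OF t(2) c'(1,2)] c'(3) one_comp[OF t(2)] by simp
  then have kb: "iso_mor C B B (k \<cdot> b)"
    using right_minimalD[OF exchange_triD(5)[OF T] comp_hom[OF b k(1)]] by simp
  have "g' \<cdot> (b \<cdot> k) = g'"
    using comp_assoc[OF k(1) b t'(2)] eq comp_assoc[OF k(1) t(2) c'(1)] k(2)
      comp_assoc[OF t'(2) c'(2,1)] c'(4) one_comp[OF t'(2)] by simp
  then have bk: "iso_mor C B' B' (b \<cdot> k)"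
    using right_minimalD[OF exchange_triD(5)[OF T'] comp_hom[OF k(1) b]] by simp
  show ?thesis using iso_two_sided[OF b k(1) k(1) kb bk] .
qed

lemma exchange_tri_unique_up:
  assumes T: "exchange_tri L X B Y f g h" and T': "exchange_tri L X' B' Y' f' g' h'"
    and i: "isomorphic C X X'"
  shows "isomorphic C B B' \<and> isomorphic C Y Y'"
proof -
  note t = triD[OF exchange_triD(1)[OF T]] and t' = triD[OF exchange_triD(1)[OF T']]
  obtain a where a: "iso_mor C X X' a" using i unfolding isomorphic_def by blast
  have ah: "a \<in> hom X X'" using isoE[OF a t(4) t'(4)] .
  obtain b where b: "b \<in> hom B B'" "b \<cdot> f = f' \<cdot> a"
    using left_approxE[OF exchange_triD(2)[OF T] exchange_triD(6)[OF T'] comp_hom[OF ah t'(1)]] .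
  have ib: "iso_mor C B B' b" using middle_iso_of_first[OF T T' a b(1)] b(2) by simp
  obtain c where c: "c \<in> hom Y Y'" "g' \<cdot> b = c \<cdot> g" "h' \<cdot> c = shm a \<cdot> h"
    using fill_third[OF exchange_triD(1)[OF T] exchange_triD(1)[OF T'] ah b(1)] b(2) by metis
  have "iso_mor C Y Y' c"
    using five_third[OF exchange_triD(1)[OF T] exchange_triD(1)[OF T'] a ib c(1)] b(2) c by simp
  then show ?thesis unfolding isomorphic_def using ib by blast
qed

lemma exchange_tri_unique_down:
  assumes T: "exchange_tri L X B Y f g h" and T': "exchange_tri L X' B' Y' f' g' h'"
    and i: "isomorphic C Y Y'"
  shows "isomorphic C B B' \<and> isomorphic C X X'"
proof -
  note t = triD[OF exchange_triD(1)[OF T]] and t' = triD[OF exchange_triD(1)[OF T']]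
  obtain c where c: "iso_mor C Y Y' c" using i unfolding isomorphic_def by blast
  have ch: "c \<in> hom Y Y'" using isoE[OF c t(6) t'(6)] .
  obtain b where b: "b \<in> hom B B'" "g' \<cdot> b = c \<cdot> g"
    using right_approxE[OF exchange_triD(4)[OF T'] exchange_triD(6)[OF T] comp_hom[OF t(2) ch]] .
  have ib: "iso_mor C B B' b" using middle_iso_of_third[OF T T' c b] .
  obtain a where a: "a \<in> hom X X'" "f' \<cdot> a = b \<cdot> f" "shm a \<cdot> h = h' \<cdot> c"
    using fill_first[OF exchange_triD(1)[OF T] exchange_triD(1)[OF T'] b(1) ch b(2)] .
  have "iso_mor C X X' a"
    using five_first[OF exchange_triD(1)[OF T] exchange_triD(1)[OF T'] a(1) ib c a(2) b(2)] a(3) by simp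
  then show ?thesis unfolding isomorphic_def using ib by blast
qed

text \<open>
  An endomorphism of either end of an exchange triangle extends to the whole triangle, and one end
  is invertible if and only if the other is; hence both ends have local endomorphism rings together.
\<close>

lemma local_object_third:
  assumes T: "exchange_tri L X B Y f g h" and X: "local_object X" and nz: "one Y \<noteq> 0"
  shows "local_object Y"
proof -
  note T' = exchange_triD(1)[OF T]
  note t = triD[OF T']
  have ex: "\<exists>b a. b \<in> hom B B \<and> a \<in> hom X X \<and> g \<cdot> b = c \<cdot> g \<and> f \<cdot> a = b \<cdot> f \<and> shm a \<cdot> h = h \<cdot> c"
    if c: "c \<in> hom Y Y" for c
  proof -
    obtain b where b: "b \<in> hom B B" "g \<cdot> b = c \<cdot> g"
      using right_approxE[OF exchange_triD(4)[OF T] exchange_triD(6)[OF T] comp_hom[OF t(2) c]] .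
    show ?thesis using fill_first[OF T' T' b(1) c b(2)] b by metis
  qed
  have up: "iso_mor C Y Y c"
    if "iso_mor C X X a" "b \<in> hom B B" "c \<in> hom Y Y" "f \<cdot> a = b \<cdot> f" "g \<cdot> b = c \<cdot> g"
      "shm a \<cdot> h = h \<cdot> c" for a b c
    using five_third[OF T' T' that(1) middle_iso_of_first[OF T T that(1,2,4)] that(3,4,5)] that(6) by simp
  have "iso_mor C Y Y c \<or> iso_mor C Y Y c'"
    if c: "c \<in> hom Y Y" and c': "c' \<in> hom Y Y" and i: "iso_mor C Y Y (c + c')" for c c'
  proof -
    obtain b a where b: "b \<in> hom B B" "a \<in> hom X X" "g \<cdot> b = c \<cdot> g" "f \<cdot> a = b \<cdot> f"
      "shm a \<cdot> h = h \<cdot> c" using ex[OF c] by blast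
    obtain b' a' where b': "b' \<in> hom B B" "a' \<in> hom X X" "g \<cdot> b' = c' \<cdot> g" "f \<cdot> a' = b' \<cdot> f"
      "shm a' \<cdot> h = h \<cdot> c'" using ex[OF c'] by blast
    have 1: "g \<cdot> (b + b') = (c + c') \<cdot> g"
      using comp_add[OF b(1) b'(1) t(2)] add_comp[OF t(2) c c'] b(3) b'(3) by simp
    have 2: "f \<cdot> (a + a') = (b + b') \<cdot> f"
      using comp_add[OF b(2) b'(2) t(1)] add_comp[OF t(1) b(1) b'(1)] b(4) b'(4) by simp
    have 3: "shm (a + a') \<cdot> h = h \<cdot> (c + c')"
      using shm_add[OF b(2) b'(2)] add_comp[OF t(3) shm_hom[OF b(2)] shm_hom[OF b'(2)]]
        comp_add[OF c c' t(3)] b(5) b'(5) by simp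
    have "iso_mor C X X (a + a')"
      using five_first[OF T' T' add_hom[OF b(2) b'(2)]
          middle_iso_of_third[OF T T i add_hom[OF b(1) b'(1)] 1] i 2 1] 3 by simp
    then have "iso_mor C X X a \<or> iso_mor C X X a'" using local_object_add[OF X b(2) b'(2)] by blast
    then show ?thesis using up[OF _ b(1) c b(4,3,5)] up[OF _ b'(1) c' b'(4,3,5)] by blast
  qed
  then show ?thesis
    unfolding local_object_def local_End_def using t(6) nz homI by metis
qed

lemma local_object_first:
  assumes T: "exchange_tri L X B Y f g h" and Y: "local_object Y" and nz: "one X \<noteq> 0"
  shows "local_object X"
proof -
  note T' = exchange_triD(1)[OF T]
  note t = triD[OF T']
  have ex: "\<exists>b c. b \<in> hom B B \<and> c \<in> hom Y Y \<and> f \<cdot> a = b \<cdot> f \<and> g \<cdot> b = c \<cdot> g \<and> h \<cdot> c = shm a \<cdot> h"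
    if a: "a \<in> hom X X" for a
  proof -
    obtain b where b: "b \<in> hom B B" "b \<cdot> f = f \<cdot> a"
      using left_approxE[OF exchange_triD(2)[OF T] exchange_triD(6)[OF T] comp_hom[OF a t(1)]] .
    show ?thesis using fill_third[OF T' T' a b(1)] b by metis
  qed
  have down: "iso_mor C X X a"
    if "iso_mor C Y Y c" "b \<in> hom B B" "a \<in> hom X X" "f \<cdot> a = b \<cdot> f" "g \<cdot> b = c \<cdot> g"
      "h \<cdot> c = shm a \<cdot> h" for a b c
    using five_first[OF T' T' that(3) middle_iso_of_third[OF T T that(1,2,5)] that(1,4,5,6)] .
  have "iso_mor C X X a \<or> iso_mor C X X a'"
    if a: "a \<in> hom X X" and a': "a' \<in> hom X X" and i: "iso_mor C X X (a + a')" for a a'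
  proof -
    obtain b c where b: "b \<in> hom B B" "c \<in> hom Y Y" "f \<cdot> a = b \<cdot> f" "g \<cdot> b = c \<cdot> g"
      "h \<cdot> c = shm a \<cdot> h" using ex[OF a] by blast
    obtain b' c' where b': "b' \<in> hom B B" "c' \<in> hom Y Y" "f \<cdot> a' = b' \<cdot> f" "g \<cdot> b' = c' \<cdot> g"
      "h \<cdot> c' = shm a' \<cdot> h" using ex[OF a'] by blast
    have 1: "g \<cdot> (b + b') = (c + c') \<cdot> g"
      using comp_add[OF b(1) b'(1) t(2)] add_comp[OF t(2) b(2) b'(2)] b(4) b'(4) by simp
    have 2: "f \<cdot> (a + a') = (b + b') \<cdot> f"
      using comp_add[OF a a' t(1)] add_comp[OF t(1) b(1) b'(1)] b(3) b'(3) by simp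
    have 3: "h \<cdot> (c + c') = shm (a + a') \<cdot> h"
      using shm_add[OF a a'] add_comp[OF t(3) shm_hom[OF a] shm_hom[OF a']]
        comp_add[OF b(2) b'(2) t(3)] b(5) b'(5) by simp
    have "iso_mor C Y Y (c + c')"
      using five_third[OF T' T' i middle_iso_of_first[OF T T i add_hom[OF b(1) b'(1)] 2]
          add_hom[OF b(2) b'(2)] 2 1 3] .
    then have "iso_mor C Y Y c \<or> iso_mor C Y Y c'" using local_object_add[OF Y b(2) b'(2)] by blast
    then show ?thesis using down[OF _ b(1) a b(3,4,5)] down[OF _ b'(1) a' b'(3,4,5)] by blast
  qed
  then show ?thesis
    unfolding local_object_def local_End_def using t(4) nz homI by metis
qed

section \<open>Sequences of exchange triangles\<close>

definition exchange_sequence ::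
  "'o set \<Rightarrow> (int \<Rightarrow> 'o) \<Rightarrow> (int \<Rightarrow> 'o) \<Rightarrow> (int \<Rightarrow> 'a) \<Rightarrow> (int \<Rightarrow> 'a) \<Rightarrow> (int \<Rightarrow> 'a) \<Rightarrow> bool"
where
  "exchange_sequence L Xs B f g h \<longleftrightarrow>
     (\<forall>c. exchange_tri L (Xs c) (B c) (Xs (c + 1)) (f c) (g c) (h c))"

lemma exchange_sequenceD:
  "exchange_sequence L Xs B f g h \<Longrightarrow> exchange_tri L (Xs c) (B c) (Xs (c + 1)) (f c) (g c) (h c)"
  unfolding exchange_sequence_def by blast

lemma exchange_sequence_pred:
  "exchange_sequence L Xs B f g h \<Longrightarrow>
    exchange_tri L (Xs (c - 1)) (B (c - 1)) (Xs c) (f (c - 1)) (g (c - 1)) (h (c - 1))"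
  using exchange_sequenceD[of L Xs B f g h "c - 1"] by simp

text \<open>
  A summand of \<open>Xs c\<close> in the additive closure would lift through the right approximation ending
  at \<open>Xs c\<close> and split off from the minimal left approximation preceding it.
\<close>

lemma exchange_sequence_no_retract:
  assumes S: "exchange_sequence L Xs B f g h" and A: "A \<in> Add L" and nz: "one A \<noteq> 0"
  shows "\<not> retract A (Xs c)"
proof
  assume "retract A (Xs c)"
  then obtain s r where s: "s \<in> hom A (Xs c)" "r \<in> hom (Xs c) A" "r \<cdot> s = one A"
    unfolding retract_def by blast
  note T = exchange_sequence_pred[OF S, of c]
  note t = triD[OF exchange_triD(1)[OF T]]
  obtain v where v: "v \<in> hom A (B (c - 1))" "g (c - 1) \<cdot> v = s"
    using right_approxE[OF exchange_triD(4)[OF T] A s(1)] .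
  note rg = comp_hom[OF t(2) s(2)]
  have "(r \<cdot> g (c - 1)) \<cdot> v = one A" using comp_eqR[OF v(1) t(2) s(2) v(2)] s(3) by simp
  moreover have "(r \<cdot> g (c - 1)) \<cdot> f (c - 1) = 0"
    using comp_eqR[OF t(1,2) s(2) tri_gf[OF exchange_triD(1)[OF T]]] comp_zero[OF s(2)] by simp
  ultimately show False
    using left_minimal_split_epi[OF exchange_triD(3)[OF T] t(1) rg v(1)] iso_one[OF Add_ob[OF A]] nz
    by simp
qed

text \<open>
  The next two lemmas exclude zero objects in an exchange sequence: next to a zero object, the
  neighbour would be a summand of the middle term.
\<close>

lemma zero_third_retract:
  assumes T: "Tri C X B Y f g h" and 0: "one Y = 0"
  shows "retract X B"
proof -
  note t = triD[OF T]
  have z: "zero_object C Y" using 0 t(6) unfolding zero_object_def by simp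
  have "h = 0" using zero_object_out[OF t(3) z] .
  then obtain r where "r \<in> hom B X" "r \<cdot> f = one X"
    using tri_extend_first[OF T one_hom[OF t(4)]] comp_zero[OF shm_hom[OF one_hom[OF t(4)]]] by metis
  then show ?thesis unfolding retract_def using t(1) by blast
qed

lemma zero_first_retract:
  assumes T: "Tri C X B Y f g h" and 0: "one X = 0"
  shows "retract Y B"
proof -
  note t = triD[OF T]
  have z: "zero_object C X" using 0 t(4) unfolding zero_object_def by simp
  have "h = 0" using zero_object_in[OF t(3) zero_object_sh[OF z]] .
  then obtain s where "s \<in> hom Y B" "g \<cdot> s = one Y"
    using tri_lift_second[OF T one_hom[OF t(6)]] zero_comp[OF one_hom[OF t(6)]] by metis
  then show ?thesis unfolding retract_def using t(2) by blast
qed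

lemma exchange_sequence_local:
  assumes S: "exchange_sequence L Xs B f g h" and X: "local_object (Xs 0)"
  shows "local_object (Xs c)"
proof (induction c rule: int_induct[where k = 0])
  case base
  show ?case using X .
next
  case (step1 i)
  note T = exchange_sequenceD[OF S, of i]
  have "one (Xs (i + 1)) \<noteq> 0"
    using zero_third_retract[OF exchange_triD(1)[OF T]] Add_retract[OF exchange_triD(6)[OF T]]
      exchange_sequence_no_retract[OF S _ local_object_nonzero[OF step1(2)]]
      retract_refl[OF local_object_ob[OF step1(2)]] by blast
  then show ?case using local_object_third[OF T step1(2)] by blast
next
  case (step2 i)
  note T = exchange_sequence_pred[OF S, of i]
  have "one (Xs (i - 1)) \<noteq> 0"
    using zero_first_retract[OF exchange_triD(1)[OF T]] Add_retract[OF exchange_triD(6)[OF T]]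
      exchange_sequence_no_retract[OF S _ local_object_nonzero[OF step2(2)]]
      retract_refl[OF local_object_ob[OF step2(2)]] by blast
  then show ?case using local_object_first[OF T step2(2)] by blast
qed

lemma exchange_sequence_unique_first:
  assumes S: "exchange_sequence L Xs B f g h" and S': "exchange_sequence L Xs' B' f' g' h'"
    and i: "isomorphic C (Xs a) (Xs' b)"
  shows "isomorphic C (Xs (a + n)) (Xs' (b + n))"
proof (induction n rule: int_induct[where k = 0])
  case base
  show ?case using i by simp
next
  case (step1 n)
  show ?case
    using exchange_tri_unique_up[OF exchange_sequenceD[OF S, of "a + n"]
        exchange_sequenceD[OF S', of "b + n"] step1(2)] by (simp add: add.assoc)
next
  case (step2 n)
  show ?case
    using exchange_tri_unique_down[OF exchange_sequence_pred[OF S, of "a + n"]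
        exchange_sequence_pred[OF S', of "b + n"] step2(2)] by (simp add: algebra_simps)
qed

lemma exchange_sequence_unique:
  assumes S: "exchange_sequence L Xs B f g h" and S': "exchange_sequence L Xs' B' f' g' h'"
    and i: "isomorphic C (Xs a) (Xs' b)"
  shows "isomorphic C (Xs (a + n)) (Xs' (b + n)) \<and> isomorphic C (B (a + n)) (B' (b + n))"
  using exchange_sequence_unique_first[OF S S' i, of n]
    exchange_tri_unique_up[OF exchange_sequenceD[OF S, of "a + n"]
        exchange_sequenceD[OF S', of "b + n"]] by blast

section \<open>Comparison modulo an additive closure\<close>

text \<open>
  Approximations that are not minimal produce the terms of an exchange sequence only up to summands
  in the additive closure. The relation below allows for such summands; it propagates along
  sequences in both directions.
\<close>

definition summand_modulo :: "'o set \<Rightarrow> 'o \<Rightarrow> 'o \<Rightarrow> bool" where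
  "summand_modulo L Y Z \<longleftrightarrow>
     (\<exists>s \<in> hom Y Z. \<exists>r \<in> hom Z Y. \<exists>A \<in> Add L. \<exists>t \<in> hom Z A. \<exists>q \<in> hom A Z.
        r \<cdot> s = one Y \<and> s \<cdot> r + q \<cdot> t = one Z)"

lemma summand_moduloE:
  assumes "summand_modulo L Y Z"
  obtains s r A t q where "s \<in> hom Y Z" "r \<in> hom Z Y" "A \<in> Add L" "t \<in> hom Z A" "q \<in> hom A Z"
    "r \<cdot> s = one Y" "s \<cdot> r + q \<cdot> t = one Z"
  using assms unfolding summand_modulo_def by blast

lemma summand_moduloI:
  "s \<in> hom Y Z \<Longrightarrow> r \<in> hom Z Y \<Longrightarrow> A \<in> Add L \<Longrightarrow> t \<in> hom Z A \<Longrightarrow> q \<in> hom A Z \<Longrightarrow>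
    r \<cdot> s = one Y \<Longrightarrow> s \<cdot> r + q \<cdot> t = one Z \<Longrightarrow> summand_modulo L Y Z"
  unfolding summand_modulo_def by blast

lemma summand_modulo_retract: "summand_modulo L Y Z \<Longrightarrow> retract Y Z"
  unfolding summand_modulo_def retract_def by blast

lemma isomorphic_summand_modulo:
  assumes i: "isomorphic C Y Z" and Y: "Y \<in> Ob C" and Z: "Z \<in> Ob C"
  shows "summand_modulo L Y Z"
proof -
  obtain s r where s: "s \<in> hom Y Z" "r \<in> hom Z Y" "r \<cdot> s = one Y" "s \<cdot> r = one Z"
    by (rule isomorphicE[OF i Y Z])
  obtain A where A: "zero_object C A" using ex_zero_object by blast
  have AO: "A \<in> Ob C" using A unfolding zero_object_def by simp
  show ?thesis
    using summand_moduloI[OF s(1,2) Add_zero[OF A] zero_hom[OF Z AO] zero_hom[OF AO Z] s(3)] s(4)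
      comp_zero[OF zero_hom[OF AO Z]] by simp
qed

lemma summand_modulo_middle:
  assumes T: "exchange_tri L Y B Y' f g h" and S: "Tri C Z M Z' m p d"
    and ap: "left_approximation C (Add L) Z M m"
    and s: "s \<in> hom Y Z" and r: "r \<in> hom Z Y" and rs: "r \<cdot> s = one Y"
  obtains sB rB where "sB \<in> hom B M" "rB \<in> hom M B" "sB \<cdot> f = m \<cdot> s" "rB \<cdot> m = f \<cdot> r"
    "(rB \<cdot> sB) \<cdot> f = f" "iso_mor C B B (rB \<cdot> sB)"
proof -
  note t = triD[OF exchange_triD(1)[OF T]] and u = triD[OF S]
  have M: "M \<in> Add L" using ap unfolding left_approximation_def by simp
  obtain sB where sB: "sB \<in> hom B M" "sB \<cdot> f = m \<cdot> s"
    using left_approxE[OF exchange_triD(2)[OF T] M comp_hom[OF s u(1)]] .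
  obtain rB where rB: "rB \<in> hom M B" "rB \<cdot> m = f \<cdot> r"
    using left_approxE[OF ap exchange_triD(6)[OF T] comp_hom[OF r t(1)]] .
  have "(rB \<cdot> sB) \<cdot> f = f"
    using comp_eqR[OF t(1) sB(1) rB(1) sB(2)] comp_eqL[OF s u(1) rB] comp_eqR[OF s r t(1) rs]
      comp_one[OF t(1)] by simp
  then show ?thesis
    using that[OF sB(1) rB(1) sB(2) rB(2)] left_minimalD[OF exchange_triD(3)[OF T] comp_hom[OF sB(1) rB(1)]]
    by simp
qed

text \<open>
  The maps between \<open>Y\<close> and \<open>Z\<close> extend to morphisms of triangles. The composite on \<open>Y'\<close> is invertible by
  minimality of \<open>f\<close>, and the complementary endomorphism of \<open>Z'\<close> is killed by \<open>d\<close>, since \<open>m\<close> is an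
  approximation; so it factors through \<open>M\<close>.
\<close>

lemma summand_modulo_up:
  assumes T: "exchange_tri L Y B Y' f g h" and S: "Tri C Z M Z' m p d"
    and ap: "left_approximation C (Add L) Z M m" and R: "summand_modulo L Y Z"
  shows "summand_modulo L Y' Z'"
proof -
  note t = triD[OF exchange_triD(1)[OF T]] and u = triD[OF S]
  have M: "M \<in> Add L" using ap unfolding left_approximation_def by simp
  obtain s r A a q where s: "s \<in> hom Y Z" and r: "r \<in> hom Z Y" and A: "A \<in> Add L"
    and a: "a \<in> hom Z A" and q: "q \<in> hom A Z" and rs: "r \<cdot> s = one Y"
    and sum: "s \<cdot> r + q \<cdot> a = one Z" by (rule summand_moduloE[OF R])
  obtain sB rB where sB: "sB \<in> hom B M" and rB: "rB \<in> hom M B" and e1: "sB \<cdot> f = m \<cdot> s"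
    and e2: "rB \<cdot> m = f \<cdot> r" and e3: "(rB \<cdot> sB) \<cdot> f = f" and i: "iso_mor C B B (rB \<cdot> sB)"
    by (rule summand_modulo_middle[OF T S ap s r rs])
  (* The composite of the induced maps on the third terms is an automorphism of Y', not the identity;
     its inverse k corrects the retraction. *)
  obtain s' where s': "s' \<in> hom Y' Z'" "p \<cdot> sB = s' \<cdot> g" "d \<cdot> s' = shm s \<cdot> h"
    using fill_third[OF exchange_triD(1)[OF T] S s sB] e1 by metis
  obtain r' where r': "r' \<in> hom Z' Y'" "g \<cdot> rB = r' \<cdot> p" "h \<cdot> r' = shm r \<cdot> d"
    using fill_third[OF S exchange_triD(1)[OF T] r rB] e2 by metis
  note rs' = comp_hom[OF s'(1) r'(1)]
  have "g \<cdot> (rB \<cdot> sB) = (r' \<cdot> s') \<cdot> g"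
    using comp_eqL[OF sB rB t(2) r'(2)] comp_eqR[OF sB u(2) r'(1) s'(2)]
      comp_assoc[OF t(2) s'(1) r'(1)] by simp
  moreover have hth: "h \<cdot> (r' \<cdot> s') = h"
    using comp_eqL[OF s'(1) r'(1) t(3) r'(3)] comp_eqR[OF s'(1) u(3) shm_hom[OF r] s'(3)]
      comp_assoc[OF t(3) shm_hom[OF s] shm_hom[OF r]] shm_comp[OF s r] rs ShM_Ident[OF t(4)]
      one_comp[OF t(3)] by simp
  ultimately have "iso_mor C Y' Y' (r' \<cdot> s')"
    using five_third[OF exchange_triD(1)[OF T] exchange_triD(1)[OF T] iso_one[OF t(4)] i rs']
      comp_one[OF t(1)] e3 ShM_Ident[OF t(4)] one_comp[OF t(3)] by simp
  then obtain k where k: "k \<in> hom Y' Y'" "k \<cdot> (r' \<cdot> s') = one Y'" "(r' \<cdot> s') \<cdot> k = one Y'"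
    by (rule isoE[OF _ t(6) t(6)])
  define r'' where "r'' = k \<cdot> r'"
  have r'': "r'' \<in> hom Z' Y'" unfolding r''_def using comp_hom[OF r'(1) k(1)] .
  have 1: "r'' \<cdot> s' = one Y'" unfolding r''_def using comp_assoc[OF s'(1) r'(1) k(1)] k(2) by simp
  have hk: "h \<cdot> k = h" using comp_eqL[OF k(1) rs' t(3) hth] k(3) comp_one[OF t(3)] by simp
  have "d \<cdot> (s' \<cdot> r'') = shm s \<cdot> (h \<cdot> r'')"
    using comp_eqL[OF r'' s'(1) u(3) s'(3)] comp_assoc[OF r'' t(3) shm_hom[OF s]] by simp
  also have "h \<cdot> r'' = shm r \<cdot> d"
    unfolding r''_def using comp_eqL[OF r'(1) k(1) t(3) hk] r'(3) by simp
  also have "shm s \<cdot> (shm r \<cdot> d) = shm (s \<cdot> r) \<cdot> d"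
    using comp_assoc[OF u(3) shm_hom[OF r] shm_hom[OF s]] shm_comp[OF r s] by simp
  also have "s \<cdot> r = one Z - q \<cdot> a" using sum by (simp add: algebra_simps)
  also have "shm (one Z - q \<cdot> a) \<cdot> d = d - shm (q \<cdot> a) \<cdot> d"
    using shm_diff[OF one_hom[OF u(4)] comp_hom[OF a q]] ShM_Ident[OF u(4)]
      diff_comp[OF u(3) one_hom[OF ShO_Ob[OF u(4)]] shm_hom[OF comp_hom[OF a q]]] one_comp[OF u(3)]
    by simp
  also have "shm (q \<cdot> a) \<cdot> d = 0"
  proof -
    obtain v where v: "v \<in> hom M A" "v \<cdot> m = a" using left_approxE[OF ap A a] .
    have "shm a \<cdot> d = 0"
      using v(2) shm_comp[OF u(1) v(1)] comp_eqR[OF u(3) shm_hom[OF u(1)] shm_hom[OF v(1)] tri_shf_h[OF S]]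
        comp_zero[OF shm_hom[OF v(1)]] by simp
    then show ?thesis
      using shm_comp[OF a q] comp_eqR[OF u(3) shm_hom[OF a] shm_hom[OF q]] comp_zero[OF shm_hom[OF q]]
      by simp
  qed
  finally have "d \<cdot> (one Z' - s' \<cdot> r'') = 0"
    using comp_diff[OF one_hom[OF u(6)] comp_hom[OF r'' s'(1)] u(3)] comp_one[OF u(3)] by simp
  then obtain w where w: "w \<in> hom Z' M" "p \<cdot> w = one Z' - s' \<cdot> r''"
    using tri_lift_second[OF S diff_hom[OF one_hom[OF u(6)] comp_hom[OF r'' s'(1)]]] by blast
  show ?thesis using summand_moduloI[OF s'(1) r'' M w(1) u(2) 1] w(2) by simp
qed

lemma summand_modulo_down:
  assumes T: "exchange_tri L Y B Y' f g h" and S: "Tri C Z M Z' m p d"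
    and ap: "right_approximation C (Add L) M Z' p" and R: "summand_modulo L Y' Z'"
  shows "summand_modulo L Y Z"
proof -
  note t = triD[OF exchange_triD(1)[OF T]] and u = triD[OF S]
  have M: "M \<in> Add L" using ap unfolding right_approximation_def by simp
  obtain s' r' A a q where s': "s' \<in> hom Y' Z'" and r': "r' \<in> hom Z' Y'" and A: "A \<in> Add L"
    and a: "a \<in> hom Z' A" and q: "q \<in> hom A Z'" and rs': "r' \<cdot> s' = one Y'"
    and sum: "s' \<cdot> r' + q \<cdot> a = one Z'" by (rule summand_moduloE[OF R])
  obtain sB where sB: "sB \<in> hom B M" "p \<cdot> sB = s' \<cdot> g"
    using right_approxE[OF ap exchange_triD(6)[OF T] comp_hom[OF t(2) s']] .
  obtain rB where rB: "rB \<in> hom M B" "g \<cdot> rB = r' \<cdot> p"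
    using right_approxE[OF exchange_triD(4)[OF T] M comp_hom[OF u(2) r']] .
  note rsB = comp_hom[OF sB(1) rB(1)]
  have gB: "g \<cdot> (rB \<cdot> sB) = g"
    using comp_eqL[OF sB(1) rB(1) t(2) rB(2)] comp_eqR[OF sB(1) u(2) r' sB(2)]
      comp_eqL[OF t(2) s' r' rs'] one_comp[OF t(2)] by simp
  have i: "iso_mor C B B (rB \<cdot> sB)" using right_minimalD[OF exchange_triD(5)[OF T] rsB gB] .
  obtain s where s: "s \<in> hom Y Z" "m \<cdot> s = sB \<cdot> f" "shm s \<cdot> h = d \<cdot> s'"
    using fill_first[OF exchange_triD(1)[OF T] S sB(1) s' sB(2)] .
  obtain r where r: "r \<in> hom Z Y" "f \<cdot> r = rB \<cdot> m" "shm r \<cdot> d = h \<cdot> r'"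
    using fill_first[OF S exchange_triD(1)[OF T] rB(1) r' rB(2)] .
  note rs = comp_hom[OF s(1) r(1)]
  have 1: "f \<cdot> (r \<cdot> s) = (rB \<cdot> sB) \<cdot> f"
    using comp_eqL[OF s(1) r(1) t(1) r(2)] comp_eqR[OF s(1) u(1) rB(1) s(2)]
      comp_assoc[OF t(1) sB(1) rB(1)] by simp
  have 2: "shm (r \<cdot> s) \<cdot> h = h"
    using shm_comp[OF s(1) r(1)] comp_eqR[OF t(3) shm_hom[OF s(1)] shm_hom[OF r(1)] s(3)]
      comp_eqL[OF s' u(3) shm_hom[OF r(1)] r(3)] comp_eqR[OF s' r' t(3) rs'] comp_one[OF t(3)]
    by simp
  have "iso_mor C Y Y (r \<cdot> s)"
    using five_first[OF exchange_triD(1)[OF T] exchange_triD(1)[OF T] rs i iso_one[OF t(6)] 1]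
      gB one_comp[OF t(2)] comp_one[OF t(3)] 2 by simp
  then obtain k where k: "k \<in> hom Y Y" "k \<cdot> (r \<cdot> s) = one Y" by (rule isoE[OF _ t(4) t(4)])
  define r'' where "r'' = k \<cdot> r"
  have r'': "r'' \<in> hom Z Y" unfolding r''_def using comp_hom[OF r(1) k(1)] .
  have 3: "r'' \<cdot> s = one Y" unfolding r''_def using comp_assoc[OF s(1) r(1) k(1)] k(2) by simp
  have kh: "shm k \<cdot> h = h"
    using comp_eqR[OF t(3) shm_hom[OF rs] shm_hom[OF k(1)] 2] shm_comp[OF rs k(1)] k(2)
      ShM_Ident[OF t(4)] one_comp[OF t(3)] by simp
  have "shm (s \<cdot> r'') \<cdot> d = shm s \<cdot> (shm r'' \<cdot> d)"
    using shm_comp[OF r'' s(1)] comp_assoc[OF u(3) shm_hom[OF r''] shm_hom[OF s(1)]] by simp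
  also have "shm r'' \<cdot> d = h \<cdot> r'"
    unfolding r''_def using shm_comp[OF r(1) k(1)] comp_eqR[OF u(3) shm_hom[OF r(1)] shm_hom[OF k(1)] r(3)]
      comp_eqL[OF r' t(3) shm_hom[OF k(1)] kh] by simp
  also have "shm s \<cdot> (h \<cdot> r') = d \<cdot> (s' \<cdot> r')"
    using comp_eqL[OF r' t(3) shm_hom[OF s(1)] s(3)] comp_assoc[OF r' s' u(3)] by simp
  also have "s' \<cdot> r' = one Z' - q \<cdot> a" using sum by (simp add: algebra_simps)
  also have "d \<cdot> (one Z' - q \<cdot> a) = d - d \<cdot> (q \<cdot> a)"
    using comp_diff[OF one_hom[OF u(6)] comp_hom[OF a q] u(3)] comp_one[OF u(3)] by simp
  also have "d \<cdot> (q \<cdot> a) = 0"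
  proof -
    obtain v where v: "v \<in> hom A M" "p \<cdot> v = q" using right_approxE[OF ap A q] .
    have "d \<cdot> q = 0" using v(2) comp_eqL[OF v(1) u(2,3) tri_hg[OF S]] zero_comp[OF v(1)] by simp
    then show ?thesis using comp_eqL[OF a q u(3)] zero_comp[OF a] by simp
  qed
  finally have "shm (one Z - s \<cdot> r'') \<cdot> d = 0"
    using shm_diff[OF one_hom[OF u(4)] comp_hom[OF r'' s(1)]] ShM_Ident[OF u(4)] one_comp[OF u(3)]
      diff_comp[OF u(3) one_hom[OF ShO_Ob[OF u(4)]] shm_hom[OF comp_hom[OF r'' s(1)]]] by simp
  then obtain w where w: "w \<in> hom M Z" "w \<cdot> m = one Z - s \<cdot> r''"
    using tri_extend_first[OF S diff_hom[OF one_hom[OF u(4)] comp_hom[OF r'' s(1)]]] by blast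
  show ?thesis using summand_moduloI[OF s(1) r'' M u(1) w(1) 3] w(2) by simp
qed

text \<open>
  Minimality makes \<open>B\<close> a summand of \<open>M\<close>. On its complement \<open>K\<close>, the map \<open>\<kappa> \<cdot> m\<close> only sees the part of \<open>Z\<close>
  complementary to \<open>Y\<close>, so the identity of \<open>K\<close> is a sum of a map through \<open>Z\<close> and a map through \<open>Z'\<close>. A
  local summand of \<open>K\<close> is thus a summand of \<open>Z\<close> or of \<open>Z'\<close>.
\<close>

lemma multiplicity_middle:
  assumes T: "exchange_tri L Y B Y' f g h" and S: "Tri C Z M Z' m p d"
    and ap: "left_approximation C (Add L) Z M m" and R: "summand_modulo L Y Z"
    and l: "local_object l" and nZ: "\<not> retract l Z" and nZ': "\<not> retract l Z'"
  shows "multiplicity C l M = multiplicity C l B"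
proof -
  note t = triD[OF exchange_triD(1)[OF T]] and u = triD[OF S]
  obtain s r A a q where s: "s \<in> hom Y Z" and r: "r \<in> hom Z Y" and A: "A \<in> Add L"
    and a: "a \<in> hom Z A" and q: "q \<in> hom A Z" and rs: "r \<cdot> s = one Y"
    and sum: "s \<cdot> r + q \<cdot> a = one Z" by (rule summand_moduloE[OF R])
  obtain sB rB where sB: "sB \<in> hom B M" and rB: "rB \<in> hom M B" and e1: "sB \<cdot> f = m \<cdot> s"
    and i: "iso_mor C B B (rB \<cdot> sB)" by (rule summand_modulo_middle[OF T S ap s r rs])
  obtain k where k: "k \<in> hom B B" "k \<cdot> (rB \<cdot> sB) = one B" by (rule isoE[OF i t(5) t(5)])
  have "(k \<cdot> rB) \<cdot> sB = one B" using comp_assoc[OF sB rB k(1)] k(2) by simp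
  then obtain K \<tau> \<kappa> where b: "biproduct2 B K M sB (k \<cdot> rB) \<tau> \<kappa>"
    using retract_complement[OF sB comp_hom[OF rB k(1)]] by blast
  note \<tau> = biproduct2D(3)[OF b] and \<kappa> = biproduct2D(4)[OF b]
  note km = comp_hom[OF u(1) \<kappa>]
  have K: "K \<in> Ob C" using hom_src[OF \<tau>] .
  have "(\<kappa> \<cdot> m) \<cdot> s = 0"
    using comp_eqR[OF s u(1) \<kappa> e1[symmetric]] comp_eqL[OF t(1) sB \<kappa> biproduct2D(8)[OF b]]
      zero_comp[OF t(1)] by simp
  then have "(\<kappa> \<cdot> m) \<cdot> (s \<cdot> r) = 0" using comp_eqL[OF r s km] zero_comp[OF r] by simp
  then have kq: "\<kappa> \<cdot> m = ((\<kappa> \<cdot> m) \<cdot> q) \<cdot> a"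
    using comp_add[OF comp_hom[OF r s] comp_hom[OF a q] km] sum comp_one[OF km]
      comp_assoc[OF a q km] by simp
  obtain v where v: "v \<in> hom M A" "v \<cdot> m = a" using left_approxE[OF ap A a] .
  note kmq = comp_hom[OF q km]
  define y where "y = ((\<kappa> \<cdot> m) \<cdot> q) \<cdot> v"
  have y: "y \<in> hom M K" unfolding y_def using comp_hom[OF v(1) kmq] .
  have "(\<kappa> - y) \<cdot> m = 0"
    using diff_comp[OF u(1) \<kappa> y] comp_eqR[OF u(1) v(1) kmq v(2)] kq unfolding y_def by simp
  then obtain x where x: "x \<in> hom Z' K" "x \<cdot> p = \<kappa> - y" using tri_extend[OF S diff_hom[OF \<kappa> y]] by blast
  have "\<not> retract l K"
  proof
    assume "retract l K"
    then obtain \<sigma> \<rho> where \<sigma>: "\<sigma> \<in> hom l K" "\<rho> \<in> hom K l" "\<rho> \<cdot> \<sigma> = one l"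
      unfolding retract_def by blast
    note ts = comp_hom[OF \<sigma>(1) \<tau>]
    have "(y + x \<cdot> p) \<cdot> (\<tau> \<cdot> \<sigma>) = \<sigma>"
      using x(2) comp_eqL[OF \<sigma>(1) \<tau> \<kappa> biproduct2D(6)[OF b]] one_comp[OF \<sigma>(1)] by simp
    then have "y \<cdot> (\<tau> \<cdot> \<sigma>) + (x \<cdot> p) \<cdot> (\<tau> \<cdot> \<sigma>) = \<sigma>"
      using add_comp[OF ts y comp_hom[OF u(2) x(1)]] by simp
    then have "\<rho> \<cdot> (y \<cdot> (\<tau> \<cdot> \<sigma>)) + \<rho> \<cdot> ((x \<cdot> p) \<cdot> (\<tau> \<cdot> \<sigma>)) = one l"
      using comp_add[OF comp_hom[OF ts y] comp_hom[OF ts comp_hom[OF u(2) x(1)]] \<sigma>(2)] \<sigma>(3) by simp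
    moreover have "\<rho> \<cdot> (y \<cdot> (\<tau> \<cdot> \<sigma>)) = (\<rho> \<cdot> (\<kappa> \<cdot> m)) \<cdot> (q \<cdot> (v \<cdot> (\<tau> \<cdot> \<sigma>)))"
      unfolding y_def
      using comp_assoc[OF ts v(1) kmq] comp_assoc[OF comp_hom[OF ts v(1)] q km]
        comp_assoc[OF comp_hom[OF comp_hom[OF ts v(1)] q] km \<sigma>(2)] by simp
    moreover have "\<rho> \<cdot> ((x \<cdot> p) \<cdot> (\<tau> \<cdot> \<sigma>)) = (\<rho> \<cdot> x) \<cdot> (p \<cdot> (\<tau> \<cdot> \<sigma>))"
      using comp_assoc[OF ts u(2) x(1)] comp_assoc[OF comp_hom[OF ts u(2)] x(1) \<sigma>(2)] by simp
    ultimately have "(\<rho> \<cdot> (\<kappa> \<cdot> m)) \<cdot> (q \<cdot> (v \<cdot> (\<tau> \<cdot> \<sigma>))) + (\<rho> \<cdot> x) \<cdot> (p \<cdot> (\<tau> \<cdot> \<sigma>)) = one l" by simp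
    then show False
      using retract_through[OF l comp_hom[OF comp_hom[OF ts v(1)] q] comp_hom[OF km \<sigma>(2)]
          comp_hom[OF ts u(2)] comp_hom[OF x(1) \<sigma>(2)]] nZ nZ' by blast
  qed
  then show ?thesis using multiplicity_biproduct2[OF l b] multiplicity_eq_0_iff[OF l K] by simp
qed

text \<open>
  The orthogonality conditions let \<open>\<alpha>\<close> and \<open>\<beta>\<close> descend to maps between \<open>X\<close> and \<open>X'\<close>, whose composite differs
  from the identity by a map through \<open>G\<close>.
\<close>

lemma lift_retract:
  assumes T: "Tri C X G Z x z \<zeta>" and T': "Tri C X' G' Z' x' z' \<zeta>'"
    and al: "\<alpha> \<in> hom Z Z'" and be: "\<beta> \<in> hom Z' Z" and ba: "\<zeta> \<cdot> (\<beta> \<cdot> \<alpha>) = \<zeta>"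
    and 1: "ext_zero G X'" and 2: "ext_zero G' X"
    and X: "local_object X" and nG: "\<not> retract X G"
  shows "retract X X'"
proof -
  note t = triD[OF T] and t' = triD[OF T']
  obtain aG where aG: "aG \<in> hom G G'" "z' \<cdot> aG = \<alpha> \<cdot> z"
    using lift_ext_zero[OF T' comp_hom[OF t(2) al] 1] .
  obtain a where a: "a \<in> hom X X'" "shm a \<cdot> \<zeta> = \<zeta>' \<cdot> \<alpha>"
    using fill_first[OF T T' aG(1) al aG(2)] by metis
  obtain bG where bG: "bG \<in> hom G' G" "z \<cdot> bG = \<beta> \<cdot> z'"
    using lift_ext_zero[OF T comp_hom[OF t'(2) be] 2] .
  obtain b where b: "b \<in> hom X' X" "shm b \<cdot> \<zeta>' = \<zeta> \<cdot> \<beta>"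
    using fill_first[OF T' T bG(1) be bG(2)] by metis
  note o = one_hom[OF t(4)] and bah = comp_hom[OF a(1) b(1)]
  have "shm (b \<cdot> a) \<cdot> \<zeta> = \<zeta>"
    using shm_comp[OF a(1) b(1)] comp_eqR[OF t(3) shm_hom[OF a(1)] shm_hom[OF b(1)] a(2)]
      comp_eqL[OF al t'(3) shm_hom[OF b(1)] b(2)] comp_assoc[OF al be t(3)] ba by simp
  then have "shm (one X - b \<cdot> a) \<cdot> \<zeta> = 0"
    using shm_diff[OF o bah] ShM_Ident[OF t(4)] diff_comp[OF t(3) shm_hom[OF o] shm_hom[OF bah]]
      one_comp[OF t(3)] by simp
  then obtain w where w: "w \<in> hom G X" "w \<cdot> x = one X - b \<cdot> a"
    using tri_extend_first[OF T diff_hom[OF o bah]] by blast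
  then show ?thesis using retract_through[OF X a(1) b(1) t(1) w(1)] nG by simp
qed

lemma ext_zero_middle_left:
  assumes T: "Tri C X Y Z f g h" and 1: "ext_zero X A" and 2: "ext_zero Z A"
  shows "ext_zero Y A"
proof -
  note t = triD[OF T]
  have "u = 0" if u: "u \<in> hom Y (sh A)" for u
  proof -
    obtain w where w: "w \<in> hom Z (sh A)" "w \<cdot> g = u"
      using tri_extend[OF T u ext_zeroD[OF 1 comp_hom[OF t(1) u]]] .
    then show ?thesis using ext_zeroD[OF 2 w(1)] zero_comp[OF t(2)] by simp
  qed
  then show ?thesis using 1 t unfolding ext_zero_def by blast
qed

lemma ext_zero_middle_right:
  assumes T: "Tri C X Y Z f g h" and 1: "ext_zero A X" and 2: "ext_zero A Z"
  shows "ext_zero A Y"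
proof -
  note t = triD[OF T]
  have "u = 0" if u: "u \<in> hom A (sh Y)" for u
  proof -
    have "(- shm g) \<cdot> u = 0"
      using minus_comp[OF u shm_hom[OF t(2)]] ext_zeroD[OF 2 comp_hom[OF u shm_hom[OF t(2)]]] by simp
    then obtain w where w: "w \<in> hom A (sh X)" "(- shm f) \<cdot> w = u"
      using tri_lift_second[OF rot[OF rot[OF T]] u] by blast
    then show ?thesis using ext_zeroD[OF 1 w(1)] comp_zero[OF minus_hom[OF shm_hom[OF t(1)]]] by simp
  qed
  then show ?thesis using 1 t unfolding ext_zero_def by blast
qed

end

section \<open>Twisting an exchange sequence\<close>

text \<open>
  In the application, \<open>P\<close> is the summand of \<open>R\<close> that is mutated, \<open>P \<rightarrow> E \<rightarrow> P'\<close> is its exchange triangle,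
  \<open>Xs\<close> is the exchange sequence of another summand \<open>Xs 0\<close>, and \<open>V\<close> consists of the remaining summands. The
  condition that there be no arrow of colour \<open>0\<close> from the vertex of \<open>P\<close> to that of \<open>Xs 0\<close> takes the form
  \<open>E \<in> Add V\<close>.
\<close>

locale compatible_twist = krull_schmidt_triangulated C
  for C :: "('o, 'a::ab_group_add, 'k::field, 'z) triangulated_cat_scheme" (structure) +
  fixes V :: "'o set" and P E P' :: 'o and p e \<delta> :: 'a
    and Xs B :: "int \<Rightarrow> 'o" and f g h :: "int \<Rightarrow> 'a"
  assumes V_local: "A \<in> V \<Longrightarrow> local_object A"
    and P_local: "local_object P"
    and P'_local: "local_object P'"
    and P_new: "A \<in> V \<Longrightarrow> \<not> isomorphic C P A"
    and P'_new: "A \<in> V \<Longrightarrow> \<not> isomorphic C P' A"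
    and rigid: "A \<in> insert P V \<Longrightarrow> A' \<in> insert P V \<Longrightarrow> ext_zero A A'"
    and twist: "Tri C P E P' p e \<delta>"
    and E_Add: "E \<in> Add V"
    and P'_V: "A \<in> V \<Longrightarrow> ext_zero P' A"
    and V_P': "A \<in> V \<Longrightarrow> ext_zero A P'"
    and P'_X0: "ext_zero P' (Xs 0)"
    and X0_local: "local_object (Xs 0)"
    and seq: "exchange_sequence (insert P V) Xs B f g h"
begin

lemma X_local: "local_object (Xs c)"
  using exchange_sequence_local[OF seq X0_local] .

lemma P_Add: "P \<in> Add (insert P V)"
  using Add_generator P_local by blast

lemma V_Add: "A \<in> V \<Longrightarrow> A \<in> Add V"
  using Add_generator V_local by blast

lemma V_subset: "Add V \<subseteq> Add (insert P V)" "Add V \<subseteq> Add (insert P' V)" "Add {P'} \<subseteq> Add (insert P' V)"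
  by (rule Add_mono; blast)+

lemma insert_local: "A \<in> insert P V \<Longrightarrow> local_object A"
  using P_local V_local by blast

lemma ext_X: "A \<in> insert P V \<Longrightarrow> ext_zero (Xs c) A"
  using ext_zero_third[OF exchange_sequence_pred[OF seq] rigid _ insert_local] by blast

lemma ext_to_X: "A \<in> insert P V \<Longrightarrow> ext_zero A (Xs c)"
  using ext_zero_first[OF exchange_sequenceD[OF seq] rigid _ insert_local] by blast

lemma ext_Add_X: "A \<in> Add V \<Longrightarrow> ext_zero A (Xs c)"
  using ext_zero_Add_left[OF _ local_object_ob[OF X_local]] ext_to_X by blast

lemma P_not_retract: "A \<in> Add V \<Longrightarrow> \<not> retract P A"
  using AddD P_local P_new by blast

lemma P'_not_retract: "A \<in> Add V \<Longrightarrow> \<not> retract P' A"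
  using AddD P'_local P'_new by blast

lemma multiplicity_zero_object:
  "local_object X \<Longrightarrow> zero_object C Z \<Longrightarrow> multiplicity C X Z = 0"
  using multiplicity_eq_0_iff[of X Z] zero_object_in local_object_nonzero comp_zero
  unfolding retract_def zero_object_def by metis

lemma E_ob: "E \<in> Ob C" and P'_ob: "P' \<in> Ob C"
  using triD[OF twist] by blast+

text \<open>
  The triangle is a sum of copies of \<open>P \<rightarrow> E \<rightarrow> P'\<close> and of identity triangles, one for each local summand
  of \<open>M\<close>. The last property says that a summand \<open>l\<close> of \<open>G\<close> which does not occur in \<open>E\<close> comes from one of
  the identities, hence from a summand of \<open>M\<close>.
\<close>

lemma twist_of_middle:
  assumes M: "M \<in> Add (insert P V)"
  obtains G Q \<gamma> \<kappa> j where "Tri C M G Q \<gamma> \<kappa> j" "G \<in> Add V" "Q \<in> Add {P'}"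
    "multiplicity C P' Q = multiplicity C P M"
    "\<And>l. l \<in> V \<Longrightarrow> \<not> retract l E \<Longrightarrow> multiplicity C l G = multiplicity C l M"
    "\<And>l \<psi> t. l \<in> V \<Longrightarrow> \<not> retract l E \<Longrightarrow> \<psi> \<in> hom G l \<Longrightarrow> t \<in> hom l G \<Longrightarrow> \<psi> \<cdot> t = one l \<Longrightarrow>
      \<exists>t'\<in>hom l M. iso_mor C l l ((\<psi> \<cdot> \<gamma>) \<cdot> t')"
proof -
  obtain n :: nat and Y \<iota> \<pi> where b: "biproduct {..<n} Y M \<iota> \<pi>"
    and Y: "\<And>i. i \<in> {..<n} \<Longrightarrow> local_object (Y i)" by (rule decomposition[OF Add_ob[OF M]]) blast
  obtain O' where O': "zero_object C O'" using ex_zero_object by blast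
  have "\<exists>G Q \<gamma> \<kappa> j. Tri C (Y i) G Q \<gamma> \<kappa> j \<and>
      (if isomorphic C (Y i) P then G = E \<and> Q = P' else G = Y i \<and> \<gamma> = one (Y i) \<and> zero_object C Q)"
    if i: "i \<in> {..<n}" for i
  proof (cases "isomorphic C (Y i) P")
    case True
    note ob = local_object_ob[OF Y[OF i]]
    obtain \<phi> \<phi>' where \<phi>: "\<phi> \<in> hom (Y i) P" "\<phi>' \<in> hom P (Y i)" "\<phi>' \<cdot> \<phi> = one (Y i)" "\<phi> \<cdot> \<phi>' = one P"
      by (rule isomorphicE[OF True ob local_object_ob[OF P_local]])
    note t = triD[OF twist]
    have "Tri C (Y i) E P' (p \<cdot> \<phi>) e (shm \<phi>' \<cdot> \<delta>)"
    proof (rule Tri_iso[OF twist ob E_ob P'_ob])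
      show "p \<cdot> \<phi> \<in> Hom C (Y i) E" "e \<in> Hom C E P'" "shm \<phi>' \<cdot> \<delta> \<in> Hom C P' (sh (Y i))"
        using hom_Hom comp_hom[OF \<phi>(1) t(1)] t(2) comp_hom[OF t(3) shm_hom[OF \<phi>(2)]] by blast+
      show "iso_mor C P (Y i) \<phi>'" using isoI[OF \<phi>(2,1)] \<phi> by simp
      show "iso_mor C E E (one E)" "iso_mor C P' P' (one P')" using iso_one E_ob P'_ob by blast+
      show "p \<cdot> \<phi> \<cdot> \<phi>' = one E \<cdot> p"
        using comp_eqR[OF \<phi>(2,1) t(1) \<phi>(4)] comp_one[OF t(1)] one_comp[OF t(1)] by simp
      show "e \<cdot> one E = one P' \<cdot> e" using comp_one[OF t(2)] one_comp[OF t(2)] by simp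
      show "shm \<phi>' \<cdot> \<delta> \<cdot> one P' = shm \<phi>' \<cdot> \<delta>"
        using comp_one[OF comp_hom[OF t(3) shm_hom[OF \<phi>(2)]]] .
    qed
    then show ?thesis using True by auto
  next
    case False
    then show ?thesis using tri_Ident[OF local_object_ob[OF Y[OF i]] O'] O' by auto
  qed
  then obtain G Q \<gamma> \<kappa> j where T: "\<And>i. i \<in> {..<n} \<Longrightarrow> Tri C (Y i) (G i) (Q i) (\<gamma> i) (\<kappa> i) (j i)"
    and cases: "\<And>i. i \<in> {..<n} \<Longrightarrow> if isomorphic C (Y i) P then G i = E \<and> Q i = P'
      else G i = Y i \<and> \<gamma> i = one (Y i) \<and> zero_object C (Q i)" by metis
  obtain SG \<iota>' \<pi>' where bG: "biproduct {..<n} G SG \<iota>' \<pi>'"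
    by (rule ex_biproduct[of "{..<n}" G]) (use triD[OF T] in auto)
  obtain SQ \<iota>'' \<pi>'' where bQ: "biproduct {..<n} Q SQ \<iota>'' \<pi>''"
    by (rule ex_biproduct[of "{..<n}" Q]) (use triD[OF T] in auto)
  have g: "\<forall>i\<in>{..<n}. \<gamma> i \<in> hom (Y i) (G i)" using triD(1)[OF T] by blast
  note F = diagonal[OF b bG g]
  define F' where "F' = (\<Sum>i<n. \<iota>' i \<cdot> (\<gamma> i \<cdot> \<pi> i))"
  note F = F[folded F'_def]
  have "\<exists>\<kappa> j. Tri C M SG SQ F' \<kappa> j" using sum_of_triangles[OF b bG bQ T] unfolding F'_def by blast
  then obtain \<kappa>' j' where T': "Tri C M SG SQ F' \<kappa>' j'" by blast
  have YV: "Y i \<in> Add V" if i: "i \<in> {..<n}" and nP: "\<not> isomorphic C (Y i) P" for i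
  proof -
    obtain A where A: "A \<in> insert P V" "isomorphic C (Y i) A"
      using AddD[OF M Y[OF i] biproduct_retract[OF b i]] by blast
    then have "A \<in> V" using nP by blast
    then show ?thesis
      using Add_retract[OF V_Add isomorphic_retract[OF A(2)]] local_object_ob Y[OF i] V_local by blast
  qed
  have "G i \<in> Add V" if "i \<in> {..<n}" for i
    using cases[OF that] E_Add YV[OF that] by (auto split: if_splits)
  then have 1: "SG \<in> Add V" using Add_biproduct[OF bG] by blast
  have "Q i \<in> Add {P'}" if "i \<in> {..<n}" for i
    using cases[OF that] Add_generator[OF _ P'_local] Add_zero by (auto split: if_splits)
  then have 2: "SQ \<in> Add {P'}" using Add_biproduct[OF bQ] by blast
  have "multiplicity C P' (Q i) = (if isomorphic C (Y i) P then 1 else 0)" if "i \<in> {..<n}" for i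
    using cases[OF that] multiplicity_local[OF P'_local P'_local] isomorphic_refl[OF P'_ob]
      multiplicity_zero_object[OF P'_local] by auto
  then have "multiplicity C P' SQ = (\<Sum>i<n. if isomorphic C (Y i) P then 1 else 0)"
    using multiplicity_biproduct[OF P'_local bQ] by simp
  then have 3: "multiplicity C P' SQ = multiplicity C P M"
    using multiplicity_eq[OF P_local b Y] by (simp add: sum.If_cases Collect_conj_eq lessThan_def)
  have 4: "multiplicity C l SG = multiplicity C l M" if l: "l \<in> V" and nE: "\<not> retract l E" for l
  proof -
    note ll = V_local[OF l]
    have "multiplicity C l (G i) = (if isomorphic C (Y i) l then 1 else 0)" if i: "i \<in> {..<n}" for i
    proof (cases "isomorphic C (Y i) P")
      case True
      then have "\<not> isomorphic C (Y i) l"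
        using P_new[OF l] isomorphic_trans[OF isomorphic_sym[OF True]] local_object_ob Y[OF i] ll P_local
        by blast
      then show ?thesis using True cases[OF i] multiplicity_eq_0_iff[OF ll E_ob] nE by simp
    next
      case False
      then show ?thesis using cases[OF i] multiplicity_local[OF ll Y[OF i]] by simp
    qed
    then have "multiplicity C l SG = (\<Sum>i<n. if isomorphic C (Y i) l then 1 else 0)"
      using multiplicity_biproduct[OF ll bG] by simp
    then show ?thesis
      using multiplicity_eq[OF ll b Y] by (simp add: sum.If_cases Collect_conj_eq lessThan_def)
  qed
  have 5: "\<exists>t'\<in>hom l M. iso_mor C l l ((\<psi> \<cdot> F') \<cdot> t')"
    if l: "l \<in> V" and nE: "\<not> retract l E" and \<psi>: "\<psi> \<in> hom SG l" and t: "t \<in> hom l SG"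
      and eq: "\<psi> \<cdot> t = one l" for l \<psi> t
  proof -
    note ll = V_local[OF l]
    note tG = biproductD(3)[OF bG] biproductD(4)[OF bG]
    have "(\<Sum>i<n. (\<psi> \<cdot> \<iota>' i) \<cdot> (\<pi>' i \<cdot> t)) = one l"
    proof -
      have "(\<psi> \<cdot> \<iota>' i) \<cdot> (\<pi>' i \<cdot> t) = \<psi> \<cdot> (\<iota>' i \<cdot> (\<pi>' i \<cdot> t))" if "i \<in> {..<n}" for i
        using comp_assoc[OF comp_hom[OF t tG(2)[OF that]] tG(1)[OF that] \<psi>] .
      then have "(\<Sum>i<n. (\<psi> \<cdot> \<iota>' i) \<cdot> (\<pi>' i \<cdot> t)) = \<psi> \<cdot> (\<Sum>i<n. \<iota>' i \<cdot> (\<pi>' i \<cdot> t))"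
        using comp_sum[OF local_object_ob[OF ll] \<psi>, of "{..<n}" "\<lambda>i. \<iota>' i \<cdot> (\<pi>' i \<cdot> t)"]
          comp_hom[OF comp_hom[OF t tG(2)] tG(1)] by simp
      then show ?thesis using biproduct_in[OF bG t] eq by simp
    qed
    then have "iso_mor C l l (\<Sum>i<n. (\<psi> \<cdot> \<iota>' i) \<cdot> (\<pi>' i \<cdot> t))"
      using iso_one[OF local_object_ob[OF ll]] by simp
    then obtain i where i: "i \<in> {..<n}" and iso: "iso_mor C l l ((\<psi> \<cdot> \<iota>' i) \<cdot> (\<pi>' i \<cdot> t))"
      using local_object_sum[OF ll, of "{..<n}" "\<lambda>i. (\<psi> \<cdot> \<iota>' i) \<cdot> (\<pi>' i \<cdot> t)"]
        comp_hom[OF comp_hom[OF t tG(2)] comp_hom[OF tG(1) \<psi>]] by blast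
    have "retract l (G i)"
      using retractI_iso[OF comp_hom[OF t tG(2)[OF i]] comp_hom[OF tG(1)[OF i] \<psi>] iso] .
    then have nP: "\<not> isomorphic C (Y i) P" using cases[OF i] nE by auto
    then have Gi: "G i = Y i" "\<gamma> i = one (Y i)" using cases[OF i] by auto
    have pt: "\<pi>' i \<cdot> t \<in> hom l (Y i)" using comp_hom[OF t tG(2)[OF i]] Gi by simp
    note t\<iota> = biproductD(3)[OF b i]
    have "F' \<cdot> \<iota> i = \<iota>' i" using F(2)[OF i] Gi comp_one[OF tG(1)[OF i]] by simp
    then have "(\<psi> \<cdot> F') \<cdot> (\<iota> i \<cdot> (\<pi>' i \<cdot> t)) = (\<psi> \<cdot> \<iota>' i) \<cdot> (\<pi>' i \<cdot> t)"
      using comp_assoc[OF pt t\<iota> comp_hom[OF F(1) \<psi>]] comp_assoc[OF t\<iota> F(1) \<psi>] by simp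
    then show ?thesis using iso comp_hom[OF pt t\<iota>] by metis
  qed
  show ?thesis using that[OF T' 1 2 3 4 5] .
qed

end

text \<open>
  The objects \<open>Z c\<close> are the cones of (not necessarily minimal) left approximations of \<open>Xs (c - 1)\<close>
  by sums of objects of \<open>V\<close>.
\<close>

locale twist_tower = compatible_twist C V P E P' p e \<delta> Xs B f g h
  for C :: "('o, 'a::ab_group_add, 'k::field, 'z) triangulated_cat_scheme" (structure)
    and V P E P' p e \<delta> Xs B f g h +
  fixes G Q Z :: "int \<Rightarrow> 'o" and \<gamma> \<kappa> j z \<zeta> :: "int \<Rightarrow> 'a"
  assumes middle: "Tri C (B c) (G c) (Q c) (\<gamma> c) (\<kappa> c) (j c)"
    and G_Add: "G c \<in> Add V"
    and Q_Add: "Q c \<in> Add {P'}"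
    and multiplicity_Q: "multiplicity C P' (Q c) = multiplicity C P (B c)"
    and multiplicity_G: "l \<in> V \<Longrightarrow> \<not> retract l E \<Longrightarrow> multiplicity C l (G c) = multiplicity C l (B c)"
    and split_G: "l \<in> V \<Longrightarrow> \<not> retract l E \<Longrightarrow> \<psi> \<in> hom (G c) l \<Longrightarrow> t \<in> hom l (G c) \<Longrightarrow>
      \<psi> \<cdot> t = one l \<Longrightarrow> \<exists>t'\<in>hom l (B c). iso_mor C l l ((\<psi> \<cdot> \<gamma> c) \<cdot> t')"
    and cone: "Tri C (Xs c) (G c) (Z (c + 1)) (\<gamma> c \<cdot> f c) (z c) (\<zeta> c)"
begin

lemma cone_pred: "Tri C (Xs (c - 1)) (G (c - 1)) (Z c) (\<gamma> (c - 1) \<cdot> f (c - 1)) (z (c - 1)) (\<zeta> (c - 1))"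
  using cone[of "c - 1"] by simp

text \<open>
  The octahedron over \<open>Xs (c - 1) \<rightarrow> B (c - 1) \<rightarrow> G (c - 1)\<close>.
\<close>

lemma octahedron:
  obtains u v w where "Tri C (Xs c) (Z c) (Q (c - 1)) u v w"
proof -
  obtain u v where "Tri C (Xs c) (Z c) (Q (c - 1)) u v (shm (g (c - 1)) \<cdot> j (c - 1))"
    using Tri_octahedral[OF exchange_triD(1)[OF exchange_sequence_pred[OF seq]] middle cone_pred[of c]]
    by blast
  then show ?thesis using that by blast
qed

lemma Z_ob: "Z c \<in> Ob C"
  using triD[OF cone_pred] by blast

lemma ext_Q: "A \<in> V \<Longrightarrow> ext_zero (Q c) A"
  using ext_zero_Add_left[OF Q_Add local_object_ob[OF V_local]] P'_V by blast

lemma ext_to_Q: "A \<in> V \<Longrightarrow> ext_zero A (Q c)"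
  using ext_zero_Add_right[OF Q_Add local_object_ob[OF V_local]] V_P' by blast

lemma ext_Z_V: "A \<in> V \<Longrightarrow> ext_zero (Z c) A"
  using octahedron[of c] ext_zero_middle_left ext_X ext_Q by (metis insertCI)

lemma ext_V_Z: "A \<in> V \<Longrightarrow> ext_zero A (Z c)"
  using octahedron[of c] ext_zero_middle_right ext_to_X ext_to_Q by (metis insertCI)

lemma ext_Z_Add: "A \<in> Add V \<Longrightarrow> ext_zero (Z c) A"
  using ext_zero_Add_right[OF _ Z_ob] ext_Z_V by blast

lemma ext_Add_Z: "A \<in> Add V \<Longrightarrow> ext_zero A (Z c)"
  using ext_zero_Add_left[OF _ Z_ob] ext_V_Z by blast

text \<open>
  A map \<open>Z c \<rightarrow> \<Sigma>P'\<close> comes from a map \<open>Xs (c - 1) \<rightarrow> P'\<close>. By orthogonality to \<open>P\<close>, this one factors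
  through \<open>E\<close> and then extends to \<open>G (c - 1)\<close>, so it induces \<open>0\<close> on \<open>Z c\<close>.
\<close>

lemma ext_Z_P': "ext_zero (Z c) P'"
proof -
  note T = cone_pred[of c]
  note t = triD[OF T] and tw = triD[OF twist]
  have "u = 0" if u: "u \<in> hom (Z c) (sh P')" for u
  proof -
    have eG: "ext_zero (G (c - 1)) P'" using ext_zero_Add_left[OF G_Add P'_ob] V_P' by blast
    obtain w where w: "w \<in> hom (sh (Xs (c - 1))) (sh P')" "w \<cdot> \<zeta> (c - 1) = u"
      using tri_extend_second[OF T u ext_zeroD[OF eG comp_hom[OF t(2) u]]] .
    obtain a where a: "a \<in> hom (Xs (c - 1)) P'" "w = shm a" by (rule shm_surj[OF w(1) t(4) P'_ob])
    obtain a' where a': "a' \<in> hom (Xs (c - 1)) E" "e \<cdot> a' = a"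
      using lift_ext_zero[OF twist a(1)] ext_X by blast
    obtain a'' where a'': "a'' \<in> hom (G (c - 1)) E" "a'' \<cdot> (\<gamma> (c - 1) \<cdot> f (c - 1)) = a'"
      using extend_ext_zero[OF T a'(1) ext_Z_Add[OF E_Add]] .
    have "shm a' \<cdot> \<zeta> (c - 1) = 0"
      using shm_comp[OF t(1) a''(1)] a''(2)
        comp_eqR[OF t(3) shm_hom[OF t(1)] shm_hom[OF a''(1)] tri_shf_h[OF T]]
        comp_zero[OF shm_hom[OF a''(1)]] by simp
    then show ?thesis
      using w(2) a(2) a'(2) shm_comp[OF a'(1) tw(2)]
        comp_eqR[OF t(3) shm_hom[OF a'(1)] shm_hom[OF tw(2)]] comp_zero[OF shm_hom[OF tw(2)]] by simp
  qed
  then show ?thesis unfolding ext_zero_def using Z_ob P'_ob by blast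
qed

text \<open>
  A map \<open>P' \<rightarrow> \<Sigma>(Z c)\<close> comes from a map \<open>P \<rightarrow> Z c\<close>. Orthogonality lifts this one to \<open>G (c - 1)\<close> and extends
  the lift to \<open>E\<close>, so it induces \<open>0\<close> on \<open>P'\<close>.
\<close>

lemma ext_P'_Z: "ext_zero P' (Z c)"
proof -
  note T = cone_pred[of c]
  note t = triD[OF T] and tw = triD[OF twist]
  have "u = 0" if u: "u \<in> hom P' (sh (Z c))" for u
  proof -
    obtain w where w: "w \<in> hom (sh P) (sh (Z c))" "w \<cdot> \<delta> = u"
      using tri_extend_second[OF twist u ext_zeroD[OF ext_Add_Z[OF E_Add] comp_hom[OF tw(2) u]]] .
    obtain b where b: "b \<in> hom P (Z c)" "w = shm b" by (rule shm_surj[OF w(1) tw(4) Z_ob])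
    obtain b' where b': "b' \<in> hom P (G (c - 1))" "z (c - 1) \<cdot> b' = b"
      using lift_ext_zero[OF T b(1)] ext_to_X by blast
    have eG: "ext_zero P' (G (c - 1))" using ext_zero_Add_right[OF G_Add P'_ob] P'_V by blast
    obtain b'' where b'': "b'' \<in> hom E (G (c - 1))" "b'' \<cdot> p = b'"
      using extend_ext_zero[OF twist b'(1) eG] .
    have "shm b' \<cdot> \<delta> = 0"
      using shm_comp[OF tw(1) b''(1)] b''(2)
        comp_eqR[OF tw(3) shm_hom[OF tw(1)] shm_hom[OF b''(1)] tri_shf_h[OF twist]]
        comp_zero[OF shm_hom[OF b''(1)]] by simp
    then show ?thesis
      using w(2) b(2) b'(2) shm_comp[OF b'(1) t(2)]
        comp_eqR[OF tw(3) shm_hom[OF b'(1)] shm_hom[OF t(2)]] comp_zero[OF shm_hom[OF t(2)]] by simp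
  qed
  then show ?thesis unfolding ext_zero_def using Z_ob P'_ob by blast
qed

text \<open>
  The map \<open>Xs c \<rightarrow> G c\<close> extends along \<open>Xs c \<rightarrow> Z c\<close>, because the cone \<open>Q (c - 1)\<close> is orthogonal to \<open>V\<close>; this
  is the input for the Mayer-Vietoris triangle. The approximation properties follow from the
  orthogonality of all \<open>Z c\<close> to \<open>V\<close> and \<open>P'\<close> on both sides.
\<close>

lemma tower_triangle:
  obtains M i q i' q' m \<mu> d where "Tri C (Z c) M (Z (c + 1)) m \<mu> d"
    "biproduct2 (Q (c - 1)) (G c) M i q i' q'"
    "left_approximation C (Add (insert P' V)) (Z c) M m"
    "right_approximation C (Add (insert P' V)) M (Z (c + 1)) \<mu>"
proof -
  obtain u v w where T1: "Tri C (Xs c) (Z c) (Q (c - 1)) u v w" by (rule octahedron[of c])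
  note t1 = triD[OF T1] and t2 = triD[OF cone[of c]]
  have "ext_zero (Q (c - 1)) (G c)" using ext_zero_Add_right[OF G_Add t1(6)] ext_Q by blast
  then obtain y where y: "y \<in> hom (Z c) (G c)" "y \<cdot> u = \<gamma> c \<cdot> f c"
    using extend_ext_zero[OF T1 t2(1)] by blast
  obtain M i q i' q' where b: "biproduct2 (Q (c - 1)) (G c) M i q i' q'"
    using ex_biproduct2[OF t1(6) t2(5)] .
  obtain \<mu> d where T: "Tri C (Z c) M (Z (c + 1)) (i \<cdot> v + i' \<cdot> y) \<mu> d"
    using mayer_vietoris[OF T1 cone y b] by blast
  note t = triD[OF T]
  have M: "M \<in> Add (insert P' V)"
    using Add_biproduct2[OF b] Q_Add G_Add V_subset by blast
  have "ext_zero (Z (c + 1)) A" if "A \<in> Add (insert P' V)" for A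
    using ext_zero_Add_right[OF that Z_ob] ext_Z_V ext_Z_P' by blast
  then have "\<exists>s\<in>hom M A. s \<cdot> (i \<cdot> v + i' \<cdot> y) = r"
    if "A \<in> Add (insert P' V)" "r \<in> hom (Z c) A" for A r
    using extend_ext_zero[OF T that(2)] that(1) by metis
  then have l: "left_approximation C (Add (insert P' V)) (Z c) M (i \<cdot> v + i' \<cdot> y)"
    unfolding left_approximation_def
    using M t(1) hom_Hom homI Z_ob Add_ob by metis
  have "ext_zero A (Z c)" if "A \<in> Add (insert P' V)" for A
    using ext_zero_Add_left[OF that Z_ob] ext_V_Z ext_P'_Z by blast
  then have "\<exists>s\<in>hom A M. \<mu> \<cdot> s = r"
    if "A \<in> Add (insert P' V)" "r \<in> hom A (Z (c + 1))" for A r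
    using lift_ext_zero[OF T that(2)] that(1) by metis
  then have r: "right_approximation C (Add (insert P' V)) M (Z (c + 1)) \<mu>"
    unfolding right_approximation_def
    using M t(2) hom_Hom homI Z_ob Add_ob by metis
  show ?thesis using that[OF T b l r] .
qed

text \<open>A summand \<open>P'\<close> of \<open>Z c\<close> would come from a summand \<open>P\<close> of \<open>Xs (c - 1)\<close>.\<close>

lemma P'_not_retract_Z: "\<not> retract P' (Z c)"
proof
  assume "retract P' (Z c)"
  then obtain s r where s: "s \<in> hom P' (Z c)" "r \<in> hom (Z c) P'" "r \<cdot> s = one P'"
    unfolding retract_def by blast
  have eG: "ext_zero (G (c - 1)) P"
    using ext_zero_Add_left[OF G_Add local_object_ob[OF P_local]] rigid by blast
  have "\<delta> \<cdot> (r \<cdot> s) = \<delta>" using s(3) comp_one[OF triD(3)[OF twist]] by simp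
  then have "retract P (Xs (c - 1))"
    using lift_retract[OF twist cone_pred s(1,2) _ ext_Add_X[OF E_Add] eG P_local P_not_retract[OF E_Add]]
    by blast
  then show False
    using exchange_sequence_no_retract[OF seq P_Add local_object_nonzero[OF P_local]] by blast
qed

text \<open>
  A summand \<open>l\<close> of \<open>Z c\<close> would lift to a summand of \<open>G (c - 1)\<close>, hence of \<open>B (c - 1)\<close>, which the
  minimal left approximation of \<open>Xs (c - 1)\<close> does not meet.
\<close>

lemma V_not_retract_Z:
  assumes l: "l \<in> V" and nE: "\<not> retract l E"
  shows "\<not> retract l (Z c)"
proof
  assume "retract l (Z c)"
  then obtain s r where s: "s \<in> hom l (Z c)" "r \<in> hom (Z c) l" "r \<cdot> s = one l"
    unfolding retract_def by blast
  note T = cone_pred[of c] and X = exchange_sequence_pred[OF seq, of c]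
  note t = triD[OF T] and x = triD[OF exchange_triD(1)[OF X]] and ga = triD(1)[OF middle[of "c - 1"]]
  obtain v where v: "v \<in> hom l (G (c - 1))" "z (c - 1) \<cdot> v = s"
    using lift_ext_zero[OF T s(1) ext_to_X] l by blast
  note rz = comp_hom[OF t(2) s(2)]
  have "(r \<cdot> z (c - 1)) \<cdot> v = one l" using comp_eqR[OF v(1) t(2) s(2) v(2)] s(3) by simp
  then obtain t' where t': "t' \<in> hom l (B (c - 1))"
    "iso_mor C l l (((r \<cdot> z (c - 1)) \<cdot> \<gamma> (c - 1)) \<cdot> t')"
    using split_G[OF l nE rz v(1)] by blast
  have "((r \<cdot> z (c - 1)) \<cdot> \<gamma> (c - 1)) \<cdot> f (c - 1) = 0"
    using comp_assoc[OF x(1) ga rz] comp_eqR[OF t(1,2) s(2) tri_gf[OF T]] comp_zero[OF s(2)] by simp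
  then show False
    using left_minimal_split_epi[OF exchange_triD(3)[OF X] x(1) comp_hom[OF ga rz] t'(1,2)]
      local_object_nonzero[OF V_local[OF l]] by blast
qed

text \<open>
  The map \<open>Q (-1) \<rightarrow> \<Sigma>(Xs 0)\<close> vanishes because \<open>Q (-1)\<close> is a sum of copies of \<open>P'\<close>, which is
  orthogonal to \<open>Xs 0\<close>. So \<open>Q (-1)\<close> is a summand of \<open>Z 0\<close>, and as \<open>P'\<close> is not, it is zero.
\<close>

lemma X0_isomorphic_Z0: "isomorphic C (Xs 0) (Z 0)"
proof -
  obtain u v w where T: "Tri C (Xs 0) (Z 0) (Q (-1)) u v w" using octahedron[of 0] by auto
  note t = triD[OF T]
  have "ext_zero (Q (-1)) (Xs 0)" using ext_zero_Add_left[OF Q_Add t(4)] P'_X0 by blast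
  then have w: "w = 0" using ext_zeroD t(3) by blast
  note ox = one_hom[OF t(4)] and oq = one_hom[OF t(6)] and oz = one_hom[OF t(5)]
  obtain r where r: "r \<in> hom (Z 0) (Xs 0)" "r \<cdot> u = one (Xs 0)"
    using tri_extend_first[OF T ox] w comp_zero[OF shm_hom[OF ox]] by auto
  obtain s where s: "s \<in> hom (Q (-1)) (Z 0)" "v \<cdot> s = one (Q (-1))"
    using tri_lift_second[OF T oq] w zero_comp[OF oq] by auto
  have rQ: "retract (Q (-1)) (Z 0)" unfolding retract_def using s t(2) by blast
  obtain n :: nat and Y \<iota> \<pi> where b: "biproduct {..<n} Y (Q (-1)) \<iota> \<pi>"
    and Y: "\<And>i. i \<in> {..<n} \<Longrightarrow> local_object (Y i)" by (rule decomposition[OF t(6)]) blast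
  have "i \<notin> {..<n}" for i
  proof
    assume i: "i \<in> {..<n}"
    note re = biproduct_retract[OF b i]
    have "isomorphic C (Y i) P'" using AddD[OF Q_Add Y[OF i] re] by blast
    then have "retract P' (Z 0)"
      using retract_trans[OF isomorphic_retract[OF isomorphic_sym] retract_trans[OF re rQ]]
        P'_ob local_object_ob[OF Y[OF i]] by blast
    then show False using P'_not_retract_Z by blast
  qed
  then have "{..<n} = {}" by blast
  then have "one (Q (-1)) = 0" using biproductD(7)[OF b] by simp
  then have v: "v = 0" using zero_object_in[OF t(2)] t(6) unfolding zero_object_def by blast
  obtain k where k: "k \<in> hom (Z 0) (Xs 0)" "u \<cdot> k = one (Z 0)"
    using tri_lift[OF T oz] v zero_comp[OF oz] by auto
  show ?thesis
    unfolding isomorphic_def using iso_inverse[OF t(1) r(1) k(1) r(2) k(2)] by blast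
qed

section \<open>Comparison with the exchange sequence after the twist\<close>

context
  fixes Ys B' f' g' h'
  assumes seq': "exchange_sequence (insert P' V) Ys B' f' g' h'"
    and Y0: "Ys 0 = Xs 0"
begin

lemma Y_local: "local_object (Ys c)"
  using exchange_sequence_local[OF seq'] X0_local Y0 by simp

lemma summand_modulo_tower: "summand_modulo (insert P' V) (Ys c) (Z c)"
proof (induction c rule: int_induct[where k = 0])
  case base
  show ?case
    using isomorphic_summand_modulo X0_isomorphic_Z0 Y0 Z_ob local_object_ob[OF X0_local] by simp
next
  case (step1 c)
  obtain M m \<mu> d where T: "Tri C (Z c) M (Z (c + 1)) m \<mu> d"
    and l: "left_approximation C (Add (insert P' V)) (Z c) M m" by (rule tower_triangle[of c]) blast
  show ?case using summand_modulo_up[OF exchange_sequenceD[OF seq'] T l step1(2)] .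
next
  case (step2 c)
  obtain M m \<mu> d where T: "Tri C (Z (c - 1)) M (Z c) m \<mu> d"
    and r: "right_approximation C (Add (insert P' V)) M (Z c) \<mu>" by (rule tower_triangle[of "c - 1", simplified]) blast
  show ?case using summand_modulo_down[OF exchange_sequence_pred[OF seq'] T r step2(2)] .
qed

lemma multiplicity_P': "multiplicity C P' (B' c) = multiplicity C P (B (c - 1))"
proof -
  obtain M i q i' q' m \<mu> d where T: "Tri C (Z c) M (Z (c + 1)) m \<mu> d"
    and b: "biproduct2 (Q (c - 1)) (G c) M i q i' q'"
    and l: "left_approximation C (Add (insert P' V)) (Z c) M m" by (rule tower_triangle[of c]) blast
  have "multiplicity C P' M = multiplicity C P' (B' c)"
    using multiplicity_middle[OF exchange_sequenceD[OF seq'] T l summand_modulo_tower P'_local]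
      P'_not_retract_Z by blast
  moreover have "multiplicity C P' (G c) = 0"
    using multiplicity_eq_0_iff[OF P'_local Add_ob[OF G_Add]] P'_not_retract[OF G_Add] by blast
  ultimately show ?thesis using multiplicity_biproduct2[OF P'_local b] multiplicity_Q by simp
qed

lemma multiplicity_V:
  assumes l: "l \<in> V" and nE: "\<not> retract l E"
  shows "multiplicity C l (B' c) = multiplicity C l (B c)"
proof -
  note ll = V_local[OF l]
  obtain M i q i' q' m \<mu> d where T: "Tri C (Z c) M (Z (c + 1)) m \<mu> d"
    and b: "biproduct2 (Q (c - 1)) (G c) M i q i' q'"
    and la: "left_approximation C (Add (insert P' V)) (Z c) M m" by (rule tower_triangle[of c]) blast
  have "multiplicity C l M = multiplicity C l (B' c)"
    using multiplicity_middle[OF exchange_sequenceD[OF seq'] T la summand_modulo_tower ll]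
      V_not_retract_Z[OF l nE] by blast
  moreover have "\<not> retract l (Q (c - 1))"
    using AddD[OF Q_Add ll] P'_new[OF l] isomorphic_sym by blast
  then have "multiplicity C l (Q (c - 1)) = 0"
    using multiplicity_eq_0_iff[OF ll Add_ob[OF Q_Add]] by blast
  ultimately show ?thesis using multiplicity_biproduct2[OF ll b] multiplicity_G[OF l nE] by simp
qed

text \<open>
  An isomorphism \<open>Ys 0 \<simeq> Ys d\<close> exhibits \<open>Z 0\<close> as a summand of \<open>Z d\<close>. Passing to the first objects of the
  triangles that define \<open>Z 0\<close> and \<open>Z d\<close> gives \<open>Xs (-1) \<simeq> Xs (d - 1)\<close>.
\<close>

lemma period_reflect:
  assumes i: "isomorphic C (Ys d) (Ys 0)"
  shows "isomorphic C (Xs d) (Xs 0)"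
proof -
  have ob: "Xs c \<in> Ob C" "Ys c \<in> Ob C" for c
    using local_object_ob X_local Y_local by blast+
  have "retract (Z 0) (Ys 0)"
    using isomorphic_retract[OF isomorphic_sym[OF X0_isomorphic_Z0] Z_ob] ob Y0 by simp
  moreover have "retract (Ys 0) (Ys d)" using isomorphic_retract[OF isomorphic_sym[OF i]] ob by blast
  ultimately have "retract (Z 0) (Z d)"
    using retract_trans summand_modulo_retract[OF summand_modulo_tower] by blast
  then obtain s r where s: "s \<in> hom (Z 0) (Z d)" "r \<in> hom (Z d) (Z 0)" "r \<cdot> s = one (Z 0)"
    unfolding retract_def by blast
  note T = cone_pred[of 0] and T' = cone_pred[of d]
  have "\<not> retract (Xs (0 - 1)) (G (0 - 1))"
    using Add_retract[OF G_Add] V_subset exchange_sequence_no_retract[OF seq]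
      local_object_nonzero[OF X_local] retract_refl[OF ob(1)] by blast
  moreover have "\<zeta> (0 - 1) \<cdot> (r \<cdot> s) = \<zeta> (0 - 1)" using s(3) comp_one[OF triD(3)[OF T]] by simp
  ultimately have "retract (Xs (0 - 1)) (Xs (d - 1))"
    using lift_retract[OF T T' s(1,2) _ ext_Add_X[OF G_Add] ext_Add_X[OF G_Add] X_local] by blast
  then have "isomorphic C (Xs (d - 1)) (Xs (0 - 1))"
    using isomorphic_sym[OF retract_local_object[OF _ X_local X_local]] by blast
  then show ?thesis using exchange_sequence_unique_first[OF seq seq, of "d - 1" "0 - 1" 1] by simp
qed

text \<open>
  In the other direction, an isomorphism \<open>Xs (-1) \<simeq> Xs (d - 1)\<close> extends to the cones, which makes \<open>Z 0\<close> a
  summand of \<open>Z d\<close> up to maps through \<open>G (-1)\<close>; of the two parts of \<open>Z d\<close>, only \<open>Ys d\<close> can contain it.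
\<close>

lemma period_preserve:
  assumes i: "isomorphic C (Xs d) (Xs 0)"
  shows "isomorphic C (Ys d) (Ys 0)"
proof -
  have ob: "Xs c \<in> Ob C" "Ys c \<in> Ob C" for c
    using local_object_ob X_local Y_local by blast+
  have Z0: "local_object (Z 0)" using local_object_isomorphic[OF X0_local X0_isomorphic_Z0 Z_ob] .
  have Y0Z0: "retract (Ys 0) (Z 0)" using isomorphic_retract[OF X0_isomorphic_Z0 ob(1) Z_ob] Y0 by simp
  have not_Add: "\<not> retract (Z 0) A" if "A \<in> Add (insert P' V)" for A
    using retract_trans[OF Y0Z0] Add_retract[OF that] exchange_sequence_no_retract[OF seq']
      local_object_nonzero[OF Y_local] retract_refl[OF ob(2)] by blast
  have "isomorphic C (Xs (0 - 1)) (Xs (d - 1))"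
    using isomorphic_sym[OF exchange_sequence_unique_first[OF seq seq i, of "-1"]] by simp
  then obtain a b where a: "a \<in> hom (Xs (0 - 1)) (Xs (d - 1))" "b \<in> hom (Xs (d - 1)) (Xs (0 - 1))"
    "b \<cdot> a = one (Xs (0 - 1))" by (rule isomorphicE[OF _ ob(1) ob(1)])
  note T = cone_pred[of 0] and T' = cone_pred[of d]
  note t = triD[OF T] and t' = triD[OF T']
  let ?x = "\<gamma> (0 - 1) \<cdot> f (0 - 1)" and ?x' = "\<gamma> (d - 1) \<cdot> f (d - 1)"
  obtain aG where aG: "aG \<in> hom (G (0 - 1)) (G (d - 1))" "aG \<cdot> ?x = ?x' \<cdot> a"
    using extend_ext_zero[OF T comp_hom[OF a(1) t'(1)] ext_Z_Add[OF G_Add]] .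
  obtain \<alpha> where \<alpha>: "\<alpha> \<in> hom (Z 0) (Z d)" "\<zeta> (d - 1) \<cdot> \<alpha> = shm a \<cdot> \<zeta> (0 - 1)"
    using fill_third[OF T T' a(1) aG(1)] aG(2) by metis
  obtain bG where bG: "bG \<in> hom (G (d - 1)) (G (0 - 1))" "bG \<cdot> ?x' = ?x \<cdot> b"
    using extend_ext_zero[OF T' comp_hom[OF a(2) t(1)] ext_Z_Add[OF G_Add]] .
  obtain \<beta> where \<beta>: "\<beta> \<in> hom (Z d) (Z 0)" "\<zeta> (0 - 1) \<cdot> \<beta> = shm b \<cdot> \<zeta> (d - 1)"
    using fill_third[OF T' T a(2) bG(1)] bG(2) by metis
  note ba = comp_hom[OF \<alpha>(1) \<beta>(1)] and o = one_hom[OF Z_ob[of 0]]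
  have "\<zeta> (0 - 1) \<cdot> (\<beta> \<cdot> \<alpha>) = \<zeta> (0 - 1)"
    using comp_eqL[OF \<alpha>(1) \<beta>(1) t(3) \<beta>(2)] comp_eqR[OF \<alpha>(1) t'(3) shm_hom[OF a(2)] \<alpha>(2)]
      comp_assoc[OF t(3) shm_hom[OF a(1)] shm_hom[OF a(2)]] shm_comp[OF a(1,2)] a(3)
      ShM_Ident[OF ob(1)] one_comp[OF t(3)] by simp
  then have "\<zeta> (0 - 1) \<cdot> (one (Z 0) - \<beta> \<cdot> \<alpha>) = 0"
    using comp_diff[OF o ba t(3)] comp_one[OF t(3)] by simp
  then obtain w where w: "w \<in> hom (Z 0) (G (0 - 1))" "z (0 - 1) \<cdot> w = one (Z 0) - \<beta> \<cdot> \<alpha>"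
    using tri_lift_second[OF T diff_hom[OF o ba]] by blast
  have "\<not> retract (Z 0) (G (0 - 1))" using not_Add G_Add V_subset by blast
  then have "retract (Z 0) (Z d)" using retract_through[OF Z0 \<alpha>(1) \<beta>(1) w(1) t(2)] w(2) by simp
  then obtain \<sigma> \<rho> where \<sigma>: "\<sigma> \<in> hom (Z 0) (Z d)" "\<rho> \<in> hom (Z d) (Z 0)" "\<rho> \<cdot> \<sigma> = one (Z 0)"
    unfolding retract_def by blast
  obtain s r A k q where s: "s \<in> hom (Ys d) (Z d)" and r: "r \<in> hom (Z d) (Ys d)"
    and A: "A \<in> Add (insert P' V)" and k: "k \<in> hom (Z d) A" and q: "q \<in> hom A (Z d)"
    and sum: "s \<cdot> r + q \<cdot> k = one (Z d)" by (rule summand_moduloE[OF summand_modulo_tower[of d]])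
  have "\<rho> \<cdot> ((s \<cdot> r + q \<cdot> k) \<cdot> \<sigma>) = one (Z 0)" using sum one_comp[OF \<sigma>(1)] \<sigma>(3) by simp
  then have "\<rho> \<cdot> ((s \<cdot> r) \<cdot> \<sigma>) + \<rho> \<cdot> ((q \<cdot> k) \<cdot> \<sigma>) = one (Z 0)"
    using add_comp[OF \<sigma>(1) comp_hom[OF r s] comp_hom[OF k q]]
      comp_add[OF comp_hom[OF \<sigma>(1) comp_hom[OF r s]] comp_hom[OF \<sigma>(1) comp_hom[OF k q]] \<sigma>(2)] by simp
  moreover have "\<rho> \<cdot> ((s \<cdot> r) \<cdot> \<sigma>) = (\<rho> \<cdot> s) \<cdot> (r \<cdot> \<sigma>)" "\<rho> \<cdot> ((q \<cdot> k) \<cdot> \<sigma>) = (\<rho> \<cdot> q) \<cdot> (k \<cdot> \<sigma>)"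
    using comp_assoc[OF \<sigma>(1) r s] comp_assoc[OF comp_hom[OF \<sigma>(1) r] s \<sigma>(2)]
      comp_assoc[OF \<sigma>(1) k q] comp_assoc[OF comp_hom[OF \<sigma>(1) k] q \<sigma>(2)] by simp_all
  ultimately have "retract (Z 0) (Ys d)"
    using retract_through[OF Z0 comp_hom[OF \<sigma>(1) r] comp_hom[OF s \<sigma>(2)] comp_hom[OF \<sigma>(1) k]
        comp_hom[OF q \<sigma>(2)]] not_Add[OF A] by simp
  then have "retract (Ys 0) (Ys d)" using retract_trans[OF Y0Z0] by blast
  then show ?thesis using isomorphic_sym[OF retract_local_object[OF _ Y_local Y_local]] by blast
qed

end

end

context compatible_twist
begin

lemma ex_tower: "\<exists>G Q Z \<gamma> \<kappa> j z \<zeta>. twist_tower C V P E P' p e \<delta> Xs B f g h G Q Z \<gamma> \<kappa> j z \<zeta>"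
proof -
  have "\<exists>G Q \<gamma> \<kappa> j. Tri C (B c) G Q \<gamma> \<kappa> j \<and> G \<in> Add V \<and> Q \<in> Add {P'} \<and>
      multiplicity C P' Q = multiplicity C P (B c) \<and>
      (\<forall>l. l \<in> V \<longrightarrow> \<not> retract l E \<longrightarrow> multiplicity C l G = multiplicity C l (B c)) \<and>
      (\<forall>l \<psi> t. l \<in> V \<longrightarrow> \<not> retract l E \<longrightarrow> \<psi> \<in> hom G l \<longrightarrow> t \<in> hom l G \<longrightarrow> \<psi> \<cdot> t = one l \<longrightarrow>
        (\<exists>t'\<in>hom l (B c). iso_mor C l l ((\<psi> \<cdot> \<gamma>) \<cdot> t')))" for c
    by (rule twist_of_middle[OF exchange_triD(6)[OF exchange_sequenceD[OF seq, of c]]]) blast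
  then obtain G Q \<gamma> \<kappa> j where T: "\<And>c. Tri C (B c) (G c) (Q c) (\<gamma> c) (\<kappa> c) (j c)"
    and 1: "\<And>c. G c \<in> Add V" "\<And>c. Q c \<in> Add {P'}"
    and 2: "\<And>c. multiplicity C P' (Q c) = multiplicity C P (B c)"
    and 3: "\<And>c l. l \<in> V \<Longrightarrow> \<not> retract l E \<Longrightarrow> multiplicity C l (G c) = multiplicity C l (B c)"
    and 4: "\<And>c l \<psi> t. l \<in> V \<Longrightarrow> \<not> retract l E \<Longrightarrow> \<psi> \<in> hom (G c) l \<Longrightarrow> t \<in> hom l (G c) \<Longrightarrow>
      \<psi> \<cdot> t = one l \<Longrightarrow> \<exists>t'\<in>hom l (B c). iso_mor C l l ((\<psi> \<cdot> \<gamma> c) \<cdot> t')"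
    by metis
  have "\<exists>Z z \<zeta>. Tri C (Xs c) (G c) Z (\<gamma> c \<cdot> f c) z \<zeta>" for c
  proof -
    note t = triD[OF T[of c]] and x = triD[OF exchange_triD(1)[OF exchange_sequenceD[OF seq, of c]]]
    show ?thesis using Tri_complete[OF x(4) t(5) hom_Hom[OF comp_hom[OF x(1) t(1)]]] .
  qed
  then obtain Z z \<zeta> where Z: "\<And>c. Tri C (Xs c) (G c) (Z c) (\<gamma> c \<cdot> f c) (z c) (\<zeta> c)" by metis
  have "twist_tower C V P E P' p e \<delta> Xs B f g h G Q (\<lambda>c. Z (c - 1)) \<gamma> \<kappa> j z \<zeta>"
    by unfold_locales (use T 1 2 3 4 Z in auto)
  then show ?thesis by blast
qed

theorem exchange_sequence_after_twist:
  assumes seq': "exchange_sequence (insert P' V) Ys B' f' g' h'" and Y0: "Ys 0 = Xs 0"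
  shows "isomorphic C (Ys d) (Ys 0) \<longleftrightarrow> isomorphic C (Xs d) (Xs 0)"
    and "multiplicity C P' (B' c) = multiplicity C P (B (c - 1))"
    and "l \<in> V \<Longrightarrow> \<not> retract l E \<Longrightarrow> multiplicity C l (B' c) = multiplicity C l (B c)"
proof -
  obtain G Q Z \<gamma> \<kappa> j z \<zeta> where "twist_tower C V P E P' p e \<delta> Xs B f g h G Q Z \<gamma> \<kappa> j z \<zeta>"
    using ex_tower by blast
  then interpret twist_tower C V P E P' p e \<delta> Xs B f g h G Q Z \<gamma> \<kappa> j z \<zeta> .
  show "isomorphic C (Ys d) (Ys 0) \<longleftrightarrow> isomorphic C (Xs d) (Xs 0)"
    using period_reflect[OF seq' Y0] period_preserve[OF seq' Y0] by blast
  show "multiplicity C P' (B' c) = multiplicity C P (B (c - 1))" using multiplicity_P'[OF seq' Y0] .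
  show "l \<in> V \<Longrightarrow> \<not> retract l E \<Longrightarrow> multiplicity C l (B' c) = multiplicity C l (B c)"
    using multiplicity_V[OF seq' Y0] .
qed

end

section \<open>Coloured quivers\<close>

lemma mod_in_colours: "c mod int d \<in> colours d"
  unfolding colours_def by simp

lemma zero_in_colours: "0 \<in> colours d"
  unfolding colours_def by simp

lemma periodicity_cong:
  assumes "\<And>d. isomorphic C (Xs d) (Xs 0) \<longleftrightarrow> isomorphic C (Ys d) (Ys 0)"
  shows "periodicity C Xs = periodicity C Ys"
  unfolding periodicity_def assms ..

context krull_schmidt_triangulated
begin

lemma periodicity_isomorphic:
  assumes "periodicity C Xs = d" "d > 0"
  shows "isomorphic C (Xs (int d)) (Xs 0)"
proof -
  have ex: "\<exists>d>0. isomorphic C (Xs (int d)) (Xs 0)"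
    using assms unfolding periodicity_def by (auto split: if_splits)
  then have "d = (LEAST d. d > 0 \<and> isomorphic C (Xs (int d)) (Xs 0))"
    using assms unfolding periodicity_def by simp
  then show ?thesis using LeastI_ex[OF ex] by simp
qed

lemma exchange_sequence_middle_periodic:
  assumes S: "exchange_sequence L Xs B f g h"
  shows "isomorphic C (B c) (B (c mod int (periodicity C Xs)))"
proof (cases "periodicity C Xs = 0")
  case True
  then show ?thesis
    using isomorphic_refl triD(5)[OF exchange_triD(1)[OF exchange_sequenceD[OF S]]] by simp
next
  case False
  define d where "d = periodicity C Xs"
  have ob: "Xs c \<in> Ob C" for c using triD(4)[OF exchange_triD(1)[OF exchange_sequenceD[OF S]]] .
  have d: "isomorphic C (Xs (int d)) (Xs 0)"
    using periodicity_isomorphic[of Xs d] False unfolding d_def by simp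
  have "isomorphic C (Xs (q * int d)) (Xs 0)" for q
  proof (induction q rule: int_induct[where k = 0])
    case base
    show ?case using isomorphic_refl[OF ob] by simp
  next
    case (step1 q)
    have "isomorphic C (Xs ((q + 1) * int d)) (Xs (q * int d))"
      using exchange_sequence_unique_first[OF S S d, of "q * int d"] by (simp add: algebra_simps)
    then show ?case using isomorphic_trans[OF _ step1(2) ob ob ob] by blast
  next
    case (step2 q)
    have "isomorphic C (Xs (q * int d)) (Xs ((q - 1) * int d))"
      using exchange_sequence_unique_first[OF S S d, of "(q - 1) * int d"] by (simp add: algebra_simps)
    then show ?case using isomorphic_trans[OF isomorphic_sym step2(2) ob ob ob] by blast
  qed
  then have "isomorphic C (B (c div int d * int d + c mod int d)) (B (0 + c mod int d))"
    using exchange_sequence_unique[OF S S] by blast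
  then show ?thesis unfolding d_def by simp
qed

lemma exchange_triangles_iff:
  fixes I :: "nat set"
  assumes "direct_sum_of C I Rs U" "\<And>l. l \<in> I \<Longrightarrow> local_object (Rs l)"
  shows "exchange_triangles C U X Xs B f g h \<longleftrightarrow> Xs 0 = X \<and> exchange_sequence (Rs ` I) Xs B f g h"
proof -
  have "add_closure C U = Add (Rs ` I)" using add_closure_eq_Add assms by blast
  then show ?thesis
    unfolding exchange_triangles_def exchange_sequence_def exchange_tri_def by simp
qed

lemma coloured_quiverE:
  assumes Q: "has_coloured_quiver C m Rs Q" and loc: "\<forall>l\<in>{1..m}. local_object (Rs l)"
    and i: "i \<in> {1..m}"
  obtains Xs B f g h where "exchange_sequence (Rs ` ({1..m} - {i})) Xs B f g h" "Xs 0 = Rs i"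
    "period Q i = periodicity C Xs"
    "\<forall>j\<in>{1..m}. \<forall>c\<in>colours (period Q i). arrows Q c i j = multiplicity C (Rs j) (B c)"
proof -
  obtain U Xs B f g h where U: "direct_sum_of C ({1..m} - {i}) Rs U"
    and X: "exchange_triangles C U (Rs i) Xs B f g h" and p: "period Q i = periodicity C Xs"
    and a: "\<forall>j\<in>{1..m}. \<forall>c\<in>colours (period Q i). arrows Q c i j = multiplicity C (Rs j) (B c)"
    using Q i unfolding has_coloured_quiver_def by blast
  have "Xs 0 = Rs i \<and> exchange_sequence (Rs ` ({1..m} - {i})) Xs B f g h"
    using exchange_triangles_iff[OF U] X loc by blast
  then show ?thesis using that p a by blast
qed

text \<open>
  An indecomposable object outside the generators of the additive closure does not occur in a
  middle term. This settles the arrows whose source and target coincide.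
\<close>

lemma no_loops:
  assumes S: "exchange_sequence L Xs B f g h" and l: "local_object l"
    and new: "\<And>A. A \<in> L \<Longrightarrow> \<not> isomorphic C l A"
  shows "multiplicity C l (B c) = 0"
  using multiplicity_eq_0_iff[OF l Add_ob] AddD[OF _ l] new exchange_triD(6)[OF exchange_sequenceD[OF S]]
  by metis

end

theorem theorem18:
  fixes C :: "('o, 'a::ab_group_add, 'k::field) triangulated_cat"
    and m k :: nat
    and Rs Rs' :: "nat \<Rightarrow> 'o"
    and R :: 'o
    and Q Q' :: coloured_quiver
  assumes "triangulated_category C"
    and "hom_finite C"
    and "krull_schmidt C"
    and "calabi_yau2 C"
    and "basic_rigid_decomposition C m Rs R"
    and "has_coloured_quiver C m Rs Q"
    and "k \<in> vertices Q"
    and "is_mutation C m Rs k Rs'"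
    and "has_coloured_quiver C m Rs' Q'"
  shows
    "(period Q k = period Q' k \<and>
      (\<forall>j \<in> vertices Q. \<forall>c \<in> colours (period Q k).
         arrows Q' c k j = arrows Q ((c + 1) mod int (period Q k)) k j)) \<and>
     (\<forall>i \<in> vertices Q. \<forall>j \<in> vertices Q.
        i \<noteq> k \<longrightarrow> j \<noteq> k \<longrightarrow> arrows Q 0 k j = 0 \<longrightarrow> arrows Q 0 k i = 0 \<longrightarrow>
        period Q' i = period Q i \<and> period Q' j = period Q j \<and>
        (\<forall>c \<in> colours (period Q j).
           arrows Q' c j k = arrows Q ((c - 1) mod int (period Q j)) j k) \<and>
        (\<forall>c \<in> colours (period Q i).
           arrows Q' c i j = arrows Q c i j))"
proof -
  interpret triangulated_category C by fact
  interpret krull_schmidt_triangulated C by unfold_locales fact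
  define J where "J = {1..m}"
  have vert: "vertices Q = J" using assms(6) unfolding has_coloured_quiver_def J_def by blast
  then have kJ: "k \<in> J" using assms(7) by simp
  note R = assms(5)[unfolded basic_rigid_decomposition_def indecomposable_iff_local, folded J_def]
  have loc: "local_object (Rs i)" if "i \<in> J" for i using R that by blast
  then have locs: "\<forall>i\<in>J. local_object (Rs i)" by blast
  have new: "\<not> isomorphic C (Rs i) (Rs j)" if "i \<in> J" "j \<in> J" "i \<noteq> j" for i j using R that by blast
  obtain \<iota> \<pi> where bR: "biproduct J Rs R \<iota> \<pi>" using R direct_sum_iff_biproduct by blast
  have "ext_zero R R" using R unfolding rigid_def ext_zero_def hom_def by auto
  then have ext: "ext_zero (Rs i) (Rs j)" if "i \<in> J" "j \<in> J" for i j
    using ext_zero_retract_left ext_zero_retract_right biproduct_retract[OF bR] that by blast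

  obtain U where U: "direct_sum_of C (J - {k}) Rs U" "is_twist C U (Rs k) (Rs' k)"
    and same: "\<And>i. i \<in> J - {k} \<Longrightarrow> Rs' i = Rs i"
    using assms(8) unfolding is_mutation_def J_def by blast
  (* The exchange sequence that defines the mutation; the quiver may use another choice of it. *)
  obtain Ts Bt ft gt ht where T: "exchange_triangles C U (Rs k) Ts Bt ft gt ht" "Ts 1 = Rs' k"
    using U(2) unfolding is_twist_def by blast
  then have T0: "Ts 0 = Rs k" and St: "exchange_sequence (Rs ` (J - {k})) Ts Bt ft gt ht"
    using exchange_triangles_iff[OF U(1)] loc by blast+
  have P': "local_object (Rs' k)" using exchange_sequence_local[OF St, of 1] T0 T(2) loc[OF kJ] by simp
  have loc': "local_object (Rs' i)" if "i \<in> J" for i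
    using that P' same[of i] loc by (cases "i = k") auto
  then have locs': "\<forall>i\<in>J. local_object (Rs' i)" by blast
  (* The new summand is the term of index 1, and no term of an exchange sequence meets the closure. *)
  have P'new: "\<not> isomorphic C (Rs' k) (Rs l)" if l: "l \<in> J - {k}" for l
  proof
    assume "isomorphic C (Rs' k) (Rs l)"
    then have "retract (Rs l) (Ts 1)"
      using isomorphic_retract[OF isomorphic_sym] T(2) local_object_ob loc l P' by auto
    then show False
      using exchange_sequence_no_retract[OF St Add_generator] loc l local_object_nonzero by blast
  qed
  have extk: "ext_zero A A'" if "A \<in> Rs ` (J - {k})" "A' \<in> Rs ` (J - {k})" for A A'
    using ext that by blast
  have P'ext: "ext_zero (Rs' k) (Rs l)" if "l \<in> J - {k}" for l
    using ext_zero_third[OF exchange_sequenceD[OF St, of 0] extk, of "Rs l"] T(2) that loc by auto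
  have extP': "ext_zero (Rs l) (Rs' k)" if "l \<in> J - {k}" for l
    using ext_zero_first[OF exchange_sequenceD[OF St, of 1] extk, of "Rs l"] T(2) that loc by auto

  obtain Xs B f g h where S: "exchange_sequence (Rs ` (J - {k})) Xs B f g h" and X0: "Xs 0 = Rs k"
    and per: "period Q k = periodicity C Xs"
    and arr: "\<forall>j\<in>J. \<forall>c\<in>colours (period Q k). arrows Q c k j = multiplicity C (Rs j) (B c)"
    using coloured_quiverE[OF assms(6) locs[unfolded J_def] kJ[unfolded J_def], folded J_def] .
  have imk: "Rs' ` (J - {k}) = Rs ` (J - {k})" using same by force
  obtain Xs' B' f' g' h' where S': "exchange_sequence (Rs ` (J - {k})) Xs' B' f' g' h'"
    and X0': "Xs' 0 = Rs' k" and per': "period Q' k = periodicity C Xs'"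
    and arr': "\<forall>j\<in>J. \<forall>c\<in>colours (period Q' k). arrows Q' c k j = multiplicity C (Rs' j) (B' c)"
    using coloured_quiverE[OF assms(9) locs'[unfolded J_def] kJ[unfolded J_def], folded J_def]
    unfolding imk .
  have ob: "Xs c \<in> Ob C" "Xs' c \<in> Ob C" "B c \<in> Ob C" "B' c \<in> Ob C" "Bt c \<in> Ob C" for c
    using triD(4,5)[OF exchange_triD(1)[OF exchange_sequenceD[OF S]]]
      triD(4,5)[OF exchange_triD(1)[OF exchange_sequenceD[OF S']]]
      triD(5)[OF exchange_triD(1)[OF exchange_sequenceD[OF St]]] by blast+
  have XT: "isomorphic C (Xs 0) (Ts 0)" using X0 T0 isomorphic_refl[OF ob(1)[of 0]] by simp
  (* Uniqueness turns this one isomorphism into a shift of the whole sequence. *)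
  have "isomorphic C (Xs 1) (Xs' 0)"
    using exchange_sequence_unique_first[OF S St XT, of 1] T(2) X0' by simp
  then have shift: "isomorphic C (Xs (1 + n)) (Xs' n)" "isomorphic C (B (1 + n)) (B' n)" for n
    using exchange_sequence_unique[OF S S', of 1 0 n] by auto
  have "isomorphic C (Xs d) (Xs 0) \<longleftrightarrow> isomorphic C (Xs' d) (Xs' 0)" for d
  proof
    assume "isomorphic C (Xs d) (Xs 0)"
    then have "isomorphic C (Xs (1 + d)) (Xs (1 + 0))"
      using exchange_sequence_unique_first[OF S S, of d 0 1] by (simp add: add.commute)
    then show "isomorphic C (Xs' d) (Xs' 0)"
      using shift(1) isomorphic_trans isomorphic_sym ob by metis
  next
    assume "isomorphic C (Xs' d) (Xs' 0)"
    then have "isomorphic C (Xs (1 + d)) (Xs (1 + 0))"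
      using shift(1) isomorphic_trans isomorphic_sym ob by metis
    then show "isomorphic C (Xs d) (Xs 0)"
      using exchange_sequence_unique_first[OF S S, of "1 + d" "1 + 0" "-1"] by simp
  qed
  then have pp: "period Q k = period Q' k" using periodicity_cong per per' by metis
  have "arrows Q' c k j = arrows Q ((c + 1) mod int (period Q k)) k j"
    if j: "j \<in> J" and c: "c \<in> colours (period Q k)" for j c
  proof (cases "j = k")
    case True
    have "multiplicity C (Rs' k) (B' c) = 0" using no_loops[OF S' P'] P'new by blast
    moreover have "multiplicity C (Rs k) (B ((c + 1) mod int (period Q k))) = 0"
      using no_loops[OF S loc[OF kJ]] new kJ by blast
    ultimately show ?thesis using arr arr' pp True mod_in_colours kJ c by simp
  next
    case False
    have "multiplicity C (Rs j) (B' c) = multiplicity C (Rs j) (B (c + 1))"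
      using multiplicity_isomorphic[OF loc[OF j] shift(2) ob(3,4), of c] by (simp add: add.commute)
    also have "\<dots> = multiplicity C (Rs j) (B ((c + 1) mod int (period Q k)))"
      using multiplicity_isomorphic[OF loc[OF j] exchange_sequence_middle_periodic[OF S] ob(3,3)] per
      by simp
    finally show ?thesis using arr arr' pp j c mod_in_colours same[of j] False by simp
  qed
  then have part1: "period Q k = period Q' k \<and> (\<forall>j \<in> vertices Q. \<forall>c \<in> colours (period Q k).
      arrows Q' c k j = arrows Q ((c + 1) mod int (period Q k)) k j)"
    using pp vert by simp

  (* An arrow of colour 0 out of k counts a summand of the object E of the twist triangle. *)
  have noE: "\<not> retract (Rs i) (Bt 0)" if i: "i \<in> J" and 0: "arrows Q 0 k i = 0" for i
  proof -
    have "isomorphic C (B 0) (Bt 0)" using exchange_sequence_unique[OF S St XT, of 0] by simp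
    then have "multiplicity C (Rs i) (Bt 0) = 0"
      using multiplicity_isomorphic[OF loc[OF i] _ ob(3,5)] arr i zero_in_colours 0 by simp
    then show ?thesis using multiplicity_eq_0_iff[OF loc[OF i] ob(5)] by simp
  qed
  have key: "period Q' i = period Q i \<and>
      (\<forall>c \<in> colours (period Q i). arrows Q' c i k = arrows Q ((c - 1) mod int (period Q i)) i k) \<and>
      (\<forall>j \<in> J. j \<noteq> k \<longrightarrow> arrows Q 0 k j = 0 \<longrightarrow>
        (\<forall>c \<in> colours (period Q i). arrows Q' c i j = arrows Q c i j))"
    if i: "i \<in> J" and ik: "i \<noteq> k" and 0: "arrows Q 0 k i = 0" for i
  proof -
    define V where "V = Rs ` (J - {i, k})"
    have V: "Rs ` (J - {i}) = insert (Rs k) V" unfolding V_def using kJ ik by blast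
    have V': "Rs' ` (J - {i}) = insert (Rs' k) V" unfolding V_def using kJ ik same by force
    obtain Xi Bi fi gi hi where Si: "exchange_sequence (insert (Rs k) V) Xi Bi fi gi hi"
      and Xi0: "Xi 0 = Rs i" and peri: "period Q i = periodicity C Xi"
      and arri: "\<forall>j\<in>J. \<forall>c\<in>colours (period Q i). arrows Q c i j = multiplicity C (Rs j) (Bi c)"
      using coloured_quiverE[OF assms(6) locs[unfolded J_def] i[unfolded J_def], folded J_def]
      unfolding V .
    obtain Yi Di fi' gi' hi' where Si': "exchange_sequence (insert (Rs' k) V) Yi Di fi' gi' hi'"
      and Yi0: "Yi 0 = Rs' i" and peri': "period Q' i = periodicity C Yi"
      and arri': "\<forall>j\<in>J. \<forall>c\<in>colours (period Q' i). arrows Q' c i j = multiplicity C (Rs' j) (Di c)"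
      using coloured_quiverE[OF assms(9) locs'[unfolded J_def] i[unfolded J_def], folded J_def]
      unfolding V' .
    have Bt: "Bt 0 \<in> Add V"
    proof -
      have "\<exists>A\<in>V. isomorphic C X A" if X: "local_object X" and re: "retract X (Bt 0)" for X
      proof -
        obtain l where l: "l \<in> J - {k}" "isomorphic C X (Rs l)"
          using AddD[OF exchange_triD(6)[OF exchange_sequenceD[OF St, of 0]] X re] by blast
        have "l \<noteq> i"
          using noE[OF i 0] retract_trans[OF isomorphic_retract[OF isomorphic_sym[OF l(2)]] re]
            local_object_ob[OF X] local_object_ob[OF loc[OF i]] by blast
        then show ?thesis using l unfolding V_def by blast
      qed
      then show ?thesis unfolding Add_def using ob(5) by blast
    qed
    have tw: "Tri C (Rs k) (Bt 0) (Rs' k) (ft 0) (gt 0) (ht 0)"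
      using exchange_triD(1)[OF exchange_sequenceD[OF St, of 0]] T0 T(2) by simp
    interpret compatible_twist C V "Rs k" "Bt 0" "Rs' k" "ft 0" "gt 0" "ht 0" Xi Bi fi gi hi
    proof
      show "local_object A" if "A \<in> V" for A using that loc unfolding V_def by blast
      show "local_object (Rs k)" "local_object (Rs' k)" using loc kJ P' by blast+
      show "\<not> isomorphic C (Rs k) A" if "A \<in> V" for A using that new kJ unfolding V_def by blast
      show "\<not> isomorphic C (Rs' k) A" if "A \<in> V" for A using that P'new unfolding V_def by blast
      show "ext_zero A A'" if "A \<in> insert (Rs k) V" "A' \<in> insert (Rs k) V" for A A'
        using that ext kJ unfolding V_def by blast
      show "Tri C (Rs k) (Bt 0) (Rs' k) (ft 0) (gt 0) (ht 0)" using tw .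
      show "Bt 0 \<in> Add V" using Bt .
      show "ext_zero (Rs' k) A" "ext_zero A (Rs' k)" if "A \<in> V" for A
        using that P'ext extP' unfolding V_def by blast+
      show "ext_zero (Rs' k) (Xi 0)" using P'ext i ik Xi0 by simp
      show "local_object (Xi 0)" using loc[OF i] Xi0 by simp
      show "exchange_sequence (insert (Rs k) V) Xi Bi fi gi hi" using Si .
    qed
    have "Yi 0 = Xi 0" using Yi0 Xi0 same i ik by simp
    note after = exchange_sequence_after_twist[OF Si' this]
    have obi: "Bi c \<in> Ob C" for c using triD(5)[OF exchange_triD(1)[OF exchange_sequenceD[OF Si]]] .
    have pi: "period Q' i = period Q i" using periodicity_cong[of C Yi Xi] after(1) peri peri' by simp
    have 1: "arrows Q' c i k = arrows Q ((c - 1) mod int (period Q i)) i k"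
      if c: "c \<in> colours (period Q i)" for c
    proof -
      have "multiplicity C (Rs k) (Bi (c - 1)) =
          multiplicity C (Rs k) (Bi ((c - 1) mod int (period Q i)))"
        using multiplicity_isomorphic[OF loc[OF kJ] exchange_sequence_middle_periodic[OF Si] obi obi] peri
        by simp
      then show ?thesis using arri arri' after(2) pi kJ c mod_in_colours by simp
    qed
    have 2: "arrows Q' c i j = arrows Q c i j"
      if j: "j \<in> J" and jk: "j \<noteq> k" and 0: "arrows Q 0 k j = 0" and c: "c \<in> colours (period Q i)" for j c
    proof -
      (* The case j = i is allowed; then neither middle term contains R_i. *)
      have "multiplicity C (Rs j) (Di c) = multiplicity C (Rs j) (Bi c)"
      proof (cases "j = i")
        case True
        have "\<not> isomorphic C (Rs i) A" if "A \<in> insert (Rs k) V" for A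
          using that new i ik kJ unfolding V_def by blast
        moreover have "\<not> isomorphic C (Rs i) A" if "A \<in> insert (Rs' k) V" for A
          using that new i ik kJ P'new[of i] isomorphic_sym unfolding V_def by blast
        ultimately show ?thesis using no_loops[OF Si loc[OF i]] no_loops[OF Si' loc[OF i]] True by simp
      next
        case False
        then have "Rs j \<in> V" unfolding V_def using j jk by blast
        then show ?thesis using after(3) noE[OF j 0] by blast
      qed
      then show ?thesis using arri arri' pi j jk c same[of j] by simp
    qed
    show ?thesis using pi 1 2 by blast
  qed
  show ?thesis using part1 key unfolding vert by blast
qed

end
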